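(* Let $K$ be an algebraically closed field of characteristic not $2$, let $a\in K$, and let $N\ge 2$ be an integer for which $P_{N,a}$ is nonsingular. Then the gonality of $\bar P_{N,a}$ (the minimum degree of a non-constant morphism $\bar P_{N,a}\to\mathbb{P}^1$) is $2^{N-2}$.
   Context: $f_c(x)=x^2+c$, $f_c^N$ its $N$-th iterate, viewed with $c$ an indeterminate. For $a\in K$, $P_{N,a}\subset\mathbb{A}^2$ (coordinates $(x,c)$) is the algebraic set defined by $f_c^N(x)-a=0$; if nonsingular it is irreducible, and $\bar P_{N,a}$ denotes the completion of its normalization. *)

theory Defs
  imports "HOL-Algebra.Algebraic_Closure_Type"
begin

section \<open>The plane curves \<open>f\<^sub>c\<^sup>N(x) = a\<close>\<close>

text \<open>
  The ring \<open>K[x,c]\<close> is rendered as \<^typ>\<open>'k poly poly\<close>: the outer variable is \<open>x\<close>, the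
  coefficients are polynomials in \<open>c\<close>.
\<close>

definition quad_map :: "'r::comm_ring_1 \<Rightarrow> 'r \<Rightarrow> 'r" where
  "quad_map c z = z\<^sup>2 + c"

definition eval_xc :: "'k::comm_ring_1 poly poly \<Rightarrow> 'k \<Rightarrow> 'k \<Rightarrow> 'k" where
  "eval_xc p x c = poly (poly p [:x:]) c"

definition preimage_poly :: "nat \<Rightarrow> 'k::comm_ring_1 \<Rightarrow> 'k poly poly" where
  "preimage_poly N a = (quad_map [:[:0, 1:]:] ^^ N) [:0, 1:] - [:[:a:]:]"

definition preimage_curve :: "nat \<Rightarrow> 'k::field \<Rightarrow> ('k \<times> 'k) set" where
  "preimage_curve N a = {(x, c). eval_xc (preimage_poly N a) x c = 0}"

text \<open>
  Jacobian criterion. In characteristic different from 2 the polynomial \<open>f\<^sub>c\<^sup>N(x) - a\<close> is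
  squarefree, so over an algebraically closed field it generates the vanishing ideal of the curve.
\<close>

definition preimage_curve_nonsingular :: "nat \<Rightarrow> 'k::field \<Rightarrow> bool" where
  "preimage_curve_nonsingular N a \<longleftrightarrow>
     (\<forall>(x, c) \<in> preimage_curve N a.
        \<not> (eval_xc (pderiv (preimage_poly N a)) x c = 0 \<and>
           eval_xc (map_poly pderiv (preimage_poly N a)) x c = 0))"


section \<open>Function fields\<close>

definition frac_rel :: "('r, 'm) ring_scheme \<Rightarrow> (('r \<times> 'r) \<times> ('r \<times> 'r)) set" where
  "frac_rel R = {((a, b), (c, d)).
     a \<in> carrier R \<and> b \<in> carrier R - {\<zero>\<^bsub>R\<^esub>} \<and> c \<in> carrier R \<and> d \<in> carrier R - {\<zero>\<^bsub>R\<^esub>} \<and>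
     a \<otimes>\<^bsub>R\<^esub> d = c \<otimes>\<^bsub>R\<^esub> b}"

definition frac_class :: "('r, 'm) ring_scheme \<Rightarrow> 'r \<Rightarrow> 'r \<Rightarrow> ('r \<times> 'r) set" where
  "frac_class R a b = frac_rel R `` {(a, b)}"

text \<open>The field of fractions; meaningful when \<open>R\<close> is an integral domain.\<close>

definition fraction_field :: "('r, 'm) ring_scheme \<Rightarrow> ('r \<times> 'r) set ring" where
  "fraction_field R =
     \<lparr> carrier = (carrier R \<times> (carrier R - {\<zero>\<^bsub>R\<^esub>})) // frac_rel R,
       monoid.mult = (\<lambda>p q. \<Union>(a, b)\<in>p. \<Union>(c, d)\<in>q. frac_class R (a \<otimes>\<^bsub>R\<^esub> c) (b \<otimes>\<^bsub>R\<^esub> d)),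
       one = frac_class R \<one>\<^bsub>R\<^esub> \<one>\<^bsub>R\<^esub>,
       ring.zero = frac_class R \<zero>\<^bsub>R\<^esub> \<one>\<^bsub>R\<^esub>,
       add = (\<lambda>p q. \<Union>(a, b)\<in>p. \<Union>(c, d)\<in>q.
                frac_class R (a \<otimes>\<^bsub>R\<^esub> d \<oplus>\<^bsub>R\<^esub> c \<otimes>\<^bsub>R\<^esub> b) (b \<otimes>\<^bsub>R\<^esub> d)) \<rparr>"

definition preimage_ideal :: "nat \<Rightarrow> 'k::field \<Rightarrow> 'k poly poly set" where
  "preimage_ideal N a = cgenideal ring_of_type_algebra (preimage_poly N a)"

definition coordinate_ring :: "nat \<Rightarrow> 'k::field \<Rightarrow> 'k poly poly set ring" where
  "coordinate_ring N a = FactRing ring_of_type_algebra (preimage_ideal N a)"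

definition function_field ::
    "nat \<Rightarrow> 'k::field \<Rightarrow> ('k poly poly set \<times> 'k poly poly set) set ring" where
  "function_field N a = fraction_field (coordinate_ring N a)"

definition constant_function ::
    "nat \<Rightarrow> 'k::field \<Rightarrow> 'k \<Rightarrow> ('k poly poly set \<times> 'k poly poly set) set" where
  "constant_function N a t =
     frac_class (coordinate_ring N a)
       (preimage_ideal N a +>\<^bsub>ring_of_type_algebra\<^esub> [:[:t:]:]) \<one>\<^bsub>coordinate_ring N a\<^esub>"


section \<open>The complete nonsingular curve of a function field\<close>

text \<open>
  Let \<open>F\<close> be a function field in one variable over \<open>K\<close>, with \<open>\<iota>\<close> embedding \<open>K\<close> into \<open>F\<close>. The
  complete nonsingular curve with function field \<open>F\<close>, which is the completion of the normalization
  of any curve with this function field, is taken to be the abstract nonsingular curve of \<open>F\<close>. Its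
  points are the valuation rings of \<open>F/K\<close> (which are all discrete), its proper closed subsets are
  the finite sets, and the regular functions on an open \<open>U\<close> are the elements of the intersection
  of the valuation rings in \<open>U\<close>, whose value at \<open>P\<close> is the class in the residue field, which is
  \<open>K\<close> when \<open>K\<close> is algebraically closed.
\<close>

definition curve_points :: "('f, 'm) ring_scheme \<Rightarrow> ('k \<Rightarrow> 'f) \<Rightarrow> 'f set set" where
  "curve_points F \<iota> =
     {P. subring P F \<and> range \<iota> \<subset> P \<and> P \<subset> carrier F \<and>
         (\<forall>z \<in> carrier F - {\<zero>\<^bsub>F\<^esub>}. z \<in> P \<or> inv\<^bsub>F\<^esub> z \<in> P)}"

definition max_ideal_at :: "('f, 'm) ring_scheme \<Rightarrow> 'f set \<Rightarrow> 'f set" where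
  "max_ideal_at F P = P - Units (F\<lparr>carrier := P\<rparr>)"

definition has_value_at ::
    "('f, 'm) ring_scheme \<Rightarrow> ('k \<Rightarrow> 'f) \<Rightarrow> 'f set \<Rightarrow> 'f \<Rightarrow> 'k \<Rightarrow> bool" where
  "has_value_at F \<iota> P h t \<longleftrightarrow> h \<in> P \<and> h \<ominus>\<^bsub>F\<^esub> \<iota> t \<in> max_ideal_at F P"

definition curve_closed :: "('f, 'm) ring_scheme \<Rightarrow> ('k \<Rightarrow> 'f) \<Rightarrow> 'f set set \<Rightarrow> bool" where
  "curve_closed F \<iota> Z \<longleftrightarrow> Z \<subseteq> curve_points F \<iota> \<and> (finite Z \<or> Z = curve_points F \<iota>)"

definition curve_regular_on ::
    "('f, 'm) ring_scheme \<Rightarrow> ('k \<Rightarrow> 'f) \<Rightarrow> 'f set set \<Rightarrow> ('f set \<Rightarrow> 'k) \<Rightarrow> bool" where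
  "curve_regular_on F \<iota> U r \<longleftrightarrow> (\<exists>h \<in> carrier F. \<forall>P \<in> U. has_value_at F \<iota> P h (r P))"


section \<open>The projective line\<close>

definition hom_point :: "'k::field \<Rightarrow> 'k \<Rightarrow> ('k \<times> 'k) set" where
  "hom_point u v = {(l * u, l * v) | l. l \<noteq> 0}"

definition proj_line :: "('k::field \<times> 'k) set set" where
  "proj_line = {hom_point u v | u v. (u, v) \<noteq> (0, 0)}"

definition binary_form :: "nat \<Rightarrow> (nat \<Rightarrow> 'k::field) \<Rightarrow> 'k \<Rightarrow> 'k \<Rightarrow> 'k" where
  "binary_form d b u v = (\<Sum>i\<le>d. b i * u ^ i * v ^ (d - i))"

definition proj_line_closed :: "('k::field \<times> 'k) set set \<Rightarrow> bool" where
  "proj_line_closed Z \<longleftrightarrow>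
     (\<exists>S. Z = {hom_point u v | u v.
                (u, v) \<noteq> (0, 0) \<and> (\<forall>(d, b) \<in> S. binary_form d b u v = 0)})"

definition proj_line_open :: "('k::field \<times> 'k) set set \<Rightarrow> bool" where
  "proj_line_open V \<longleftrightarrow> V \<subseteq> proj_line \<and> proj_line_closed (proj_line - V)"

definition proj_line_regular_on ::
    "('k::field \<times> 'k) set set \<Rightarrow> (('k \<times> 'k) set \<Rightarrow> 'k) \<Rightarrow> bool" where
  "proj_line_regular_on V g \<longleftrightarrow>
     (\<forall>Q \<in> V. \<exists>U. proj_line_open U \<and> Q \<in> U \<and> U \<subseteq> V \<and>
        (\<exists>d A B. \<forall>u v. (u, v) \<noteq> (0, 0) \<and> hom_point u v \<in> U \<longrightarrow>
            binary_form d B u v \<noteq> 0 \<and>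
            g (hom_point u v) = binary_form d A u v / binary_form d B u v))"


section \<open>Morphisms to the projective line and gonality\<close>

definition curve_preimage ::
    "('f, 'm) ring_scheme \<Rightarrow> ('k \<Rightarrow> 'f) \<Rightarrow> ('f set \<Rightarrow> ('k \<times> 'k) set) \<Rightarrow>
     ('k \<times> 'k) set set \<Rightarrow> 'f set set" where
  "curve_preimage F \<iota> \<phi> V = {P \<in> curve_points F \<iota>. \<phi> P \<in> V}"

definition morphism_to_proj_line ::
    "('f, 'm) ring_scheme \<Rightarrow> ('k::field \<Rightarrow> 'f) \<Rightarrow> ('f set \<Rightarrow> ('k \<times> 'k) set) \<Rightarrow> bool" where
  "morphism_to_proj_line F \<iota> \<phi> \<longleftrightarrow>
     (\<forall>P \<in> curve_points F \<iota>. \<phi> P \<in> proj_line) \<and>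
     (\<forall>Z. proj_line_closed Z \<longrightarrow> curve_closed F \<iota> (curve_preimage F \<iota> \<phi> Z)) \<and>
     (\<forall>V g. proj_line_open V \<and> proj_line_regular_on V g \<longrightarrow>
        curve_regular_on F \<iota> (curve_preimage F \<iota> \<phi> V) (g \<circ> \<phi>))"

definition nonconstant_on_curve ::
    "('f, 'm) ring_scheme \<Rightarrow> ('k \<Rightarrow> 'f) \<Rightarrow> ('f set \<Rightarrow> 'q) \<Rightarrow> bool" where
  "nonconstant_on_curve F \<iota> \<phi> \<longleftrightarrow> (\<exists>P \<in> curve_points F \<iota>. \<exists>Q \<in> curve_points F \<iota>. \<phi> P \<noteq> \<phi> Q)"

text \<open>
  The image of the function field of the projective line under \<open>\<phi>\<^sup>*\<close>, for a nonconstant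
  morphism \<open>\<phi>\<close>: rational functions on the line are regular functions on nonempty open sets.
\<close>

definition pullback_field ::
    "('f, 'm) ring_scheme \<Rightarrow> ('k::field \<Rightarrow> 'f) \<Rightarrow> ('f set \<Rightarrow> ('k \<times> 'k) set) \<Rightarrow> 'f set" where
  "pullback_field F \<iota> \<phi> =
     {h \<in> carrier F. \<exists>V g. proj_line_open V \<and> V \<noteq> {} \<and> proj_line_regular_on V g \<and>
        (\<forall>P \<in> curve_preimage F \<iota> \<phi> V. has_value_at F \<iota> P h (g (\<phi> P)))}"

definition has_morphism_degree ::
    "('f, 'm) ring_scheme \<Rightarrow> ('k::field \<Rightarrow> 'f) \<Rightarrow> ('f set \<Rightarrow> ('k \<times> 'k) set) \<Rightarrow> nat \<Rightarrow> bool" where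
  "has_morphism_degree F \<iota> \<phi> n \<longleftrightarrow> ring.dimension F n (pullback_field F \<iota> \<phi>) (carrier F)"

definition gonality :: "('f, 'm) ring_scheme \<Rightarrow> ('k::field \<Rightarrow> 'f) \<Rightarrow> nat" where
  "gonality F \<iota> =
     (LEAST n. \<exists>\<phi>. morphism_to_proj_line F \<iota> \<phi> \<and> nonconstant_on_curve F \<iota> \<phi> \<and>
                   has_morphism_degree F \<iota> \<phi> n)"

end

theory Submission
  imports Defs "Jordan_Normal_Form.Char_Poly"
begin

text \<open>
  Write \<open>z\<^sub>i = f\<^sub>c\<^sup>i(x)\<close>, so that the function field is \<open>F = K(x, c)\<close> with \<open>z\<^sub>N = a\<close>.

  Upper bound: \<open>u = z\<^sub>N\<^sub>-\<^sub>2\<close> and \<open>v = z\<^sub>N\<^sub>-\<^sub>1\<close> satisfy \<open>u\<^sup>2 = v\<^sup>2 + v - a\<close>, a conic parametrized by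
  \<open>t = u - v\<close>. Since \<open>c = a - v\<^sup>2\<close> lies in \<open>K(t)\<close> and \<open>x\<close> is a root of \<open>f\<^sub>c\<^sup>N\<^sup>-\<^sup>2(X) - u\<close>, the function \<open>t\<close>
  has degree at most \<open>2\<^sup>N\<^sup>-\<^sup>2\<close>.

  Lower bound, by induction on \<open>N\<close> (the argument of Castelnuovo's inequality for the double
  cover \<open>x \<mapsto> x\<^sup>2 + c\<close>): let \<open>\<sigma>\<close> be the involution \<open>x \<mapsto> -x\<close> and let \<open>h\<close> be a nonconstant function of
  degree \<open>n\<close>. If \<open>\<sigma> h = h\<close>, then \<open>h\<close> lies in the function field for \<open>N - 1\<close>, which has index 2 in
  \<open>F\<close>. Otherwise we may replace \<open>h\<close> by some \<open>1/(h - s)\<close> without poles at the fixed points of \<open>\<sigma>\<close>. Then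
  \<open>h - \<sigma> h\<close> has degree at most \<open>2n\<close> and vanishes at these fixed points, that is, at the \<open>2\<^sup>N\<^sup>-\<^sup>1\<close> points
  with \<open>x = 0\<close>; they are distinct because the curve is nonsingular there. Hence \<open>2\<^sup>N\<^sup>-\<^sup>1 \<le> 2n\<close>.

  The points come from power series: a parametrization \<open>(x(s), c(s))\<close> of the curve embeds \<open>F\<close> into
  \<open>K((s))\<close>, and the functions without a pole at \<open>s = 0\<close> form a valuation ring.
\<close>

section \<open>Polynomials over an algebraically closed field\<close>

lemma alg_closed_poly_induct [case_names const linear_factor]:
  fixes p :: "'k::alg_closed_field poly"
  assumes "\<And>b. P [:b:]" and "\<And>a q. q \<noteq> 0 \<Longrightarrow> P q \<Longrightarrow> P ([:- a, 1:] * q)"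
  shows "P p"
proof (induction "degree p" arbitrary: p)
  case 0
  then show ?case
    using assms(1) by (metis degree_0_id)
next
  case (Suc n)
  then obtain a where "poly p a = 0"
    by (metis alg_closed_imp_poly_has_root zero_less_Suc)
  then obtain q where q: "p = [:- a, 1:] * q"
    by (auto simp: poly_eq_0_iff_dvd)
  then have "q \<noteq> 0"
    using Suc.hyps(2) by auto
  then have "degree p = Suc (degree q)"
    unfolding q by (subst degree_mult_eq) auto
  then have "P q"
    using Suc.hyps by simp
  then show ?case
    unfolding q by (rule assms(2)[OF \<open>q \<noteq> 0\<close>])
qed

lemma infinite_UNIV_alg_closed_field: "infinite (UNIV :: 'k::alg_closed_field set)"
proof
  assume fin: "finite (UNIV :: 'k set)"
  define p where "p = (\<Prod>a\<in>UNIV. [:- a, 1 :: 'k:])"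
  have "degree p = card (UNIV :: 'k set)"
    unfolding p_def by (subst degree_prod_eq_sum_degree) auto
  then have "degree p > 0"
    using fin by (simp add: card_gt_0_iff)
  then have "degree (p + 1) > 0"
    by (subst degree_add_eq_left) auto
  then obtain x where "poly (p + 1) x = 0"
    using alg_closed_imp_poly_has_root by blast
  moreover have "poly p x = 0"
    unfolding p_def poly_prod using fin by (intro prod_zero) auto
  ultimately show False
    by simp
qed

lemma card_simple_roots_eq_degree:
  fixes p :: "'k::alg_closed_field poly"
  assumes "p \<noteq> 0" "\<And>b. poly p b = 0 \<Longrightarrow> poly (pderiv p) b \<noteq> 0"
  shows "card {b. poly p b = 0} = degree p"
  using assms
proof (induction p rule: alg_closed_poly_induct)
  case (linear_factor a q)
  have pderiv: "poly (pderiv ([:- a, 1:] * q)) s = (s - a) * poly (pderiv q) s + poly q s" for s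
    unfolding pderiv_mult by (simp add: pderiv_pCons algebra_simps)
  have "poly q a \<noteq> 0"
    using linear_factor.prems(2)[of a] pderiv[of a] by simp
  moreover have "card {s. poly q s = 0} = degree q"
  proof (rule linear_factor.IH[OF \<open>q \<noteq> 0\<close>])
    show "poly (pderiv q) s \<noteq> 0" if "poly q s = 0" for s
      using linear_factor.prems(2)[of s] pderiv[of s] that by simp
  qed
  moreover have "{s. poly ([:- a, 1:] * q) s = 0} = insert a {s. poly q s = 0}"
    by auto
  moreover have "degree ([:- a, 1:] * q) = Suc (degree q)"
    using \<open>q \<noteq> 0\<close> by (subst degree_mult_eq) auto
  ultimately show ?case
    by (simp add: poly_roots_finite[OF \<open>q \<noteq> 0\<close>])
qed simp

section \<open>Evaluation homomorphisms\<close>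

lemma comm_ring_hom_compose:
  assumes "comm_ring_hom \<phi>" "comm_ring_hom \<psi>"
  shows "comm_ring_hom (\<lambda>z. \<psi> (\<phi> z))"
proof -
  interpret \<phi>: comm_ring_hom \<phi> by fact
  interpret \<psi>: comm_ring_hom \<psi> by fact
  show ?thesis
    by unfold_locales (simp_all add: \<phi>.hom_add \<phi>.hom_mult \<psi>.hom_add \<psi>.hom_mult)
qed

lemma comm_ring_hom_const_poly: "comm_ring_hom (\<lambda>a. [:a:])"
  by unfold_locales (auto simp: one_pCons)

lemma comm_ring_hom_map_poly: "comm_ring_hom \<phi> \<Longrightarrow> comm_ring_hom (map_poly \<phi>)"
proof -
  assume "comm_ring_hom \<phi>"
  then interpret map_poly_comm_ring_hom \<phi>
    by (simp add: map_poly_comm_ring_hom_def)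
  show ?thesis ..
qed

definition eval_poly2 ::
    "('r::comm_ring_1 \<Rightarrow> 's::comm_ring_1) \<Rightarrow> 's \<Rightarrow> 's \<Rightarrow> 'r poly poly \<Rightarrow> 's" where
  "eval_poly2 \<phi> x c p = eval_poly (\<lambda>q. eval_poly \<phi> q c) p x"

lemma eval_poly2_0 [simp]: "eval_poly2 \<phi> x c 0 = 0"
  by (simp add: eval_poly2_def eval_poly_def)

context comm_ring_hom
begin

lemma eval_poly_pCons [simp]: "eval_poly hom (pCons a p) z = hom a + z * eval_poly hom p z"
  by (simp add: eval_poly_def map_poly_pCons_hom)

lemma eval_poly_1 [simp]: "eval_poly hom 1 z = 1"
  by (simp add: one_pCons)

lemma comm_ring_hom_eval_poly: "comm_ring_hom (\<lambda>p. eval_poly hom p z)"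
proof
  interpret map: map_poly_comm_ring_hom hom ..
  show "eval_poly hom (p * q) z = eval_poly hom p z * eval_poly hom q z" for p q
    by (simp add: eval_poly_def map.hom_mult)
qed (auto simp: one_pCons)

lemma eval_poly_uminus [simp]: "eval_poly hom (- p) z = - eval_poly hom p z"
proof -
  interpret eval: comm_ring_hom "\<lambda>p. eval_poly hom p z"
    by (rule comm_ring_hom_eval_poly)
  show ?thesis
    by (rule eval.hom_uminus)
qed

lemma eval_poly_eq_sum:
  assumes "degree p \<le> n"
  shows "eval_poly hom p z = (\<Sum>i\<le>n. hom (coeff p i) * z ^ i)"
  using degree_extension[OF assms] eval_poly_as_sum[of hom p z] by (simp add: mult.commute)

lemma hom_eval_poly:
  assumes "comm_ring_hom \<theta>"
  shows "\<theta> (eval_poly hom p z) = eval_poly (\<lambda>a. \<theta> (hom a)) p (\<theta> z)"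
proof -
  interpret \<theta>: comm_ring_hom \<theta> by fact
  interpret comp: comm_ring_hom "\<lambda>a. \<theta> (hom a)"
    by (rule comm_ring_hom_compose[OF comm_ring_hom_axioms assms])
  show ?thesis
    by (induction p) (auto simp: \<theta>.hom_add \<theta>.hom_mult)
qed

lemma comm_ring_hom_eval_poly2: "comm_ring_hom (eval_poly2 hom x c)"
  using comm_ring_hom.comm_ring_hom_eval_poly[OF comm_ring_hom_eval_poly]
  by (simp add: eval_poly2_def[abs_def])

lemma eval_poly2_pCons:
  "eval_poly2 hom x c (pCons q p) = eval_poly hom q c + x * eval_poly2 hom x c p"
  unfolding eval_poly2_def by (rule comm_ring_hom.eval_poly_pCons[OF comm_ring_hom_eval_poly])

lemma eval_poly2_const [simp]: "eval_poly2 hom x c [:q:] = eval_poly hom q c"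
  by (simp add: eval_poly2_pCons)

lemma eval_poly2_var [simp]: "eval_poly2 hom x c [:0, 1:] = x"
  by (simp add: eval_poly2_pCons one_pCons)

lemma eval_poly2_eq_sum:
  assumes "degree p \<le> n"
  shows "eval_poly2 hom x c p = (\<Sum>i\<le>n. eval_poly hom (coeff p i) c * x ^ i)"
  unfolding eval_poly2_def by (rule comm_ring_hom.eval_poly_eq_sum[OF comm_ring_hom_eval_poly assms])

lemma hom_eval_poly2:
  assumes "comm_ring_hom \<theta>"
  shows "\<theta> (eval_poly2 hom x c p) = eval_poly2 (\<lambda>a. \<theta> (hom a)) (\<theta> x) (\<theta> c) p"
  unfolding eval_poly2_def comm_ring_hom.hom_eval_poly[OF comm_ring_hom_eval_poly assms]
  by (simp add: hom_eval_poly[OF assms])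

end

lemma comm_ring_hom_eq_eval_poly:
  assumes "comm_ring_hom e"
  shows "e p = eval_poly (\<lambda>a. e [:a:]) p (e [:0, 1:])"
proof -
  interpret e: comm_ring_hom e by fact
  interpret const: comm_ring_hom "\<lambda>a. e [:a:]"
    by (rule comm_ring_hom_compose[OF comm_ring_hom_const_poly assms])
  show ?thesis
  proof (induction p)
    case (pCons a p)
    have "e (pCons a p) = e ([:a:] + [:0, 1:] * p)"
      by simp
    also have "\<dots> = e [:a:] + e [:0, 1:] * e p"
      by (simp only: e.hom_add e.hom_mult)
    finally show ?case
      using pCons by simp
  qed simp
qed

lemma comm_ring_hom_eq_eval_poly2:
  assumes "comm_ring_hom e"
  shows "e p = eval_poly2 (\<lambda>a. e [:[:a:]:]) (e [:0, 1:]) (e [:[:0, 1:]:]) p"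
proof -
  have "comm_ring_hom (\<lambda>q. e [:q:])"
    by (rule comm_ring_hom_compose[OF comm_ring_hom_const_poly assms])
  then have "(\<lambda>q. e [:q:]) = (\<lambda>q. eval_poly (\<lambda>a. e [:[:a:]:]) q (e [:[:0, 1:]:]))"
    using comm_ring_hom_eq_eval_poly by blast
  then show ?thesis
    unfolding eval_poly2_def using comm_ring_hom_eq_eval_poly[OF assms, of p] by simp
qed

lemma (in comm_ring_hom) eval_poly2_pcompose:
  "eval_poly2 hom x c (pcompose p q) = eval_poly2 hom (eval_poly2 hom x c q) c p"
proof -
  have "comm_ring_hom (\<lambda>p. eval_poly2 hom x c (pcompose p q))"
    by (rule comm_ring_hom_compose[OF pcompose_hom.comm_ring_hom_axioms comm_ring_hom_eval_poly2])
  from comm_ring_hom_eq_eval_poly2[OF this, of p] show ?thesis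
    by (simp add: pcompose_pCons)
qed

lemma eval_poly_eq_0_iff_transcendental:
  fixes \<phi> :: "'k::alg_closed_field \<Rightarrow> 's::idom"
  assumes "comm_ring_hom \<phi>" and z: "z \<notin> range \<phi>"
  shows "eval_poly \<phi> p z = 0 \<longleftrightarrow> p = 0"
proof
  interpret \<phi>: comm_ring_hom \<phi> by fact
  interpret eval: comm_ring_hom "\<lambda>p. eval_poly \<phi> p z"
    by (rule \<phi>.comm_ring_hom_eval_poly)
  show "eval_poly \<phi> p z = 0 \<Longrightarrow> p = 0"
  proof (induction p rule: alg_closed_poly_induct)
    case (const b)
    have "\<phi> b * \<phi> (inverse b) = 1" if "b \<noteq> 0"
      using that by (simp flip: \<phi>.hom_mult)
    then show ?case
      using const by auto
  next
    case (linear_factor a q)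
    have "eval_poly \<phi> [:- a, 1:] z = z - \<phi> a"
      by (simp add: \<phi>.hom_uminus)
    then show ?case
      using linear_factor z unfolding eval.hom_mult by auto
  qed
qed (simp add: eval_poly_def)

section \<open>Prime ideals of \<open>K[c][x]\<close>\<close>

lemma prime_elem_const_linear_poly: "prime_elem [:[:- \<alpha>, 1 :: 'k::field:]:]"
  by (intro lift_prime_elem_poly prime_elem_linear_field_poly) simp

lemma dvd_if_dvd_const_mult:
  fixes R S :: "'k::alg_closed_field poly poly"
  assumes primitive: "\<And>\<alpha>. \<not> [:[:- \<alpha>, 1:]:] dvd R"
    and "R dvd [:l:] * S" "l \<noteq> 0"
  shows "R dvd S"
  using assms(2,3)
proof (induction l rule: alg_closed_poly_induct)
  case (const b)
  have "[:[:inverse b:]:] * ([:[:b:]:] * S) = S"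
    using const.prems(2) by (simp add: pCons_one flip: mult.assoc)
  then show ?case
    using const.prems(1) by (metis dvd_mult)
next
  case (linear_factor \<alpha> l)
  let ?\<pi> = "[:[:- \<alpha>, 1:]:]"
  have split: "[:[:- \<alpha>, 1:] * l:] * S = ?\<pi> * ([:l:] * S)"
    by simp
  then obtain Q where Q: "?\<pi> * ([:l:] * S) = R * Q"
    using linear_factor.prems(1) by (metis dvdE)
  then have "?\<pi> dvd R * Q"
    by (metis dvd_triv_left)
  then have "?\<pi> dvd Q"
    using primitive prime_elem_const_linear_poly by (metis prime_elem_dvd_multD)
  then obtain Q' where "Q = ?\<pi> * Q'"
    by (rule dvdE)
  then have "?\<pi> * ([:l:] * S) = ?\<pi> * (R * Q')"
    unfolding Q by (simp only: mult.left_commute)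
  then have "[:l:] * S = R * Q'"
    by (subst (asm) mult_cancel_left) auto
  then show ?case
    using linear_factor.IH \<open>l \<noteq> 0\<close> by auto
qed

text \<open>Comparing the leading coefficients as well makes a minimal relation primitive.\<close>

definition minimal_relation :: "('k::field poly poly \<Rightarrow> 'g::zero) \<Rightarrow> 'k poly poly \<Rightarrow> bool" where
  "minimal_relation e R \<longleftrightarrow> R \<noteq> 0 \<and> e R = 0 \<and>
     (\<forall>p. p \<noteq> 0 \<longrightarrow> e p = 0 \<longrightarrow> (p, R) \<notin> measures [degree, \<lambda>p. degree (lead_coeff p)])"

lemma minimal_relation_exists:
  assumes "S \<noteq> 0" "e S = 0"
  obtains R where "minimal_relation e R"
proof -
  let ?less = "measures [degree, \<lambda>p :: 'a poly poly. degree (lead_coeff p)]"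
  have "S \<in> {p. p \<noteq> 0 \<and> e p = 0}"
    using assms by simp
  then obtain R where "R \<in> {p. p \<noteq> 0 \<and> e p = 0}"
    and "\<And>p. (p, R) \<in> ?less \<Longrightarrow> p \<notin> {p. p \<noteq> 0 \<and> e p = 0}"
    by (rule wfE_min[OF wf_measures]) (rule that)
  then have "minimal_relation e R"
    unfolding minimal_relation_def by blast
  then show ?thesis
    by (rule that)
qed

lemma minimal_relation_primitive:
  fixes e :: "'k::field poly poly \<Rightarrow> 'g::idom"
  assumes e: "comm_ring_hom e" and inj: "\<And>r. e [:r:] = 0 \<Longrightarrow> r = 0" and R: "minimal_relation e R"
  shows "\<not> [:[:- \<alpha>, 1:]:] dvd R"
proof
  interpret e: comm_ring_hom e by fact
  assume "[:[:- \<alpha>, 1:]:] dvd R"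
  then obtain R' where R': "R = [:[:- \<alpha>, 1:]:] * R'"
    by (rule dvdE)
  then have "R' \<noteq> 0"
    using R by (auto simp: minimal_relation_def)
  have "e [:[:- \<alpha>, 1:]:] \<noteq> 0"
    using inj[of "[:- \<alpha>, 1:]"] by auto
  then have "e R' = 0"
    using R unfolding minimal_relation_def R' e.hom_mult by simp
  have "degree R = degree R'"
    unfolding R' by simp
  moreover have "lead_coeff R = [:- \<alpha>, 1:] * lead_coeff R'"
    unfolding R' lead_coeff_mult by simp
  then have "degree (lead_coeff R) = Suc (degree (lead_coeff R'))"
    using \<open>R' \<noteq> 0\<close> by (simp add: degree_mult_eq del: mult_pCons_left)
  ultimately have "(R', R) \<in> measures [degree, \<lambda>p. degree (lead_coeff p)]"
    by simp
  then show False
    using R \<open>R' \<noteq> 0\<close> \<open>e R' = 0\<close> unfolding minimal_relation_def by blast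
qed

lemma minimal_relation_dvd_const_mult:
  fixes e :: "'k::field poly poly \<Rightarrow> 'g::idom"
  assumes e: "comm_ring_hom e" and R: "minimal_relation e R" and p: "e p = 0"
  obtains l where "l \<noteq> 0" "R dvd [:l:] * p"
proof -
  interpret e: comm_ring_hom e by fact
  have "R \<noteq> 0" "e R = 0"
    using R by (simp_all add: minimal_relation_def)
  obtain s r where "pseudo_divmod p R = (s, r)"
    by (cases "pseudo_divmod p R")
  note division = pseudo_divmod[OF \<open>R \<noteq> 0\<close> this]
  define l where "l = lead_coeff R ^ (Suc (degree p) - degree R)"
  have lp: "[:l:] * p = R * s + r"
    using division(1) by (simp add: l_def)
  have "e [:l:] * e p = e R * e s + e r"
    using arg_cong[OF lp, of e] by (simp only: e.hom_add e.hom_mult)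
  then have "e r = 0"
    using p \<open>e R = 0\<close> by simp
  have "r = 0"
  proof (rule ccontr)
    assume "r \<noteq> 0"
    then have "(r, R) \<in> measures [degree, \<lambda>p. degree (lead_coeff p)]"
      using division(2) by simp
    then show False
      using R \<open>r \<noteq> 0\<close> \<open>e r = 0\<close> unfolding minimal_relation_def by blast
  qed
  show ?thesis
  proof (rule that)
    show "l \<noteq> 0"
      using \<open>R \<noteq> 0\<close> by (simp add: l_def)
    show "R dvd [:l:] * p"
      unfolding lp using \<open>r = 0\<close> by simp
  qed
qed

lemma kernel_principal:
  fixes e :: "'k::alg_closed_field poly poly \<Rightarrow> 'g::idom"
  assumes e: "comm_ring_hom e" and inj: "\<And>r. e [:r:] = 0 \<Longrightarrow> r = 0" and S: "S \<noteq> 0" "e S = 0"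
  obtains R where "\<And>p. e p = 0 \<longleftrightarrow> R dvd p"
proof -
  interpret e: comm_ring_hom e by fact
  obtain R where R: "minimal_relation e R"
    by (rule minimal_relation_exists[of S e, OF S])
  show ?thesis
  proof (rule that[of R], rule iffI)
    fix p assume "e p = 0"
    then obtain l where l: "l \<noteq> 0" "R dvd [:l:] * p"
      by (rule minimal_relation_dvd_const_mult[OF e R])
    have "\<not> [:[:- \<alpha>, 1:]:] dvd R" for \<alpha>
      using inj by (rule minimal_relation_primitive[OF e _ R])
    then show "R dvd p"
      using l(2,1) by (rule dvd_if_dvd_const_mult)
  next
    fix p assume "R dvd p"
    then show "e p = 0"
      using R by (auto simp: minimal_relation_def e.hom_mult)
  qed
qed

lemma kernel_eq_multiples_of_prime:
  fixes e :: "'k::alg_closed_field poly poly \<Rightarrow> 'g::idom"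
  assumes e: "comm_ring_hom e" and inj: "\<And>r. e [:r:] = 0 \<Longrightarrow> r = 0"
    and prime: "prime_elem g" and g: "e g = 0"
  shows "e p = 0 \<longleftrightarrow> g dvd p"
proof -
  interpret e: comm_ring_hom e by fact
  have "g \<noteq> 0"
    using prime by auto
  then obtain R where R: "\<And>p. e p = 0 \<longleftrightarrow> R dvd p"
    using kernel_principal[OF e inj _ g] by metis
  have "\<not> is_unit R"
    using R[of 1] by simp
  moreover have "R dvd g"
    using R g by blast
  ultimately have "g dvd R"
    using irreducibleD'[OF prime_elem_imp_irreducible[OF prime]] by blast
  then show ?thesis
    using R \<open>R dvd g\<close> dvd_trans by blast
qed

section \<open>Hensel's lemma for formal power series\<close>

lemma fps_contraction_fixpoint:
  fixes T :: "'a::comm_ring_1 fps \<Rightarrow> 'a fps"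
  assumes T0: "\<And>f. fps_nth f 0 = a \<Longrightarrow> fps_nth (T f) 0 = a"
    and contraction: "\<And>f g n. fps_nth f 0 = a \<Longrightarrow> fps_nth g 0 = a \<Longrightarrow>
      \<forall>k<n. fps_nth f k = fps_nth g k \<Longrightarrow> \<forall>k\<le>n. fps_nth (T f) k = fps_nth (T g) k"
  obtains f where "fps_nth f 0 = a" "T f = f"
proof -
  define s where "s n = (T ^^ n) (fps_const a)" for n
  have s_Suc: "s (Suc n) = T (s n)" for n
    by (simp add: s_def)
  have s_0: "fps_nth (s n) 0 = a" for n
    by (induction n) (auto simp: s_def T0)
  have s_step: "\<forall>k\<le>n. fps_nth (s (Suc n)) k = fps_nth (s n) k" for n
  proof (induction n)
    case (Suc n)
    then have "\<forall>k<Suc n. fps_nth (s (Suc n)) k = fps_nth (s n) k"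
      by simp
    from contraction[OF s_0 s_0 this] show ?case
      unfolding s_Suc .
  qed (simp add: s_0)
  have s_stable: "fps_nth (s n) k = fps_nth (s k) k" if "k \<le> n" for n k
    using that by (induction n rule: dec_induct) (simp_all add: s_step)
  define f where "f = Abs_fps (\<lambda>k. fps_nth (s k) k)"
  have f_0: "fps_nth f 0 = a"
    by (simp add: f_def s_0)
  have "T f = f"
  proof (rule fps_ext)
    fix n
    have "\<forall>k<n. fps_nth f k = fps_nth (s n) k"
      unfolding f_def fps_nth_Abs_fps by (metis s_stable less_imp_le_nat)
    from contraction[OF f_0 s_0 this] have "fps_nth (T f) n = fps_nth (s (Suc n)) n"
      by (simp add: s_Suc)
    then show "fps_nth (T f) n = fps_nth f n"
      using s_step[of n] by (simp add: f_def)
  qed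
  with f_0 show ?thesis
    by (rule that)
qed

lemma poly_fps_nth_0: "fps_nth (poly p f) 0 = poly (map_poly (\<lambda>s. fps_nth s 0) p) (fps_nth f 0)"
  by (induction p) (auto simp: Polynomial.map_poly_pCons)

lemma poly_fps_diff_factor:
  fixes p :: "'a::idom fps poly"
  assumes "fps_nth f 0 = a" "fps_nth g 0 = a"
  obtains r where "poly p f - poly p g = (f - g) * r"
    "fps_nth r 0 = poly (pderiv (map_poly (\<lambda>s. fps_nth s 0) p)) a"
proof (induction p arbitrary: thesis)
  case 0
  show ?case by (rule 0[of 0]) auto
next
  case (pCons s p)
  obtain r where r: "poly p f - poly p g = (f - g) * r"
      "fps_nth r 0 = poly (pderiv (map_poly (\<lambda>s. fps_nth s 0) p)) a"
    by (rule pCons.IH)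
  show ?case
  proof (rule pCons.prems)
    have "poly (pCons s p) f - poly (pCons s p) g = f * (poly p f - poly p g) + (f - g) * poly p g"
      by (simp add: algebra_simps)
    also have "\<dots> = (f - g) * (f * r + poly p g)"
      unfolding r(1) by (simp add: algebra_simps)
    finally show "poly (pCons s p) f - poly (pCons s p) g = (f - g) * (f * r + poly p g)" .
    show "fps_nth (f * r + poly p g) 0 = poly (pderiv (map_poly (\<lambda>s. fps_nth s 0) (pCons s p))) a"
      using assms by (simp add: r(2) poly_fps_nth_0 Polynomial.map_poly_pCons pderiv_pCons add.commute)
  qed
qed

text \<open>The simplified Newton iteration \<open>f \<mapsto> f - p(f) / p\<^sub>0'(a)\<close> is a contraction.\<close>

lemma fps_hensel:
  fixes p :: "'k::field fps poly"
  defines "p0 \<equiv> map_poly (\<lambda>s. fps_nth s 0) p"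
  assumes root: "poly p0 a = 0" and simple: "poly (pderiv p0) a \<noteq> 0"
  obtains f where "fps_nth f 0 = a" "poly p f = 0"
proof -
  define u where "u = poly (pderiv p0) a"
  define T where "T f = f - fps_const (inverse u) * poly p f" for f
  obtain f where f: "fps_nth f 0 = a" "T f = f"
  proof (rule fps_contraction_fixpoint)
    show "fps_nth (T f) 0 = a" if "fps_nth f 0 = a" for f
      using that root by (simp add: T_def poly_fps_nth_0 p0_def)
  next
    fix f g n
    assume fg: "fps_nth f 0 = a" "fps_nth g 0 = a" and agree: "\<forall>k<n. fps_nth f k = fps_nth g k"
    obtain r where r: "poly p f - poly p g = (f - g) * r" "fps_nth r 0 = u"
      unfolding u_def p0_def by (rule poly_fps_diff_factor[OF fg])
    define d where "d = 1 - fps_const (inverse u) * r"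
    have d0: "fps_nth d 0 = 0"
      using simple by (simp add: d_def r(2) u_def)
    have "T f - T g = f - g - fps_const (inverse u) * (poly p f - poly p g)"
      by (simp add: T_def algebra_simps)
    also have "\<dots> = (f - g) * d"
      unfolding r(1) d_def by (simp add: algebra_simps)
    finally have T_diff: "T f - T g = (f - g) * d" .
    have "fps_nth (T f - T g) k = 0" if "k \<le> n" for k
      unfolding T_diff fps_mult_nth
    proof (rule sum.neutral, intro ballI)
      fix i assume "i \<in> {0..k}"
      then have "i < n \<or> k - i = 0"
        using \<open>k \<le> n\<close> by auto
      then show "fps_nth (f - g) i * fps_nth d (k - i) = 0"
        using agree d0 by auto
    qed
    then show "\<forall>k\<le>n. fps_nth (T f) k = fps_nth (T g) k"
      by (simp add: fps_sub_nth)
  qed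
  have "fps_const (inverse u) * poly p f = 0"
    using f(2) by (simp add: T_def)
  then have "poly p f = 0"
    using simple by (simp add: u_def)
  with f(1) show ?thesis
    by (rule that)
qed

section \<open>The critical orbit of \<open>f\<^sub>c\<close>\<close>

lemma (in comm_ring_hom) hom_quad_map_funpow:
  "hom ((quad_map c ^^ n) z) = (quad_map (hom c) ^^ n) (hom z)"
  by (induction n) (auto simp: quad_map_def hom_add hom_power)

lemma degree_quad_map_funpow:
  fixes p c :: "'k::idom poly"
  assumes "degree p > 0" "degree c \<le> 1"
  shows "degree ((quad_map c ^^ n) p) = 2 ^ n * degree p"
proof (induction n)
  case (Suc n)
  let ?q = "(quad_map c ^^ n) p"
  have "degree ?q > 0"
    using Suc assms by simp
  then have "degree c < degree (?q ^ 2)"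
    using assms by (subst degree_power_eq) auto
  then have "degree (?q ^ 2 + c) = degree (?q ^ 2)"
    by (rule degree_add_eq_left)
  also have "\<dots> = 2 * degree ?q"
    using \<open>degree ?q > 0\<close> by (subst degree_power_eq) auto
  finally show ?case
    using Suc by (simp add: quad_map_def[of c ?q])
qed simp

lemma degree_quad_map_funpow_diff_const:
  fixes p c :: "'k::idom poly"
  assumes "degree p > 0" "degree c \<le> 1"
  shows "degree ((quad_map c ^^ n) p - [:a:]) = 2 ^ n * degree p"
  unfolding diff_conv_add_uminus
  by (subst degree_add_eq_left) (use assms degree_quad_map_funpow[OF assms, of n] in auto)

text \<open>The roots are the parameters \<open>c\<close> for which the critical point \<open>0\<close> of \<open>f\<^sub>c\<close> is mapped to \<open>a\<close> by \<open>f\<^sub>c\<^sup>M\<close>.\<close>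

definition crit_poly :: "nat \<Rightarrow> 'k::field \<Rightarrow> 'k poly" where
  "crit_poly M a = (quad_map [:0, 1:] ^^ M) 0 - [:a:]"

definition critical_roots_simple :: "nat \<Rightarrow> 'k::field \<Rightarrow> bool" where
  "critical_roots_simple N a \<longleftrightarrow> (\<forall>M\<in>{1..N}. \<forall>c.
     poly (crit_poly M a) c = 0 \<longrightarrow> poly (pderiv (crit_poly M a)) c \<noteq> 0)"

lemma critical_roots_simple_mono:
  "critical_roots_simple N a \<Longrightarrow> M \<le> N \<Longrightarrow> critical_roots_simple M a"
  by (auto simp: critical_roots_simple_def)

lemma critical_roots_simpleD:
  "critical_roots_simple (Suc M) a \<Longrightarrow> poly (crit_poly (Suc M) a) c = 0 \<Longrightarrow>
     poly (pderiv (crit_poly (Suc M) a)) c \<noteq> 0"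
  by (auto simp: critical_roots_simple_def)

lemma crit_poly_Suc: "crit_poly (Suc M) a = (quad_map [:0, 1:] ^^ M) [:0, 1:] - [:a:]"
  by (simp add: crit_poly_def funpow_Suc_right quad_map_def del: funpow.simps)

lemma degree_crit_poly_Suc: "degree (crit_poly (Suc M) a) = 2 ^ M"
  unfolding crit_poly_Suc by (subst degree_quad_map_funpow_diff_const) auto

lemma crit_poly_Suc_nonzero: "crit_poly (Suc M) a \<noteq> 0"
  using degree_crit_poly_Suc[of M a] by auto

lemma crit_poly_Suc_root:
  fixes a :: "'k::alg_closed_field"
  obtains c where "poly (crit_poly (Suc M) a) c = 0"
  using alg_closed_imp_poly_has_root[of "crit_poly (Suc M) a"] by (auto simp: degree_crit_poly_Suc)

lemma poly_crit_poly: "poly (crit_poly M a) c = (quad_map c ^^ M) 0 - a"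
  by (simp add: crit_poly_def poly_hom.hom_quad_map_funpow)

section \<open>The polynomial \<open>f\<^sub>c\<^sup>N(x) - a\<close>\<close>

abbreviation quad_poly :: "'k::comm_ring_1 poly poly" where
  "quad_poly \<equiv> [:[:0, 1:], 0, 1:]"

lemma preimage_poly_Suc: "preimage_poly (Suc N) a = pcompose (preimage_poly N a) quad_poly"
proof -
  have "quad_map [:[:0, 1:]:] [:0, 1:] = (quad_poly :: 'a poly poly)"
    by (simp add: quad_map_def power2_eq_square)
  then show ?thesis
    by (simp add: preimage_poly_def funpow_Suc_right pcompose_hom.hom_quad_map_funpow
        pcompose_hom.hom_minus pcompose_pCons del: funpow.simps)
qed

lemma poly_preimage_poly_0: "poly (preimage_poly N a) 0 = crit_poly N a"
  by (simp add: preimage_poly_def crit_poly_def poly_hom.hom_quad_map_funpow)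

lemma monic_preimage_poly:
  fixes a :: "'k::idom"
  shows "degree (preimage_poly N a) = 2 ^ N \<and> lead_coeff (preimage_poly N a) = 1"
proof (induction N)
  case 0
  show ?case by (simp add: preimage_poly_def)
next
  case (Suc N)
  have "degree (quad_poly :: 'k poly poly) = 2"
    by simp
  moreover have "coeff (preimage_poly N a) (2 ^ N) = 1"
    using Suc by metis
  ultimately show ?case
    using Suc unfolding preimage_poly_Suc
    by (subst (1) lead_coeff_comp) (simp_all add: degree_pcompose)
qed

lemmas degree_preimage_poly = monic_preimage_poly[THEN conjunct1]
  and lead_coeff_preimage_poly = monic_preimage_poly[THEN conjunct2]

lemma preimage_poly_even: "pcompose (preimage_poly (Suc M) a) [:0, - 1:] = preimage_poly (Suc M) a"
proof -
  have "pcompose quad_poly [:0, - 1:] = (quad_poly :: 'a poly poly)"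
    by (simp add: pcompose_pCons)
  then show ?thesis
    unfolding preimage_poly_Suc pcompose_assoc[symmetric] by simp
qed

lemma (in comm_ring_hom) eval_poly2_preimage_poly:
  "eval_poly2 hom x c (preimage_poly N a) = (quad_map c ^^ N) x - hom a"
proof -
  interpret eval: comm_ring_hom "eval_poly2 hom x c" by (rule comm_ring_hom_eval_poly2)
  show ?thesis
    by (simp add: preimage_poly_def eval.hom_minus eval.hom_quad_map_funpow)
qed

section \<open>Nonsingularity and the critical orbit\<close>

lemma comm_ring_hom_eval_xc: "comm_ring_hom (\<lambda>p. eval_xc p x c)"
  by unfold_locales (auto simp: eval_xc_def)

lemma eval_xc_pcompose_quad_poly: "eval_xc (pcompose p quad_poly) x c = eval_xc p (x\<^sup>2 + c) c"
proof -
  have "comm_ring_hom (\<lambda>p. eval_xc (pcompose p quad_poly) x c)"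
    by (rule comm_ring_hom_compose[OF pcompose_hom.comm_ring_hom_axioms comm_ring_hom_eval_xc])
  from comm_ring_hom_eq_eval_poly2[OF this, of p]
    comm_ring_hom_eq_eval_poly2[OF comm_ring_hom_eval_xc[of "x\<^sup>2 + c" c], of p]
  show ?thesis
    by (simp add: eval_xc_def pcompose_pCons power2_eq_square add.commute)
qed

lemma map_poly_pderiv_add:
  "map_poly pderiv (p + q) = map_poly pderiv p + map_poly pderiv q"
  by (rule poly_eqI) (simp add: coeff_map_poly pderiv_add)

lemma map_poly_pderiv_mult:
  "map_poly pderiv (p * q) = map_poly pderiv p * q + p * map_poly pderiv q"
  by (rule poly_eqI, simp add: coeff_map_poly coeff_mult pderiv_sum pderiv_mult sum.distrib)
     (simp add: algebra_simps)

lemma map_poly_pderiv_pcompose_quad_poly: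
  "map_poly pderiv (pcompose p quad_poly) =
     pcompose (map_poly pderiv p) quad_poly + pcompose (pderiv p) quad_poly"
proof (induction p)
  case (pCons a p)
  have quad: "map_poly pderiv quad_poly = (1 :: 'a poly poly)"
    by (simp add: Polynomial.map_poly_pCons pderiv_pCons one_pCons)
  have "map_poly pderiv (pcompose (pCons a p) quad_poly) =
      map_poly pderiv [:a:] + pcompose p quad_poly +
      quad_poly * map_poly pderiv (pcompose p quad_poly)"
    unfolding pcompose_pCons map_poly_pderiv_add map_poly_pderiv_mult quad by simp
  also have "\<dots> = pcompose (map_poly pderiv (pCons a p)) quad_poly +
      pcompose (pderiv (pCons a p)) quad_poly"
    unfolding pCons.IH
    by (simp add: Polynomial.map_poly_pCons pcompose_pCons pderiv_pCons pcompose_add algebra_simps)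
  finally show ?case .
qed simp

lemma preimage_curve_nonsingular_Suc:
  fixes a :: "'k::alg_closed_field"
  assumes "preimage_curve_nonsingular (Suc N) a"
  shows "preimage_curve_nonsingular N a"
  unfolding preimage_curve_nonsingular_def preimage_curve_def
proof (intro ballI, clarify)
  fix y c
  assume point: "eval_xc (preimage_poly N a) y c = 0"
    and deriv_x: "eval_xc (pderiv (preimage_poly N a)) y c = 0"
    and deriv_c: "eval_xc (map_poly pderiv (preimage_poly N a)) y c = 0"
  obtain x where "x ^ 2 = y - c"
    using nth_root_exists[of 2 "y - c"] by auto
  then have y: "x\<^sup>2 + c = y"
    by simp
  interpret eval: comm_ring_hom "\<lambda>p. eval_xc p x c"
    by (rule comm_ring_hom_eval_xc)
  have "(x, c) \<in> preimage_curve (Suc N) a"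
    by (simp add: preimage_curve_def preimage_poly_Suc eval_xc_pcompose_quad_poly y point)
  moreover have "eval_xc (pderiv (preimage_poly (Suc N) a)) x c = 0"
    by (simp add: preimage_poly_Suc pderiv_pcompose eval.hom_mult eval_xc_pcompose_quad_poly y deriv_x)
  moreover have "eval_xc (map_poly pderiv (preimage_poly (Suc N) a)) x c = 0"
    by (simp add: preimage_poly_Suc map_poly_pderiv_pcompose_quad_poly eval.hom_add
        eval_xc_pcompose_quad_poly y deriv_x deriv_c)
  ultimately show False
    using assms unfolding preimage_curve_nonsingular_def by blast
qed

lemma critical_roots_simple_if_nonsingular:
  fixes a :: "'k::alg_closed_field"
  assumes "preimage_curve_nonsingular N a"
  shows "critical_roots_simple N a"
  unfolding critical_roots_simple_def
proof (intro ballI allI impI)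
  fix M c assume M: "M \<in> {1..N}" and root: "poly (crit_poly M a) c = 0"
  have "M \<le> N"
    using M by simp
  then have nonsingular: "preimage_curve_nonsingular M a"
    using assms by (induction rule: inc_induct) (auto intro: preimage_curve_nonsingular_Suc)
  obtain M' where M': "M = Suc M'"
    using M by (cases M) auto
  have eval_0: "eval_xc p 0 c = poly (poly p 0) c" for p :: "'k poly poly"
    by (simp add: eval_xc_def)
  interpret eval: comm_ring_hom "\<lambda>p. eval_xc p 0 c"
    by (rule comm_ring_hom_eval_xc)
  have "(0, c) \<in> preimage_curve M a"
    by (simp add: preimage_curve_def eval_0 poly_preimage_poly_0 root)
  moreover have "eval_xc (pderiv (preimage_poly M a)) 0 c = 0"
    unfolding M' preimage_poly_Suc pderiv_pcompose eval.hom_mult by (simp add: eval_0 pderiv_pCons)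
  moreover have "eval_xc (map_poly pderiv (preimage_poly M a)) 0 c = poly (pderiv (crit_poly M a)) c"
    by (simp add: eval_0 poly_0_coeff_0 coeff_map_poly flip: poly_preimage_poly_0)
  ultimately show "poly (pderiv (crit_poly M a)) c \<noteq> 0"
    using nonsingular unfolding preimage_curve_nonsingular_def by force
qed

section \<open>Parametrizations by power series\<close>

definition curve_param :: "nat \<Rightarrow> 'k::field \<Rightarrow> 'k fps \<Rightarrow> 'k fps \<Rightarrow> bool" where
  "curve_param N a \<xi> \<eta> \<longleftrightarrow> (quad_map \<eta> ^^ N) \<xi> = fps_const a \<and> \<eta> \<notin> range fps_const"

lemma comm_ring_hom_fps_const: "comm_ring_hom (fps_const :: 'k::comm_ring_1 \<Rightarrow> 'k fps)"
  by unfold_locales auto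

lemma comm_ring_hom_fps_nth_0: "comm_ring_hom (\<lambda>f :: 'k::comm_ring_1 fps. fps_nth f 0)"
  by unfold_locales auto

lemma comm_ring_hom_fps_compose:
  "fps_nth g 0 = 0 \<Longrightarrow> comm_ring_hom (\<lambda>f :: 'k::idom fps. f oo g)"
  by unfold_locales (auto simp: fps_compose_add_distrib fps_compose_mult_distrib)

lemma curve_param_eval_eq_0_iff:
  fixes a :: "'k::alg_closed_field"
  assumes "prime_elem (preimage_poly N a)" and param: "curve_param N a \<xi> \<eta>"
  shows "eval_poly2 fps_const \<xi> \<eta> p = 0 \<longleftrightarrow> preimage_poly N a dvd p"
proof (rule kernel_eq_multiples_of_prime)
  interpret const: comm_ring_hom "fps_const :: 'k \<Rightarrow> 'k fps"
    by (rule comm_ring_hom_fps_const)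
  show "comm_ring_hom (eval_poly2 fps_const \<xi> \<eta>)"
    by (rule const.comm_ring_hom_eval_poly2)
  show "eval_poly2 fps_const \<xi> \<eta> (preimage_poly N a) = 0"
    using param by (simp add: curve_param_def const.eval_poly2_preimage_poly)
  show "r = 0" if "eval_poly2 fps_const \<xi> \<eta> [:r:] = 0" for r
    using that param eval_poly_eq_0_iff_transcendental[OF comm_ring_hom_fps_const, of \<eta> r]
    by (simp add: curve_param_def)
qed fact

lemma constant_if_quad_map_funpow_constant:
  fixes \<xi> :: "'k::alg_closed_field fps"
  assumes "(quad_map (fps_const b) ^^ M) \<xi> = fps_const a"
  shows "\<xi> \<in> range fps_const"
proof (rule ccontr)
  assume transcendental: "\<xi> \<notin> range fps_const"
  define Q where "Q = (quad_map [:b:] ^^ M) [:0, 1:] - [:a:]"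
  interpret const: comm_ring_hom "fps_const :: 'k \<Rightarrow> 'k fps"
    by (rule comm_ring_hom_fps_const)
  interpret eval: comm_ring_hom "\<lambda>p. eval_poly fps_const p \<xi>"
    by (rule const.comm_ring_hom_eval_poly)
  have "eval_poly fps_const Q \<xi> = 0"
    unfolding Q_def eval.hom_minus eval.hom_quad_map_funpow by (simp add: assms)
  then have "Q = 0"
    using eval_poly_eq_0_iff_transcendental[OF comm_ring_hom_fps_const transcendental] by simp
  then show False
    using degree_quad_map_funpow_diff_const[of "[:0, 1:]" "[:b:]" M a] by (simp add: Q_def)
qed

text \<open>Near a critical parameter \<open>c\<^sub>0\<close> the curve is parametrized by \<open>s = y - c\<close>.\<close>

lemma curve_param_at_critical_root:
  fixes a c0 :: "'k::alg_closed_field"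
  assumes root: "poly (crit_poly (Suc M) a) c0 = 0"
    and simple: "poly (pderiv (crit_poly (Suc M) a)) c0 \<noteq> 0"
  obtains \<gamma> where "fps_nth \<gamma> 0 = c0" "curve_param M a (\<gamma> + fps_X) \<gamma>"
proof -
  define P where "P = (quad_map [:0, 1:] ^^ M) [:fps_X, 1:] - [:fps_const a:]"
  interpret reduce: comm_ring_hom "map_poly (\<lambda>f :: 'k fps. fps_nth f 0)"
    by (intro comm_ring_hom_map_poly comm_ring_hom_fps_nth_0)
  have reduce_P: "map_poly (\<lambda>f. fps_nth f 0) P = crit_poly (Suc M) a"
    unfolding P_def reduce.hom_minus reduce.hom_quad_map_funpow crit_poly_Suc
    by (simp add: Polynomial.map_poly_pCons)
  obtain \<gamma> where \<gamma>: "fps_nth \<gamma> 0 = c0" "poly P \<gamma> = 0"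
    by (rule fps_hensel[of P c0]) (simp_all only: reduce_P root simple not_False_eq_True)
  have "poly P \<gamma> = (quad_map \<gamma> ^^ M) (\<gamma> + fps_X) - fps_const a"
    by (simp add: P_def poly_hom.hom_quad_map_funpow add.commute)
  then have orbit: "(quad_map \<gamma> ^^ M) (\<gamma> + fps_X) = fps_const a"
    using \<gamma>(2) by simp
  have "\<gamma> \<noteq> fps_const b" for b
  proof
    assume const: "\<gamma> = fps_const b"
    then have "\<gamma> + fps_X \<in> range fps_const"
      using orbit by (intro constant_if_quad_map_funpow_constant) simp
    then obtain d where "\<gamma> + fps_X = fps_const d"
      by blast
    from arg_cong[OF this, of "\<lambda>f. fps_nth f 1"] show False
      by (simp add: const)
  qed
  then have "curve_param M a (\<gamma> + fps_X) \<gamma>"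
    using orbit by (auto simp: curve_param_def)
  with \<gamma>(1) show ?thesis
    by (rule that)
qed

text \<open>Substituting \<open>s = x\<^sup>2\<close> gives a parametrization by \<open>x\<close> of the curve for \<open>M + 1\<close>.\<close>

lemma even_curve_param:
  fixes a :: "'k::field"
  assumes "curve_param M a (\<gamma> + fps_X) \<gamma>"
  obtains \<eta> where "fps_nth \<eta> 0 = fps_nth \<gamma> 0" "\<eta> oo - fps_X = \<eta>" "curve_param (Suc M) a fps_X \<eta>"
proof -
  define \<eta> where "\<eta> = \<gamma> oo fps_X ^ 2"
  have sq_0: "fps_nth (fps_X ^ 2 :: 'k fps) 0 = 0"
    by (simp add: fps_X_power_nth)
  interpret square: comm_ring_hom "\<lambda>f :: 'k fps. f oo fps_X ^ 2"
    by (rule comm_ring_hom_fps_compose[OF sq_0])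
  have "(quad_map \<gamma> ^^ M) (\<gamma> + fps_X) oo fps_X ^ 2 = fps_const a oo fps_X ^ 2"
    using assms by (simp add: curve_param_def)
  then have "(quad_map \<eta> ^^ M) (\<eta> + fps_X ^ 2) = fps_const a"
    by (simp add: square.hom_quad_map_funpow square.hom_add sq_0 \<eta>_def)
  then have orbit: "(quad_map \<eta> ^^ Suc M) fps_X = fps_const a"
    by (simp add: funpow_Suc_right quad_map_def[of \<eta> fps_X] add.commute del: funpow.simps)
  have "\<eta> \<noteq> fps_const b" for b
  proof
    assume "\<eta> = fps_const b"
    then have "(\<gamma> - fps_const b) oo fps_X ^ 2 = 0"
      by (simp add: square.hom_minus \<eta>_def)
    then have "\<gamma> = fps_const b"
      using fps_compose_eq_0_iff[OF sq_0, of "\<gamma> - fps_const b"] by simp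
    then show False
      using assms by (simp add: curve_param_def)
  qed
  then have "curve_param (Suc M) a fps_X \<eta>"
    using orbit by (auto simp: curve_param_def simp del: funpow.simps)
  moreover have "\<eta> oo - fps_X = \<eta>"
  proof -
    have "\<eta> oo - fps_X = \<gamma> oo (fps_X ^ 2 oo - fps_X)"
      unfolding \<eta>_def by (rule fps_compose_assoc[symmetric]) (simp_all add: sq_0)
    also have "fps_X ^ 2 oo - fps_X = (fps_X ^ 2 :: 'k fps)"
      by (simp add: fps_X_power_compose)
    finally show ?thesis
      by (simp add: \<eta>_def)
  qed
  moreover have "fps_nth \<eta> 0 = fps_nth \<gamma> 0"
    by (simp add: \<eta>_def)
  ultimately show ?thesis
    using that by blast
qed

lemma poly_pderiv_quad_map_funpow:
  fixes c x :: "'k::idom"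
  shows "poly (pderiv ((quad_map [:c:] ^^ n) [:0, 1:])) x = (\<Prod>i<n. 2 * (quad_map c ^^ i) x)"
proof (induction n)
  case (Suc n)
  define q where "q = (quad_map [:c:] ^^ n) [:0, 1:]"
  have "poly q x = (quad_map c ^^ n) x"
    by (simp add: q_def poly_hom.hom_quad_map_funpow)
  moreover have "(quad_map [:c:] ^^ Suc n) [:0, 1:] = q * q + [:c:]"
    by (simp add: q_def quad_map_def power2_eq_square)
  ultimately have "poly (pderiv ((quad_map [:c:] ^^ Suc n) [:0, 1:])) x =
      2 * (quad_map c ^^ n) x * poly (pderiv q) x"
    by (simp add: pderiv_add pderiv_mult pderiv_pCons)
  then show ?case
    using Suc.IH by (simp add: q_def mult.commute)
qed (simp add: pderiv_pCons)

lemma crit_poly_root_if_orbit_meets_0: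
  assumes "(quad_map c ^^ N) x = a" "i < N" "(quad_map c ^^ i) x = 0"
  shows "poly (crit_poly (N - i) a) c = 0"
proof -
  have "(quad_map c ^^ N) x = (quad_map c ^^ (N - i)) ((quad_map c ^^ i) x)"
    using assms(2) by (metis comp_apply funpow_add le_add_diff_inverse2 less_imp_le)
  then show ?thesis
    using assms by (simp add: poly_crit_poly)
qed

lemma curve_param_at_noncritical_value:
  fixes a c0 :: "'k::alg_closed_field"
  assumes two: "(2 :: 'k) \<noteq> 0" and noncritical: "\<And>M. M \<in> {1..N} \<Longrightarrow> poly (crit_poly M a) c0 \<noteq> 0"
  obtains \<xi> where "curve_param N a \<xi> (fps_const c0 + fps_X)"
proof -
  define \<eta> where "\<eta> = fps_const c0 + fps_X"
  define P where "P = (quad_map [:\<eta>:] ^^ N) [:0, 1:] - [:fps_const a:]"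
  define Q where "Q = (quad_map [:c0:] ^^ N) [:0, 1:] - [:a:]"
  interpret reduce: comm_ring_hom "map_poly (\<lambda>f :: 'k fps. fps_nth f 0)"
    by (intro comm_ring_hom_map_poly comm_ring_hom_fps_nth_0)
  have reduce_P: "map_poly (\<lambda>f. fps_nth f 0) P = Q"
    unfolding P_def Q_def reduce.hom_minus reduce.hom_quad_map_funpow
    by (simp add: Polynomial.map_poly_pCons \<eta>_def)
  obtain x0 where root: "poly Q x0 = 0"
    using alg_closed_imp_poly_has_root[of Q] unfolding Q_def
    by (auto simp: degree_quad_map_funpow_diff_const)
  then have orbit: "(quad_map c0 ^^ N) x0 = a"
    by (simp add: Q_def poly_hom.hom_quad_map_funpow)
  have "(quad_map c0 ^^ i) x0 \<noteq> 0" if "i < N" for i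
    using crit_poly_root_if_orbit_meets_0[OF orbit that] noncritical[of "N - i"] that by auto
  then have simple: "poly (pderiv Q) x0 \<noteq> 0"
    using two by (simp add: Q_def pderiv_diff pderiv_pCons poly_pderiv_quad_map_funpow)
  obtain \<xi> where "poly P \<xi> = 0"
    by (rule fps_hensel[of P x0]) (simp_all only: reduce_P root simple not_False_eq_True)
  then have "(quad_map \<eta> ^^ N) \<xi> = fps_const a"
    by (simp add: P_def poly_hom.hom_quad_map_funpow)
  moreover have "\<eta> \<noteq> fps_const b" for b
    using arg_cong[of \<eta> "fps_const b" "\<lambda>f. fps_nth f 1"] by (auto simp: \<eta>_def)
  ultimately have "curve_param N a \<xi> \<eta>"
    by (auto simp: curve_param_def)
  then show ?thesis
    using that by (simp add: \<eta>_def)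
qed

section \<open>Irreducibility\<close>

lemma monic_division:
  fixes p g :: "'r::idom poly"
  assumes "lead_coeff g = 1"
  obtains s r where "p = g * s + r" "r = 0 \<or> degree r < degree g"
proof -
  have "g \<noteq> 0"
    using assms by auto
  obtain s r where "pseudo_divmod p g = (s, r)"
    by (cases "pseudo_divmod p g")
  from pseudo_divmod[OF \<open>g \<noteq> 0\<close> this] have "p = g * s + r" "r = 0 \<or> degree r < degree g"
    using assms by auto
  then show ?thesis
    by (rule that)
qed

lemma even_odd_decomposition:
  fixes p :: "'k::comm_ring_1 poly poly"
  obtains u v where "p = pcompose u quad_poly + [:0, 1:] * pcompose v quad_poly"
proof (induction p arbitrary: thesis)
  case 0
  show ?case by (rule 0[of 0 0]) simp
next
  case (pCons b p)
  obtain u v where p: "p = pcompose u quad_poly + [:0, 1:] * pcompose v quad_poly"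
    by (rule pCons.IH)
  have "pcompose [:- [:0, 1:], 1:] quad_poly = ([:0, 1:] * [:0, 1:] :: 'k poly poly)"
    by (simp add: pcompose_pCons)
  then have square: "[:0, 1:] * ([:0, 1:] * pcompose v quad_poly) =
      pcompose ([:- [:0, 1:], 1:] * v) quad_poly"
    unfolding pcompose_mult by (simp only: mult.assoc)
  have "pCons b p = [:b:] + [:0, 1:] * p"
    by simp
  also have "\<dots> = pcompose ([:b:] + [:- [:0, 1:], 1:] * v) quad_poly + [:0, 1:] * pcompose u quad_poly"
    unfolding p pcompose_add square[symmetric] by (simp add: algebra_simps)
  finally show ?case
    by (rule pCons.prems)
qed

lemma even_odd_eq_0D:
  fixes u v :: "'k::idom poly poly"
  assumes "pcompose u quad_poly + [:0, 1:] * pcompose v quad_poly = 0"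
  shows "u = 0" "v = 0"
proof -
  have even_eq_odd: "pcompose u quad_poly = - ([:0, 1:] * pcompose v quad_poly)"
    using assms by (simp only: eq_neg_iff_add_eq_0)
  show "v = 0"
  proof (rule ccontr)
    assume "v \<noteq> 0"
    then have "pcompose v quad_poly \<noteq> 0"
      using pcompose_eq_0_iff[of quad_poly v] by simp
    then have "degree ([:0, 1:] * pcompose v quad_poly) = 1 + 2 * degree v"
      by (subst degree_mult_eq) (auto simp: degree_pcompose)
    moreover have "degree (pcompose u quad_poly) = 2 * degree u"
      by (simp add: degree_pcompose)
    ultimately have "2 * degree u = 1 + 2 * degree v"
      using even_eq_odd by (metis degree_minus)
    then show False by presburger
  qed
  then show "u = 0"
    using even_eq_odd pcompose_eq_0_iff[of quad_poly u] by simp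
qed

lemma monic_dvd_even_odd_iff:
  fixes g u v :: "'k::idom poly poly"
  assumes monic: "lead_coeff g = 1" and deg: "degree g > 0"
  shows "pcompose g quad_poly dvd pcompose u quad_poly + [:0, 1:] * pcompose v quad_poly \<longleftrightarrow>
         g dvd u \<and> g dvd v"
proof
  let ?c = "\<lambda>p. pcompose p quad_poly"
  assume dvd: "?c g dvd ?c u + [:0, 1:] * ?c v"
  obtain s r where u: "u = g * s + r" "r = 0 \<or> degree r < degree g"
    by (rule monic_division[OF monic])
  obtain s' r' where v: "v = g * s' + r'" "r' = 0 \<or> degree r' < degree g"
    by (rule monic_division[OF monic])
  let ?R = "?c r + [:0, 1:] * ?c r'"
  have "?c u + [:0, 1:] * ?c v = ?c g * (?c s + [:0, 1:] * ?c s') + ?R"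
    unfolding u v by (simp only: pcompose_add pcompose_mult) (simp only: algebra_simps)
  then have "?c g dvd ?R"
    using dvd by (metis dvd_add_right_iff dvd_triv_left)
  moreover have "degree ?R < degree (?c g)"
  proof -
    have "degree ?R \<le> max (degree (?c r)) (degree ([:0, 1:] * ?c r'))"
      by (rule degree_add_le_max)
    also have "\<dots> \<le> max (2 * degree r) (1 + 2 * degree r')"
      using degree_mult_le[of "[:0, 1:]" "?c r'"] by (auto simp: degree_pcompose le_max_iff_disj)
    also have "\<dots> < degree (?c g)"
      using u(2) v(2) deg by (auto simp: degree_pcompose)
    finally show ?thesis .
  qed
  ultimately have "?R = 0"
    using dvd_imp_degree_le leD by blast
  from even_odd_eq_0D[OF this] show "g dvd u \<and> g dvd v"
    using u v by simp
next
  assume "g dvd u \<and> g dvd v"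
  then show "pcompose g quad_poly dvd pcompose u quad_poly + [:0, 1:] * pcompose v quad_poly"
    by (auto elim!: dvdE simp: pcompose_mult simp del: mult_pCons_left)
qed

lemma preimage_poly_Suc_dvd_even_odd_iff:
  fixes a :: "'k::idom"
  shows "preimage_poly (Suc M) a dvd pcompose u quad_poly + [:0, 1:] * pcompose v quad_poly \<longleftrightarrow>
    preimage_poly M a dvd u \<and> preimage_poly M a dvd v"
  unfolding preimage_poly_Suc
  by (rule monic_dvd_even_odd_iff[OF lead_coeff_preimage_poly]) (simp add: degree_preimage_poly)

text \<open>The norm to \<open>K[y, c]\<close> of \<open>u(y) + x v(y)\<close>, where \<open>y = x\<^sup>2 + c\<close>.\<close>

definition quad_norm :: "'k::comm_ring_1 poly poly \<Rightarrow> 'k poly poly \<Rightarrow> 'k poly poly" where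
  "quad_norm u v = u\<^sup>2 - [:- [:0, 1:], 1:] * v\<^sup>2"

lemma pcompose_quad_norm:
  "pcompose (quad_norm u v) quad_poly =
     (pcompose u quad_poly - [:0, 1:] * pcompose v quad_poly) *
     (pcompose u quad_poly + [:0, 1:] * pcompose v quad_poly)"
proof -
  have "pcompose [:- [:0, 1:], 1:] quad_poly = ([:0, 1:] * [:0, 1:] :: 'a poly poly)"
    by (simp add: pcompose_pCons)
  then show ?thesis
    unfolding quad_norm_def pcompose_diff pcompose_mult power2_eq_square by (simp only: algebra_simps)
qed

text \<open>On a branch with \<open>y - c = s\<close> both terms of \<open>u\<^sup>2 = (y - c) v\<^sup>2\<close> vanish: their orders in \<open>s\<close> have
  different parity.\<close>

lemma preimage_poly_dvd_quad_norm:
  fixes a :: "'k::alg_closed_field"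
  assumes prime: "prime_elem (preimage_poly M a)" and param: "curve_param M a (\<gamma> + fps_X) \<gamma>"
    and "preimage_poly M a dvd quad_norm u v"
  shows "preimage_poly M a dvd u \<and> preimage_poly M a dvd v"
proof -
  interpret const: comm_ring_hom "fps_const :: 'k \<Rightarrow> 'k fps"
    by (rule comm_ring_hom_fps_const)
  let ?e = "eval_poly2 fps_const (\<gamma> + fps_X) \<gamma>"
  interpret eval: comm_ring_hom ?e
    by (rule const.comm_ring_hom_eval_poly2)
  note kernel = curve_param_eval_eq_0_iff[OF prime param]
  have "?e [:- [:0, 1:], 1:] = fps_X"
    by (simp add: const.eval_poly2_pCons const.hom_uminus one_pCons)
  then have "?e (quad_norm u v) = (?e u)\<^sup>2 - fps_X * (?e v)\<^sup>2"
    unfolding quad_norm_def eval.hom_minus eval.hom_mult eval.hom_power by simp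
  then have norm_eq_0: "(?e u)\<^sup>2 = fps_X * (?e v)\<^sup>2"
    using kernel[of "quad_norm u v"] assms(3) by simp
  have "?e v = 0"
  proof (rule ccontr)
    assume "?e v \<noteq> 0"
    then have "subdegree (fps_X * (?e v)\<^sup>2) = 1 + 2 * subdegree (?e v)"
      by (subst subdegree_mult) (auto simp: subdegree_power)
    moreover have "subdegree ((?e u)\<^sup>2) = 2 * subdegree (?e u)"
      by (simp add: subdegree_power)
    ultimately have "2 * subdegree (?e u) = 1 + 2 * subdegree (?e v)"
      using norm_eq_0 by simp
    then show False by presburger
  qed
  moreover from this have "?e u = 0"
    using norm_eq_0 by simp
  ultimately show ?thesis
    using kernel[of u] kernel[of v] by simp
qed

lemma prime_elem_preimage_poly_Suc:
  fixes a :: "'k::alg_closed_field"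
  assumes prime: "prime_elem (preimage_poly M a)" and param: "curve_param M a (\<gamma> + fps_X) \<gamma>"
  shows "prime_elem (preimage_poly (Suc M) a)"
proof (rule prime_elemI)
  let ?g = "preimage_poly M a" and ?H = "preimage_poly (Suc M) a"
    and ?c = "\<lambda>p. pcompose p quad_poly" and ?X = "[:0, 1:]"
  show "?H \<noteq> 0"
    using lead_coeff_preimage_poly[of "Suc M" a] by auto
  show "\<not> ?H dvd 1"
    using degree_preimage_poly[of "Suc M" a] by (auto dest: dvd_imp_degree_le)
  fix p q assume pq: "?H dvd p * q"
  obtain u v where p: "p = ?c u + ?X * ?c v"
    by (rule even_odd_decomposition)
  obtain u' v' where q: "q = ?c u' + ?X * ?c v'"
    by (rule even_odd_decomposition)
  have "?c (quad_norm u v) * q = (?c u - ?X * ?c v) * (p * q)"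
    unfolding pcompose_quad_norm p by (simp only: mult.assoc)
  then have "?H dvd ?c (quad_norm u v) * q"
    using pq by (simp only: dvd_mult)
  also have "?c (quad_norm u v) * q = ?c (quad_norm u v * u') + ?X * ?c (quad_norm u v * v')"
    unfolding q pcompose_mult by (simp only: algebra_simps)
  finally have "?g dvd quad_norm u v * u'" "?g dvd quad_norm u v * v'"
    unfolding preimage_poly_Suc_dvd_even_odd_iff by blast+
  then have "?g dvd quad_norm u v \<or> ?g dvd u' \<and> ?g dvd v'"
    unfolding prime_elem_dvd_mult_iff[OF prime] by blast
  then show "?H dvd p \<or> ?H dvd q"
    unfolding p q preimage_poly_Suc_dvd_even_odd_iff
    using preimage_poly_dvd_quad_norm[OF prime param] by blast
qed

theorem prime_elem_preimage_poly:
  fixes a :: "'k::alg_closed_field"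
  assumes "critical_roots_simple N a"
  shows "prime_elem (preimage_poly N a)"
  using assms
proof (induction N)
  case 0
  have dvd: "preimage_poly 0 a dvd p \<longleftrightarrow> poly p [:a:] = 0" for p
    by (simp add: preimage_poly_def poly_eq_0_iff_dvd)
  show ?case
    by (rule prime_elemI) (auto simp: dvd, simp add: preimage_poly_def)
next
  case (Suc N)
  obtain c0 where c0: "poly (crit_poly (Suc N) a) c0 = 0"
    by (rule crit_poly_Suc_root)
  obtain \<gamma> where "curve_param N a (\<gamma> + fps_X) \<gamma>"
    using curve_param_at_critical_root[OF c0 critical_roots_simpleD[OF Suc.prems c0]] by blast
  then show ?case
    using Suc critical_roots_simple_mono[of "Suc N" a N] by (intro prime_elem_preimage_poly_Suc) auto
qed

section \<open>Subfields and degrees\<close>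

abbreviation type_ring :: "'r::comm_ring_1 ring" where
  "type_ring \<equiv> ring_of_type_algebra"

lemma type_ring_simps [simp]:
  "carrier type_ring = UNIV"
  "x \<otimes>\<^bsub>type_ring\<^esub> y = x * y" "x \<oplus>\<^bsub>type_ring\<^esub> y = x + y"
  "\<one>\<^bsub>type_ring\<^esub> = 1" "\<zero>\<^bsub>type_ring\<^esub> = 0"
  by (simp_all add: ring_of_type_algebra_def)

interpretation type_ring: domain "type_ring :: 'f::field ring"
  by (rule field.axioms(1)[OF field_from_type_algebra])

lemma type_ring_a_inv [simp]: "\<ominus>\<^bsub>type_ring\<^esub> (x :: 'f::field) = - x"
  using type_ring.minus_equality[of "- x" x] by simp

lemma type_ring_m_inv [simp]: "x \<noteq> 0 \<Longrightarrow> inv\<^bsub>type_ring\<^esub> (x :: 'f::field) = inverse x"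
  using type_ring.inv_char[of x "inverse x"] by simp

lemma type_ring_pow [simp]: "x [^]\<^bsub>type_ring\<^esub> (n :: nat) = (x :: 'f::field) ^ n"
  by (induction n) (auto simp: mult.commute)

abbreviation is_subfield :: "'f::field set \<Rightarrow> bool" where
  "is_subfield S \<equiv> subfield S type_ring"

abbreviation has_degree :: "nat \<Rightarrow> 'f::field set \<Rightarrow> 'f set \<Rightarrow> bool" where
  "has_degree n S V \<equiv> type_ring.dimension n S V"

lemma is_subfieldI:
  assumes "1 \<in> S" "\<And>a. a \<in> S \<Longrightarrow> - a \<in> S" "\<And>a b. a \<in> S \<Longrightarrow> b \<in> S \<Longrightarrow> a + b \<in> S"
    "\<And>a b. a \<in> S \<Longrightarrow> b \<in> S \<Longrightarrow> a * b \<in> S" "\<And>a. a \<in> S \<Longrightarrow> a \<noteq> 0 \<Longrightarrow> inverse a \<in> S"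
  shows "is_subfield S"
  by (rule field.subfieldI'[OF field_from_type_algebra], rule type_ring.subringI) (use assms in auto)

context
  fixes S :: "'f::field set"
  assumes S: "is_subfield S"
begin

lemma subfield_0: "0 \<in> S"
  using subringE(2)[OF subfieldE(1)[OF S]] by simp

lemma subfield_1: "1 \<in> S"
  using subringE(3)[OF subfieldE(1)[OF S]] by simp

lemma subfield_uminus: "a \<in> S \<Longrightarrow> - a \<in> S"
  using subringE(5)[OF subfieldE(1)[OF S], of a] by simp

lemma subfield_mult: "a \<in> S \<Longrightarrow> b \<in> S \<Longrightarrow> a * b \<in> S"
  using subringE(6)[OF subfieldE(1)[OF S], of a b] by simp

lemma subfield_add: "a \<in> S \<Longrightarrow> b \<in> S \<Longrightarrow> a + b \<in> S"
  using subringE(7)[OF subfieldE(1)[OF S], of a b] by simp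

lemma subfield_diff: "a \<in> S \<Longrightarrow> b \<in> S \<Longrightarrow> a - b \<in> S"
  using subfield_add[of a "- b"] subfield_uminus[of b] by simp

lemma subfield_inverse: "a \<in> S \<Longrightarrow> inverse a \<in> S"
  using type_ring.subfield_m_inv(1)[OF S, of a] subfield_0 by (cases "a = 0") auto

lemma subfield_divide: "a \<in> S \<Longrightarrow> b \<in> S \<Longrightarrow> a / b \<in> S"
  by (simp add: field_class.field_divide_inverse subfield_mult subfield_inverse)

lemma subfield_power: "a \<in> S \<Longrightarrow> a ^ n \<in> S"
  by (induction n) (auto intro: subfield_mult subfield_1)

lemma subfield_sum: "(\<And>i. i \<in> A \<Longrightarrow> f i \<in> S) \<Longrightarrow> sum f A \<in> S"
  by (induction A rule: infinite_finite_induct) (auto intro: subfield_0 subfield_add)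

lemma subfield_quad_map_funpow: "c \<in> S \<Longrightarrow> z \<in> S \<Longrightarrow> (quad_map c ^^ n) z \<in> S"
  by (induction n) (auto simp: quad_map_def intro: subfield_add subfield_power)

end

lemmas subfield_closed = subfield_0 subfield_1 subfield_uminus subfield_mult subfield_add
  subfield_diff subfield_inverse subfield_divide subfield_power

lemma combine_eq_sum:
  "length Ks = length Us \<Longrightarrow>
     type_ring.combine Ks Us = (\<Sum>i<length Us. Ks ! i * (Us ! i :: 'f::field))"
  by (induction Ks Us rule: list_induct2)
     (simp_all add: sum.lessThan_Suc_shift del: sum.lessThan_Suc)

lemma has_degree_imp_relation:
  fixes u :: "nat \<Rightarrow> 'f::field"
  assumes S: "is_subfield S" and degree: "has_degree n S V" and u: "\<forall>i\<le>n. u i \<in> V"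
  obtains k where "\<forall>i\<le>n. k i \<in> S" "\<exists>i\<le>n. k i \<noteq> 0" "(\<Sum>i\<le>n. k i * u i) = 0"
proof -
  let ?Us = "map u [0..<Suc n]"
  have "\<not> type_ring.independent S ?Us"
  proof
    assume "type_ring.independent S ?Us"
    moreover have "set ?Us \<subseteq> V"
      using u by auto
    ultimately have "length ?Us \<le> n"
      using type_ring.independent_length_le_dimension[OF S degree] by blast
    then show False by simp
  qed
  then obtain Ks where Ks: "length Ks = length ?Us" "type_ring.combine Ks ?Us = 0"
      "set Ks \<subseteq> S" "set Ks \<noteq> {0}"
    using type_ring.dependent_imp_non_trivial_combine[OF S, of ?Us] by auto
  have length: "length Ks = Suc n"
    using Ks(1) by simp
  show ?thesis
  proof (rule that)
    show "\<forall>i\<le>n. Ks ! i \<in> S"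
      using Ks(3) length by (metis le_imp_less_Suc nth_mem subsetD)
    have "set Ks \<noteq> {}"
      using length by auto
    then have "\<not> set Ks \<subseteq> {0}"
      using Ks(4) by (simp add: subset_singleton_iff)
    then obtain b where "b \<in> set Ks" "b \<noteq> 0"
      by blast
    then show "\<exists>i\<le>n. Ks ! i \<noteq> 0"
      using length by (metis in_set_conv_nth less_Suc_eq_le)
    have "(\<Sum>i\<le>n. Ks ! i * u i) = (\<Sum>i<Suc n. Ks ! i * (?Us ! i))"
      unfolding lessThan_Suc_atMost by (rule sum.cong) (auto simp: nth_append less_Suc_eq)
    then show "(\<Sum>i\<le>n. Ks ! i * u i) = 0"
      using Ks(2) combine_eq_sum[OF Ks(1)] by simp
  qed
qed

lemma has_degree_pos:
  assumes "is_subfield S" "has_degree n S V" "1 \<in> V"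
  shows "n > 0"
proof (rule ccontr)
  assume "\<not> n > 0"
  moreover have "\<forall>i\<le>n. (1 :: 'a) \<in> V"
    using assms(3) by simp
  then obtain k where "\<forall>i\<le>n. k i \<in> S" "\<exists>i\<le>n. k i \<noteq> 0" "(\<Sum>i\<le>n. k i * 1) = 0"
    by (rule has_degree_imp_relation[OF assms(1,2)])
  ultimately show False
    by simp
qed

lemma has_degree_1_subset:
  assumes S: "is_subfield S" and degree: "has_degree 1 S V" and "1 \<in> V"
  shows "V \<subseteq> S"
proof
  fix x assume "x \<in> V"
  then have "\<forall>i\<le>1. (if i = (0 :: nat) then 1 else x) \<in> V"
    using \<open>1 \<in> V\<close> by simp
  then obtain k :: "nat \<Rightarrow> 'a" where k: "\<forall>i\<le>1. k i \<in> S" "\<exists>i\<le>1. k i \<noteq> 0"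
      "(\<Sum>i\<le>1. k i * (if i = 0 then 1 else x)) = 0"
    by (rule has_degree_imp_relation[OF S degree])
  have relation: "k 0 + k 1 * x = 0"
    using k(3) by simp
  moreover have "k 0 \<noteq> 0 \<or> k 1 \<noteq> 0"
    using k(2) by (metis le_neq_implies_less less_one)
  ultimately have "k 1 \<noteq> 0"
    by auto
  then have "x = - k 0 / k 1"
    using relation by (simp add: field_simps eq_neg_iff_add_eq_0)
  then show "x \<in> S"
    using k(1) S by (auto intro!: subfield_closed)
qed

lemma subalgebra_subfield:
  assumes "is_subfield S" "is_subfield V" "S \<subseteq> V"
  shows "subalgebra S V type_ring"
proof (intro subalgebra.intro subalgebra_axioms.intro)
  show "subgroup V (add_monoid type_ring)"
    using subring.axioms(1)[OF subfieldE(1)[OF assms(2)]] .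
qed (use assms in \<open>auto intro: subfield_mult\<close>)

lemma has_degree_tower_split:
  fixes S E L :: "'f::field set"
  assumes S: "is_subfield S" and E: "is_subfield E" and L: "is_subfield L"
    and "S \<subseteq> E" "E \<subseteq> L" and degree: "has_degree n S L"
  obtains e m where "has_degree e S E" "has_degree m E L" "n = e * m"
proof -
  have finite_SE: "type_ring.finite_dimension S E"
    using type_ring.subalbegra_incl_imp_finite_dimension[OF S type_ring.finite_dimensionI[OF degree]]
      subalgebra_subfield S E \<open>S \<subseteq> E\<close> \<open>E \<subseteq> L\<close> by blast
  obtain Us where Us: "set Us \<subseteq> carrier type_ring" "type_ring.Span S Us = L"
    using type_ring.exists_base[OF S degree] by blast
  have "type_ring.Span E Us = L"
  proof
    have "set Us \<subseteq> L"
      using type_ring.Span_base_incl[OF S Us(1)] Us(2) by simp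
    then show "type_ring.Span E Us \<subseteq> L"
      by (intro type_ring.subalgebra_Span_incl[OF E] subalgebra_subfield E L \<open>E \<subseteq> L\<close>)
    have "subalgebra E (type_ring.Span E Us) type_ring"
      by (rule type_ring.Span_is_subalgebra[OF E Us(1)])
    then have "subalgebra S (type_ring.Span E Us) type_ring"
      using \<open>S \<subseteq> E\<close> unfolding subalgebra_def subalgebra_axioms_def by blast
    then show "L \<subseteq> type_ring.Span E Us"
      using type_ring.subalgebra_Span_incl[OF S _ type_ring.Span_base_incl[OF E Us(1)]] Us(2) by simp
  qed
  then have "type_ring.finite_dimension E L"
    using type_ring.Span_finite_dimension[OF E Us(1)] by simp
  then obtain e m where em: "has_degree e S E" "has_degree m E L"
    using finite_SE unfolding type_ring.finite_dimension_def by blast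
  have "n = e * m"
    using type_ring.dimension_is_inj[OF S degree type_ring.telescopic_base[OF S E em]] .
  with em show ?thesis
    by (rule that)
qed

lemma has_degree_simple_extension_le:
  fixes y :: "'f::field"
  assumes S: "is_subfield S" and k: "\<forall>i\<le>d. k i \<in> S" "k d \<noteq> 0" and root: "(\<Sum>i\<le>d. k i * y ^ i) = 0"
  obtains n where "n \<le> d" "has_degree n S (type_ring.simple_extension S y)"
    "is_subfield (type_ring.simple_extension S y)"
proof -
  define p where "p m = map k (rev [0..<m])" for m
  have "type_ring.eval (p m) y = (\<Sum>i<m. k i * y ^ i)" for m
    by (induction m) (simp_all add: p_def add.commute)
  from this[of "Suc d"] have eval: "type_ring.eval (p (Suc d)) y = \<zero>\<^bsub>type_ring\<^esub>"
    using root by (simp add: lessThan_Suc_atMost del: sum.lessThan_Suc)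
  have p: "p (Suc d) \<in> carrier (univ_poly type_ring S)"
    using k by (auto simp: p_def univ_poly_def polynomial_def)
  have algebraic: "(type_ring.algebraic over S) y"
    by (rule type_ring.algebraicI[OF p _ eval]) (simp add: p_def)
  have "length (type_ring.Irr S y) - 1 \<le> length (p (Suc d)) - 1"
  proof (rule type_ring.pdivides_imp_degree_le[OF subfieldE(1)[OF S]])
    show "type_ring.Irr S y \<in> carrier (univ_poly type_ring S)"
      by (rule type_ring.IrrE(1)[OF S _ algebraic]) simp
    show "type_ring.Irr S y pdivides\<^bsub>type_ring\<^esub> p (Suc d)"
      by (rule type_ring.Irr_minimal[OF S _ algebraic p eval]) simp
  qed (use p in \<open>auto simp: p_def\<close>)
  then have "length (type_ring.Irr S y) - 1 \<le> d"
    by (simp add: p_def)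
  moreover have "has_degree (length (type_ring.Irr S y) - 1) S (type_ring.simple_extension S y)"
    by (rule type_ring.dimension_simple_extension[OF S _ algebraic]) simp
  moreover have "is_subfield (type_ring.simple_extension S y)"
    using type_ring.simple_extension_is_subfield[OF S, of y] algebraic by simp
  ultimately show ?thesis
    by (rule that)
qed

lemma has_degree_simple_le:
  fixes y :: "'f::field"
  assumes S: "is_subfield S" and V: "is_subfield V" "S \<subseteq> V" "y \<in> V"
    and least: "\<And>T. is_subfield T \<Longrightarrow> S \<subseteq> T \<Longrightarrow> y \<in> T \<Longrightarrow> V \<subseteq> T"
    and k: "\<forall>i\<le>d. k i \<in> S" "k d \<noteq> 0" "(\<Sum>i\<le>d. k i * y ^ i) = 0"
  obtains n where "n \<le> d" "has_degree n S V"
proof -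
  let ?E = "type_ring.simple_extension S y"
  obtain n where n: "n \<le> d" "has_degree n S ?E" "is_subfield ?E"
    by (rule has_degree_simple_extension_le[OF S k])
  have "S \<subseteq> ?E"
    by (rule type_ring.simple_extension_incl) simp_all
  moreover have "y \<in> ?E"
    by (rule type_ring.simple_extension_mem[OF subfieldE(1)[OF S]]) simp
  ultimately have "V \<subseteq> ?E"
    by (rule least[OF n(3)])
  moreover have "?E \<subseteq> V"
    by (rule type_ring.simple_extension_subring_incl[OF subfieldE(1)[OF V(1)] V(2,3)])
  ultimately have "?E = V"
    by blast
  then show ?thesis
    using that[OF n(1)] n(2) by simp
qed

lemma quadratic_extension_inverse:
  fixes E :: "'f::field set"
  assumes E: "is_subfield E" and square: "x * x \<in> E" and x: "x \<notin> E"
    and uv: "u \<in> E" "v \<in> E" "u + x * v \<noteq> 0"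
  obtains u' v' where "u' \<in> E" "v' \<in> E" "inverse (u + x * v) = u' + x * v'"
proof -
  have "u - x * v \<noteq> 0"
  proof
    assume conj_0: "u - x * v = 0"
    then have "v \<noteq> 0"
      using uv(3) by auto
    then have "x = u / v"
      using conj_0 by (simp add: field_simps)
    then show False
      using x uv by (simp add: subfield_closed[OF E])
  qed
  define d where "d = u * u - x * x * (v * v)"
  have d: "d = (u + x * v) * (u - x * v)"
    unfolding d_def by (simp add: algebra_simps)
  have "d \<in> E"
    unfolding d_def by (intro subfield_closed[OF E] square uv)
  have "inverse (u + x * v) = (u - x * v) / d"
    by (simp only: d inverse_eq_divide nonzero_divide_mult_cancel_right[OF \<open>u - x * v \<noteq> 0\<close>])
  also have "\<dots> = u / d + x * (- v / d)"
    by (simp add: diff_divide_distrib)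
  finally show ?thesis
    by (rule that[rotated 2]) (use uv \<open>d \<in> E\<close> in \<open>simp_all add: subfield_closed[OF E]\<close>)
qed

lemma subfield_quadratic_extension:
  fixes E :: "'f::field set"
  assumes E: "is_subfield E" and square: "x * x \<in> E" and x: "x \<notin> E"
  shows "is_subfield {u + x * v | u v. u \<in> E \<and> v \<in> E}" (is "is_subfield ?T")
proof (rule is_subfieldI)
  note E_closed = subfield_closed[OF E]
  define y where "y = x * x"
  have "y \<in> E"
    using square by (simp add: y_def)
  have mem: "z \<in> ?T" if "z = u + x * v" "u \<in> E" "v \<in> E" for z u v
    using that by blast
  show "1 \<in> ?T"
    by (rule mem[of _ 1 0]) (simp_all add: E_closed)
  fix z assume "z \<in> ?T"
  then obtain u v where z: "z = u + x * v" "u \<in> E" "v \<in> E"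
    by blast
  show "- z \<in> ?T"
    by (rule mem[of _ "- u" "- v"]) (simp_all add: z E_closed)
  show "inverse z \<in> ?T" if "z \<noteq> 0"
    unfolding z(1)
    by (rule quadratic_extension_inverse[OF E square x z(2,3) that[unfolded z(1)]]) (rule mem)
  fix w assume "w \<in> ?T"
  then obtain u' v' where w: "w = u' + x * v'" "u' \<in> E" "v' \<in> E"
    by blast
  show "z + w \<in> ?T"
    by (rule mem[of _ "u + u'" "v + v'"]) (simp_all add: z w E_closed algebra_simps)
  show "z * w \<in> ?T"
    by (rule mem[of _ "u * u' + y * (v * v')" "u * v' + v * u'"])
       (simp_all add: z w \<open>y \<in> E\<close> E_closed, simp add: y_def algebra_simps)
qed

section \<open>Fields of fractions inside a field\<close>

definition fractions :: "('r::comm_ring_1 \<Rightarrow> 'f::field) \<Rightarrow> 'f set" where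
  "fractions e = {e p / e q | p q. e q \<noteq> 0}"

lemma fractionsI: "e q \<noteq> 0 \<Longrightarrow> e p / e q \<in> fractions e"
  by (auto simp: fractions_def)

lemma fractionsE:
  assumes "z \<in> fractions e"
  obtains p q where "z = e p / e q" "e q \<noteq> 0"
  using assms by (auto simp: fractions_def)

lemma image_in_fractions:
  assumes "comm_ring_hom e"
  shows "e p \<in> fractions e"
proof -
  interpret comm_ring_hom e by fact
  show ?thesis
    using fractionsI[of e 1 p] by simp
qed

lemma is_subfield_fractions:
  assumes "comm_ring_hom e"
  shows "is_subfield (fractions e)"
proof (rule is_subfieldI)
  interpret comm_ring_hom e by fact
  show "1 \<in> fractions e"
    using fractionsI[of e 1 1] by simp
  fix a assume "a \<in> fractions e"
  then obtain p q where a: "a = e p / e q" "e q \<noteq> 0"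
    by (rule fractionsE)
  show "- a \<in> fractions e"
    using fractionsI[of e q "- p"] a by (simp add: hom_uminus)
  show "inverse a \<in> fractions e" if "a \<noteq> 0"
    using fractionsI[of e p q] a that by simp
  fix b assume "b \<in> fractions e"
  then obtain p' q' where b: "b = e p' / e q'" "e q' \<noteq> 0"
    by (rule fractionsE)
  show "a * b \<in> fractions e"
    using fractionsI[of e "q * q'" "p * p'"] a b by (simp add: hom_mult)
  have "a + b = e (p * q' + p' * q) / e (q * q')"
    using a b by (simp add: hom_add hom_mult field_simps)
  also have "\<dots> \<in> fractions e"
    by (rule fractionsI) (use a b in \<open>simp add: hom_mult\<close>)
  finally show "a + b \<in> fractions e" .
qed

lemma fractions_subset: "is_subfield T \<Longrightarrow> (\<And>p. e p \<in> T) \<Longrightarrow> fractions e \<subseteq> T"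
  by (auto simp: fractions_def intro: subfield_divide)

definition adjoin :: "('k::field \<Rightarrow> 'f::field) \<Rightarrow> 'f \<Rightarrow> 'f set" where
  "adjoin j h = fractions (\<lambda>p. eval_poly j p h)"

definition adjoin2 :: "('k::field \<Rightarrow> 'f::field) \<Rightarrow> 'f \<Rightarrow> 'f \<Rightarrow> 'f set" where
  "adjoin2 j x c = fractions (eval_poly2 j x c)"

context field_hom
begin

lemma is_subfield_range: "is_subfield (range hom)"
proof (rule is_subfieldI)
  show "1 \<in> range hom"
    using hom_one by (metis rangeI)
qed (auto simp flip: hom_add hom_mult hom_uminus hom_inverse)

lemma is_subfield_adjoin: "is_subfield (adjoin hom h)"
  unfolding adjoin_def by (intro is_subfield_fractions comm_ring_hom_eval_poly)

lemma is_subfield_adjoin2: "is_subfield (adjoin2 hom x c)"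
  unfolding adjoin2_def by (intro is_subfield_fractions comm_ring_hom_eval_poly2)

lemma eval_poly_in_adjoin: "eval_poly hom p h \<in> adjoin hom h"
  unfolding adjoin_def by (rule image_in_fractions[OF comm_ring_hom_eval_poly])

lemma eval_poly2_in_adjoin2: "eval_poly2 hom x c p \<in> adjoin2 hom x c"
  unfolding adjoin2_def by (rule image_in_fractions[OF comm_ring_hom_eval_poly2])

lemma const_in_adjoin: "hom a \<in> adjoin hom h"
  using eval_poly_in_adjoin[of "[:a:]" h] by simp

lemma generator_in_adjoin: "h \<in> adjoin hom h"
  using eval_poly_in_adjoin[of "[:0, 1:]" h] by simp

lemma const_in_adjoin2: "hom a \<in> adjoin2 hom x c"
  using eval_poly2_in_adjoin2[of x c "[:[:a:]:]"] by simp

lemma generators_in_adjoin2: "x \<in> adjoin2 hom x c" "c \<in> adjoin2 hom x c"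
  using eval_poly2_in_adjoin2[of x c "[:0, 1:]"] eval_poly2_in_adjoin2[of x c "[:[:0, 1:]:]"]
  by simp_all

lemma range_subset_adjoin: "range hom \<subseteq> adjoin hom h"
  using const_in_adjoin by auto

lemma range_subset_adjoin2: "range hom \<subseteq> adjoin2 hom x c"
  using const_in_adjoin2 by auto

lemma eval_poly_in_subfield:
  "is_subfield T \<Longrightarrow> range hom \<subseteq> T \<Longrightarrow> h \<in> T \<Longrightarrow> eval_poly hom p h \<in> T"
  by (induction p) (auto intro!: subfield_closed)

lemma eval_poly2_in_subfield:
  assumes "is_subfield T" "range hom \<subseteq> T" "x \<in> T" "c \<in> T"
  shows "eval_poly2 hom x c p \<in> T"
  by (induction p)
     (use assms in \<open>auto simp: eval_poly2_pCons intro!: subfield_closed eval_poly_in_subfield\<close>)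

lemma adjoin_subset: "is_subfield T \<Longrightarrow> range hom \<subseteq> T \<Longrightarrow> h \<in> T \<Longrightarrow> adjoin hom h \<subseteq> T"
  unfolding adjoin_def by (intro fractions_subset eval_poly_in_subfield)

lemma adjoin2_subset:
  "is_subfield T \<Longrightarrow> range hom \<subseteq> T \<Longrightarrow> x \<in> T \<Longrightarrow> c \<in> T \<Longrightarrow> adjoin2 hom x c \<subseteq> T"
  unfolding adjoin2_def by (intro fractions_subset eval_poly2_in_subfield)

lemma adjoin_subset_range: "h \<in> range hom \<Longrightarrow> adjoin hom h \<subseteq> range hom"
  by (intro adjoin_subset is_subfield_range) auto

lemma adjoin_eqI: "h \<in> adjoin hom g \<Longrightarrow> g \<in> adjoin hom h \<Longrightarrow> adjoin hom h = adjoin hom g"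
  by (intro equalityI adjoin_subset is_subfield_adjoin range_subset_adjoin)

lemma transcendental_if_adjoin_eq:
  "adjoin hom h = adjoin hom g \<Longrightarrow> g \<notin> range hom \<Longrightarrow> h \<notin> range hom"
  using adjoin_subset_range[of h] generator_in_adjoin[of g] by blast

lemma adjoin_diff_const: "adjoin hom (h - hom s) = adjoin hom h"
proof (rule adjoin_eqI)
  show "h - hom s \<in> adjoin hom h"
    by (intro subfield_diff is_subfield_adjoin generator_in_adjoin const_in_adjoin)
  have "(h - hom s) + hom s \<in> adjoin hom (h - hom s)"
    by (intro subfield_add is_subfield_adjoin generator_in_adjoin const_in_adjoin)
  then show "h \<in> adjoin hom (h - hom s)" by simp
qed

lemma adjoin_inverse: "adjoin hom (inverse h) = adjoin hom h"
proof (rule adjoin_eqI)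
  show "inverse h \<in> adjoin hom h"
    by (intro subfield_inverse is_subfield_adjoin generator_in_adjoin)
  have "inverse (inverse h) \<in> adjoin hom (inverse h)"
    by (intro subfield_inverse is_subfield_adjoin generator_in_adjoin)
  then show "h \<in> adjoin hom (inverse h)" by simp
qed

end

section \<open>Relations with polynomial coefficients\<close>

locale alg_closed_embedding = field_hom j for j :: "'k::alg_closed_field \<Rightarrow> 'f::field"
begin

lemma eval_poly_eq_0_iff: "z \<notin> range j \<Longrightarrow> eval_poly j p z = 0 \<longleftrightarrow> p = 0"
  by (rule eval_poly_eq_0_iff_transcendental[OF comm_ring_hom_axioms])

lemma relation_not_vanishing_at_0:
  assumes "m \<in> I" "p m \<noteq> 0" "w \<noteq> 0" "(\<Sum>i\<in>I. eval_poly j (p i) w * u i) = 0"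
  obtains q where "\<exists>i\<in>I. poly (q i) 0 \<noteq> 0" "(\<Sum>i\<in>I. eval_poly j (q i) w * u i) = 0"
  using assms
proof (induction "degree (p m)" arbitrary: p thesis rule: less_induct)
  case less
  show ?case
  proof (cases "\<exists>i\<in>I. poly (p i) 0 \<noteq> 0")
    case True
    then show ?thesis
      using less.prems(1,5) by blast
  next
    case False
    have "\<exists>r. p i = pCons 0 r" if "i \<in> I" for i
      using False that by (cases "p i" rule: pCons_cases) auto
    then obtain r where r: "\<And>i. i \<in> I \<Longrightarrow> p i = pCons 0 (r i)"
      by metis
    have "r m \<noteq> 0"
      using r[OF \<open>m \<in> I\<close>] \<open>p m \<noteq> 0\<close> by auto
    then have "degree (r m) < degree (p m)"
      unfolding r[OF \<open>m \<in> I\<close>] by simp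
    moreover have "(\<Sum>i\<in>I. eval_poly j (p i) w * u i) = w * (\<Sum>i\<in>I. eval_poly j (r i) w * u i)"
      unfolding sum_distrib_left by (rule sum.cong) (auto simp: r)
    then have "(\<Sum>i\<in>I. eval_poly j (r i) w * u i) = 0"
      using less.prems by simp
    ultimately show ?thesis
      using less.hyps[of r] less.prems(1,2,4) \<open>r m \<noteq> 0\<close> by blast
  qed
qed

lemma has_degree_imp_polynomial_relation:
  assumes w: "w \<notin> range j" and degree: "has_degree n (adjoin j w) V" and u: "\<forall>i\<le>n. u i \<in> V"
  obtains q where "\<exists>i\<le>n. poly (q i) 0 \<noteq> 0" "(\<Sum>i\<le>n. eval_poly j (q i) w * u i) = 0"
proof -
  interpret eval: comm_ring_hom "\<lambda>p. eval_poly j p w"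
    by (rule comm_ring_hom_eval_poly)
  obtain k where k: "\<forall>i\<le>n. k i \<in> adjoin j w" "\<exists>i\<le>n. k i \<noteq> 0"
    and relation: "(\<Sum>i\<le>n. k i * u i) = 0"
    by (rule has_degree_imp_relation[OF is_subfield_adjoin degree u])
  then obtain m where m: "m \<le> n" "k m \<noteq> 0"
    by blast
  have "\<forall>i\<in>{..n}. \<exists>a b. k i = eval_poly j a w / eval_poly j b w \<and> eval_poly j b w \<noteq> 0"
    using k(1) unfolding adjoin_def by (auto elim!: fractionsE)
  then obtain a b where ab: "\<And>i. i \<le> n \<Longrightarrow> k i = eval_poly j (a i) w / eval_poly j (b i) w"
      "\<And>i. i \<le> n \<Longrightarrow> eval_poly j (b i) w \<noteq> 0"
    by (metis atMost_iff)
  define B where "B = (\<Prod>l\<le>n. eval_poly j (b l) w)"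
  have "B \<noteq> 0"
    using ab(2) by (simp add: B_def)
  define p where "p i = a i * (\<Prod>l\<in>{..n} - {i}. b l)" for i
  have p: "eval_poly j (p i) w = B * k i" if "i \<le> n" for i
  proof -
    have "B = eval_poly j (b i) w * (\<Prod>l\<in>{..n} - {i}. eval_poly j (b l) w)"
      unfolding B_def using that by (subst prod.remove[of _ i]) auto
    then show ?thesis
      using ab[OF that] by (simp add: p_def eval.hom_mult eval.hom_prod)
  qed
  have "p m \<noteq> 0"
    using p[OF m(1)] m(2) \<open>B \<noteq> 0\<close> by auto
  moreover have "w \<noteq> 0"
    using w hom_zero by (metis rangeI)
  moreover have "(\<Sum>i\<le>n. eval_poly j (p i) w * u i) = B * (\<Sum>i\<le>n. k i * u i)"
    unfolding sum_distrib_left by (rule sum.cong) (auto simp: p)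
  ultimately show ?thesis
    using relation_not_vanishing_at_0[of m "{..n}" p w u] m(1) relation that by auto
qed

lemma has_degree_imp_algebraic:
  assumes w: "w \<notin> range j" and degree: "has_degree n (adjoin j w) V" and z: "\<forall>i\<le>n. z ^ i \<in> V"
  obtains S where "map_poly (\<lambda>q. poly q 0) S \<noteq> 0" "degree S \<le> n" "eval_poly2 j z w S = 0"
proof -
  obtain q where "\<exists>m\<le>n. poly (q m) 0 \<noteq> 0"
    and relation: "(\<Sum>i\<le>n. eval_poly j (q i) w * z ^ i) = 0"
    by (rule has_degree_imp_polynomial_relation[OF w degree z])
  then obtain m where m: "m \<le> n" "poly (q m) 0 \<noteq> 0"
    by blast
  define S where "S = (\<Sum>i\<le>n. Polynomial.monom (q i) i)"
  have coeff_S: "coeff S i = (if i \<le> n then q i else 0)" for i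
    unfolding S_def coeff_sum by (simp add: coeff_monom)
  then have "degree S \<le> n"
    by (intro degree_le) simp
  moreover have "coeff (map_poly (\<lambda>q. poly q 0) S) m \<noteq> 0"
    using m by (simp add: coeff_map_poly coeff_S)
  then have "map_poly (\<lambda>q. poly q 0) S \<noteq> 0"
    by (metis coeff_0)
  moreover have "eval_poly2 j z w S = 0"
    unfolding eval_poly2_eq_sum[OF \<open>degree S \<le> n\<close>] using relation by (simp add: coeff_S)
  ultimately show ?thesis
    using that by blast
qed

end

section \<open>Places\<close>

definition places :: "('k::field \<Rightarrow> 'f::field) \<Rightarrow> 'f set \<Rightarrow> 'f set set" where
  "places j L = {P. P \<subseteq> L \<and> P \<noteq> L \<and> range j \<subseteq> P \<and> range j \<noteq> P \<and>
     (\<forall>a\<in>P. \<forall>b\<in>P. a + b \<in> P \<and> a * b \<in> P) \<and> (\<forall>a\<in>P. - a \<in> P) \<and>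
     (\<forall>z\<in>L - {0}. z \<in> P \<or> inverse z \<in> P)}"

definition nonunits :: "'f::field set \<Rightarrow> 'f set" where
  "nonunits P = {z \<in> P. z = 0 \<or> inverse z \<notin> P}"

definition takes_value :: "('k::field \<Rightarrow> 'f::field) \<Rightarrow> 'f set \<Rightarrow> 'f \<Rightarrow> 'k \<Rightarrow> bool" where
  "takes_value j P z s \<longleftrightarrow> z \<in> P \<and> z - j s \<in> nonunits P"

locale place = field_hom j for j :: "'k::field \<Rightarrow> 'f::field" +
  fixes L P
  assumes L: "is_subfield L" and P: "P \<in> places j L"
begin

lemma mem_field: "z \<in> P \<Longrightarrow> z \<in> L"
  using P by (auto simp: places_def)

lemma const_mem: "j s \<in> P"
  using P unfolding places_def by blast

lemma zero_mem: "0 \<in> P"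
  using const_mem[of 0] by simp

lemma one_mem: "1 \<in> P"
  using const_mem[of 1] by simp

lemma add_mem: "a \<in> P \<Longrightarrow> b \<in> P \<Longrightarrow> a + b \<in> P"
  using P by (auto simp: places_def)

lemma mult_mem: "a \<in> P \<Longrightarrow> b \<in> P \<Longrightarrow> a * b \<in> P"
  using P by (auto simp: places_def)

lemma uminus_mem: "a \<in> P \<Longrightarrow> - a \<in> P"
  using P by (auto simp: places_def)

lemma diff_mem: "a \<in> P \<Longrightarrow> b \<in> P \<Longrightarrow> a - b \<in> P"
  using add_mem[of a "- b"] uminus_mem[of b] by simp

lemma power_mem: "a \<in> P \<Longrightarrow> a ^ n \<in> P"
  by (induction n) (auto intro: one_mem mult_mem)

lemma mem_or_inverse_mem: "z \<in> L \<Longrightarrow> z \<noteq> 0 \<Longrightarrow> z \<in> P \<or> inverse z \<in> P"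
  using P by (auto simp: places_def)

lemma nonunit_mem: "z \<in> nonunits P \<Longrightarrow> z \<in> P"
  by (auto simp: nonunits_def)

lemma zero_nonunit: "0 \<in> nonunits P"
  by (auto simp: nonunits_def zero_mem)

lemma inverse_mem_if_unit: "z \<in> P \<Longrightarrow> z \<notin> nonunits P \<Longrightarrow> z \<noteq> 0 \<and> inverse z \<in> P"
  by (auto simp: nonunits_def)

lemma inverse_nonunit: "z \<in> L \<Longrightarrow> z \<notin> P \<Longrightarrow> inverse z \<in> nonunits P"
  using mem_or_inverse_mem[of z] zero_mem by (auto simp: nonunits_def)

lemma nonunit_mult_left:
  assumes a: "a \<in> nonunits P" and b: "b \<in> P"
  shows "a * b \<in> nonunits P"
proof (cases "a * b = 0")
  case True
  show ?thesis
    unfolding True by (rule zero_nonunit)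
next
  case False
  have "inverse (a * b) \<notin> P"
  proof
    assume "inverse (a * b) \<in> P"
    then have "b * inverse (a * b) \<in> P"
      using b mult_mem by blast
    moreover have "b * inverse (a * b) = inverse a"
      using False by (simp add: field_simps)
    ultimately have "inverse a \<in> P"
      by metis
    then show False
      using a False by (auto simp: nonunits_def)
  qed
  then show ?thesis
    using a b by (auto simp: nonunits_def mult_mem)
qed

lemma nonunit_mult_right: "a \<in> P \<Longrightarrow> b \<in> nonunits P \<Longrightarrow> a * b \<in> nonunits P"
  using nonunit_mult_left[of b a] by (simp add: mult.commute)

lemma one_not_nonunit: "1 \<notin> nonunits P"
  using one_mem by (simp add: nonunits_def)

lemma nonunit_multD:
  assumes "a \<in> P" "b \<in> P" "a * b \<in> nonunits P"
  shows "a \<in> nonunits P \<or> b \<in> nonunits P"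
proof (rule ccontr)
  assume "\<not> ?thesis"
  then have "a \<noteq> 0" "inverse a \<in> P" "b \<noteq> 0" "inverse b \<in> P"
    using inverse_mem_if_unit assms by blast+
  then have "a * b * (inverse a * inverse b) \<in> nonunits P"
    using assms nonunit_mult_left mult_mem by blast
  moreover have "a * b * (inverse a * inverse b) = 1"
    using \<open>a \<noteq> 0\<close> \<open>b \<noteq> 0\<close> by (simp add: field_simps)
  ultimately show False
    using one_not_nonunit by simp
qed

lemma nonunit_add:
  assumes a: "a \<in> nonunits P" and b: "b \<in> nonunits P"
  shows "a + b \<in> nonunits P"
proof (cases "a = 0 \<or> b = 0")
  case True
  then show ?thesis using a b by auto
next
  case False
  have "a \<in> L" "b \<in> L"
    using a b nonunit_mem mem_field by blast+
  then have "a / b \<in> L" "a / b \<noteq> 0"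
    using False subfield_divide[OF L] by auto
  then consider "a / b \<in> P" | "inverse (a / b) \<in> P"
    using mem_or_inverse_mem by blast
  then show ?thesis
  proof cases
    case 1
    then have "b * (a / b + 1) \<in> nonunits P"
      using b by (intro nonunit_mult_left add_mem one_mem)
    moreover have "b * (a / b + 1) = a + b"
      using False by (simp add: field_simps)
    ultimately show ?thesis by simp
  next
    case 2
    then have "a * (1 + inverse (a / b)) \<in> nonunits P"
      using a by (intro nonunit_mult_left add_mem one_mem)
    moreover have "a * (1 + inverse (a / b)) = a + b"
      using False by (simp add: field_simps)
    ultimately show ?thesis by simp
  qed
qed

lemma nonunit_uminus: "a \<in> nonunits P \<Longrightarrow> - a \<in> nonunits P"
  using nonunit_mult_left[of a "- 1"] uminus_mem[OF one_mem] by simp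

lemma nonunit_diff: "a \<in> nonunits P \<Longrightarrow> b \<in> nonunits P \<Longrightarrow> a - b \<in> nonunits P"
  using nonunit_add[of a "- b"] nonunit_uminus[of b] by simp

lemma nonunit_sum: "(\<And>i. i \<in> A \<Longrightarrow> f i \<in> nonunits P) \<Longrightarrow> sum f A \<in> nonunits P"
  by (induction A rule: infinite_finite_induct) (auto intro: zero_nonunit nonunit_add)

lemma const_nonunit_iff [simp]: "j s \<in> nonunits P \<longleftrightarrow> s = 0"
  using const_mem[of "inverse s"] const_mem[of s] by (auto simp: nonunits_def zero_mem hom_inverse)

lemma takes_value_mem: "takes_value j P z s \<Longrightarrow> z \<in> P"
  by (simp add: takes_value_def)

lemma takes_value_nonunit_iff: "takes_value j P z s \<Longrightarrow> z \<in> nonunits P \<longleftrightarrow> s = 0"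
proof
  assume v: "takes_value j P z s"
  show "s = 0" if "z \<in> nonunits P"
  proof -
    have "z - (z - j s) \<in> nonunits P"
      by (rule nonunit_diff) (use v that in \<open>auto simp: takes_value_def\<close>)
    then show ?thesis by simp
  qed
  show "z \<in> nonunits P" if "s = 0"
    using v that by (simp add: takes_value_def)
qed

lemma takes_value_0_iff: "takes_value j P z 0 \<longleftrightarrow> z \<in> nonunits P"
  by (auto simp: takes_value_def nonunit_mem)

lemma takes_value_const: "takes_value j P (j s) s"
  by (simp add: takes_value_def const_mem zero_nonunit)

lemma takes_value_add:
  assumes "takes_value j P z s" "takes_value j P z' s'"
  shows "takes_value j P (z + z') (s + s')"
proof -
  have "(z - j s) + (z' - j s') \<in> nonunits P"
    using assms by (intro nonunit_add) (auto simp: takes_value_def)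
  then show ?thesis
    using assms by (simp add: takes_value_def add_mem hom_add algebra_simps)
qed

lemma takes_value_mult:
  assumes "takes_value j P z s" "takes_value j P z' s'"
  shows "takes_value j P (z * z') (s * s')"
proof -
  have "(z - j s) * z' + j s * (z' - j s') \<in> nonunits P"
    by (intro nonunit_add nonunit_mult_left nonunit_mult_right const_mem)
       (use assms in \<open>auto simp: takes_value_def\<close>)
  then show ?thesis
    using assms by (simp add: takes_value_def mult_mem hom_mult algebra_simps)
qed

lemma takes_value_uminus: "takes_value j P z s \<Longrightarrow> takes_value j P (- z) (- s)"
  using takes_value_mult[OF takes_value_const[of "- 1"]] by (simp add: hom_uminus)

lemma takes_value_diff:
  "takes_value j P z s \<Longrightarrow> takes_value j P z' s' \<Longrightarrow> takes_value j P (z - z') (s - s')"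
  using takes_value_add[of z s "- z'" "- s'"] takes_value_uminus by simp

lemma takes_value_unique: "takes_value j P z s \<Longrightarrow> takes_value j P z s' \<Longrightarrow> s = s'"
  using takes_value_diff[of z s z s'] takes_value_nonunit_iff[of 0 "s - s'"] zero_nonunit by simp

lemma takes_value_eval_poly: "takes_value j P z s \<Longrightarrow> takes_value j P (eval_poly j p z) (poly p s)"
proof (induction p)
  case 0
  show ?case using takes_value_const[of 0] by simp
next
  case (pCons a p)
  then show ?case
    by (simp add: takes_value_add takes_value_mult takes_value_const)
qed

lemma takes_value_inverse:
  assumes v: "takes_value j P z s" and s: "s \<noteq> 0"
  shows "takes_value j P (inverse z) (inverse s)"
proof -
  have z: "z \<noteq> 0" "inverse z \<in> P"
    using inverse_mem_if_unit[OF takes_value_mem[OF v]] takes_value_nonunit_iff[OF v] s by auto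
  have inverse_const: "j (inverse s) = inverse (j s)" "j s \<noteq> 0"
    using s by (simp_all add: hom_inverse)
  have "(z - j s) * (- (inverse z * j (inverse s))) \<in> nonunits P"
    by (intro nonunit_mult_left uminus_mem mult_mem const_mem) (use v z in \<open>auto simp: takes_value_def\<close>)
  moreover have "(z - j s) * (- (inverse z * j (inverse s))) = inverse z - j (inverse s)"
    unfolding inverse_const(1) using z inverse_const(2) by (simp add: field_simps)
  ultimately show ?thesis
    using z by (simp add: takes_value_def)
qed

lemma takes_value_divide:
  "takes_value j P z s \<Longrightarrow> takes_value j P z' s' \<Longrightarrow> s' \<noteq> 0 \<Longrightarrow> takes_value j P (z / z') (s / s')"
  using takes_value_mult[OF _ takes_value_inverse] by (simp add: field_class.field_divide_inverse)

lemma prod_mem: "(\<And>i. i \<in> A \<Longrightarrow> f i \<in> P) \<Longrightarrow> prod f A \<in> P"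
  by (induction A rule: infinite_finite_induct) (auto intro: one_mem mult_mem)

lemma prod_nonunit_iff:
  assumes "finite A" "\<And>i. i \<in> A \<Longrightarrow> f i \<in> P"
  shows "prod f A \<in> nonunits P \<longleftrightarrow> (\<exists>i\<in>A. f i \<in> nonunits P)"
  using assms
proof (induction A)
  case (insert a A)
  have "f a \<in> P" "prod f A \<in> P"
    using insert.prems by (auto intro: prod_mem)
  then have "f a * prod f A \<in> nonunits P \<longleftrightarrow> f a \<in> nonunits P \<or> prod f A \<in> nonunits P"
    using nonunit_multD nonunit_mult_left nonunit_mult_right by blast
  then show ?case
    using insert by simp
qed (simp add: one_not_nonunit)

text \<open>Otherwise \<open>a\<^sub>d = - \<Sum>\<^sub>i a\<^sub>i z\<^sup>i\<^sup>-\<^sup>d\<close>, summed over \<open>i < d\<close>, would be a nonunit.\<close>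

lemma integral_mem:
  assumes z: "z \<in> L" and a: "\<And>i. i \<le> d \<Longrightarrow> a i \<in> P" and unit: "a d \<notin> nonunits P"
    and relation: "(\<Sum>i\<le>d. a i * z ^ i) = 0"
  shows "z \<in> P"
proof (rule ccontr)
  assume "z \<notin> P"
  then have "z \<noteq> 0"
    using zero_mem by auto
  define y where "y = inverse z"
  have y: "y \<in> nonunits P"
    unfolding y_def by (rule inverse_nonunit[OF z \<open>z \<notin> P\<close>])
  have "0 = y ^ d * (\<Sum>i\<le>d. a i * z ^ i)"
    using relation by simp
  also have "\<dots> = (\<Sum>i\<le>d. a i * y ^ (d - i))"
    unfolding sum_distrib_left
  proof (rule sum.cong)
    fix i assume "i \<in> {..d}"
    then have "y ^ d = y ^ (d - i) * y ^ i"
      by (simp flip: power_add)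
    then show "y ^ d * (a i * z ^ i) = a i * y ^ (d - i)"
      using \<open>z \<noteq> 0\<close> by (simp add: y_def field_simps)
  qed simp
  also have "\<dots> = (\<Sum>i<d. a i * y ^ (d - i)) + a d"
    by (simp flip: lessThan_Suc_atMost)
  finally have "a d = - (\<Sum>i<d. a i * y ^ (d - i))"
    by (simp add: eq_neg_iff_add_eq_0 add.commute)
  also have "\<dots> \<in> nonunits P"
  proof (intro nonunit_uminus nonunit_sum nonunit_mult_right a)
    fix i assume "i \<in> {..<d}"
    then have "d - i = Suc (d - i - 1)"
      by simp
    moreover have "y * y ^ (d - i - 1) \<in> nonunits P"
      using y nonunit_mem by (intro nonunit_mult_left power_mem) auto
    ultimately show "y ^ (d - i) \<in> nonunits P"
      by (metis power_Suc)
  qed auto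
  finally show False
    using unit by simp
qed

lemma eval_poly2_specialize:
  assumes "z \<in> P" and w: "takes_value j P w s"
  shows "eval_poly2 j z w S - eval_poly j (map_poly (\<lambda>q. poly q s) S) z \<in> nonunits P"
proof (induction S)
  case 0
  show ?case by (simp add: zero_nonunit)
next
  case (pCons q S)
  have "eval_poly j q w - j (poly q s) \<in> nonunits P"
    using takes_value_eval_poly[OF w] by (simp add: takes_value_def)
  moreover have "z * (eval_poly2 j z w S - eval_poly j (map_poly (\<lambda>q. poly q s) S) z) \<in> nonunits P"
    by (intro nonunit_mult_right assms pCons.IH)
  ultimately have "(eval_poly j q w - j (poly q s)) +
      z * (eval_poly2 j z w S - eval_poly j (map_poly (\<lambda>q. poly q s) S) z) \<in> nonunits P"
    by (rule nonunit_add)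
  then show ?case
    by (simp add: eval_poly2_pCons Polynomial.map_poly_pCons algebra_simps)
qed

lemma nonunit_root_imp_nonunit_constant_coeff:
  assumes z: "z \<in> nonunits P" and w: "w \<in> P" and root: "eval_poly2 j z w S = 0"
  shows "eval_poly j (coeff S 0) w \<in> nonunits P"
proof (cases S rule: pCons_cases)
  case (pCons q R)
  have eval_mem: "eval_poly j p w \<in> P" for p
    by (induction p) (auto intro: zero_mem add_mem mult_mem const_mem w)
  have "eval_poly2 j z w R \<in> P"
    by (induction R) (auto simp: eval_poly2_pCons
        intro: zero_mem add_mem mult_mem eval_mem nonunit_mem z)
  then have "- (z * eval_poly2 j z w R) \<in> nonunits P"
    by (intro nonunit_uminus nonunit_mult_left z)
  moreover have "eval_poly j q w = - (z * eval_poly2 j z w R)"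
    using root by (simp add: pCons eval_poly2_pCons eq_neg_iff_add_eq_0)
  ultimately show ?thesis
    by (simp add: pCons)
qed

lemma relation_coeff_vanishes_at_0:
  assumes w: "w \<in> nonunits P" and I: "finite I" "l \<in> I"
    and unit: "u l \<in> P" "u l \<notin> nonunits P" and nonunits: "\<And>i. i \<in> I - {l} \<Longrightarrow> u i \<in> nonunits P"
    and relation: "(\<Sum>i\<in>I. eval_poly j (q i) w * u i) = 0"
  shows "poly (q l) 0 = 0"
proof -
  have coeff_value: "takes_value j P (eval_poly j (q i) w) (poly (q i) 0)" for i
    using w by (intro takes_value_eval_poly) (simp add: takes_value_0_iff)
  have "eval_poly j (q l) w * u l + (\<Sum>i\<in>I - {l}. eval_poly j (q i) w * u i) = 0"
    using relation I by (simp add: sum.remove[of I l])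
  then have "eval_poly j (q l) w * u l = - (\<Sum>i\<in>I - {l}. eval_poly j (q i) w * u i)"
    by (simp add: eq_neg_iff_add_eq_0)
  also have "\<dots> \<in> nonunits P"
    by (intro nonunit_uminus nonunit_sum nonunit_mult_right takes_value_mem[OF coeff_value] nonunits)
  finally have "eval_poly j (q l) w \<in> nonunits P"
    using nonunit_multD[OF takes_value_mem[OF coeff_value] unit(1)] unit(2) by blast
  then show ?thesis
    using takes_value_nonunit_iff[OF coeff_value] by simp
qed

end

lemma (in field_hom) places_with_distinct_values:
  assumes L: "is_subfield L" and S: "S \<subseteq> places hom L"
    and ex_place: "\<And>s. s \<in> B \<Longrightarrow> \<exists>P\<in>S. takes_value hom P z s"
  obtains P where "inj_on P B" "P ` B \<subseteq> S"
proof -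
  have "\<forall>s\<in>B. \<exists>P. P \<in> S \<and> takes_value hom P z s"
    using ex_place by blast
  from bchoice[OF this] obtain P where P: "\<forall>s\<in>B. P s \<in> S \<and> takes_value hom (P s) z s"
    by blast
  have "inj_on P B"
  proof (rule inj_onI)
    fix s s' assume s: "s \<in> B" "s' \<in> B" "P s = P s'"
    have "P s \<in> places hom L" "takes_value hom (P s) z s" "takes_value hom (P s) z s'"
      using bspec[OF P s(1)] bspec[OF P s(2)] s(3) S by auto
    then show "s = s'"
      by (intro place.takes_value_unique[OF place.intro[OF field_hom_axioms place_axioms.intro[OF L]]])
  qed
  moreover have "P ` B \<subseteq> S"
    using P by blast
  ultimately show ?thesis
    by (rule that)
qed

lemma place_eval_poly_unit:
  fixes j :: "'k::alg_closed_field \<Rightarrow> 'f::field"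
  assumes "place j L P" and z: "z \<in> P" "\<And>s. \<not> takes_value j P z s" and "p \<noteq> 0"
  shows "eval_poly j p z \<in> P - nonunits P"
proof -
  interpret place j L P by fact
  interpret eval: comm_ring_hom "\<lambda>p. eval_poly j p z"
    by (rule comm_ring_hom_eval_poly)
  show ?thesis
    using \<open>p \<noteq> 0\<close>
  proof (induction p rule: alg_closed_poly_induct)
    case (const b)
    then show ?case
      by (simp add: const_mem)
  next
    case (linear_factor a q)
    have "eval_poly j ([:- a, 1:] * q) z = (z - j a) * eval_poly j q z"
      unfolding eval.hom_mult by (simp add: hom_uminus)
    moreover have "z - j a \<in> P"
      by (intro diff_mem z const_mem)
    moreover have "z - j a \<notin> nonunits P"
      using z by (simp add: takes_value_def)
    ultimately show ?case
      using linear_factor.IH \<open>q \<noteq> 0\<close> nonunit_multD[of "z - j a" "eval_poly j q z"] mult_mem by auto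
  qed
qed

lemma (in field_hom) relation_with_constant_term:
  assumes "z \<noteq> 0" "S \<noteq> 0" "eval_poly2 hom z w S = 0"
  obtains R where "coeff R 0 \<noteq> 0" "eval_poly2 hom z w R = 0"
  using assms(2,3)
proof (induction S arbitrary: thesis)
  case (pCons q S)
  show ?case
  proof (cases "q = 0")
    case True
    then have "S \<noteq> 0" "eval_poly2 hom z w S = 0"
      using pCons.prems assms(1) by (auto simp: eval_poly2_pCons)
    then show ?thesis
      using pCons.IH pCons.prems(1) by blast
  next
    case False
    then show ?thesis
      using pCons.prems(1)[of "pCons q S"] pCons.prems(3) by simp
  qed
qed simp

section \<open>Function fields in one variable\<close>

locale function_field_in_one_variable = alg_closed_embedding j
  for j :: "'k::alg_closed_field \<Rightarrow> 'f::field" +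
  fixes L t n
  assumes subfield_L: "is_subfield L" and range_L: "range j \<subseteq> L"
    and t: "t \<in> L" "t \<notin> range j" and degree: "has_degree n (adjoin j t) L"
begin

lemma placeI: "P \<in> places j L \<Longrightarrow> place j L P"
  by (intro place.intro place_axioms.intro field_hom_axioms subfield_L)

lemma const_in_L: "j s \<in> L"
  using range_L by auto

lemma relation_over_generator:
  assumes w: "adjoin j w = adjoin j t" and z: "z \<in> L"
  obtains S where "map_poly (\<lambda>q. poly q 0) S \<noteq> 0" "eval_poly2 j z w S = 0"
proof -
  have "w \<notin> range j"
    by (rule transcendental_if_adjoin_eq[OF w t(2)])
  moreover have "\<forall>i\<le>n. z ^ i \<in> L"
    using subfield_power[OF subfield_L z] by blast
  ultimately show ?thesis
    using has_degree_imp_algebraic[of w n L z] degree w that by metis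
qed

lemma generator_takes_value:
  assumes P: "P \<in> places j L" and tP: "t \<in> P"
  shows "\<exists>s. takes_value j P t s"
proof (rule ccontr)
  interpret place j L P by (rule placeI[OF P])
  assume no_value: "\<nexists>s. takes_value j P t s"
  have unit: "eval_poly j p t \<in> P - nonunits P" if "p \<noteq> 0" for p
    by (rule place_eval_poly_unit[OF placeI[OF P] tP]) (use no_value that in auto)
  have "z \<in> P" if z: "z \<in> L" for z
  proof -
    obtain S where "map_poly (\<lambda>q. poly q 0) S \<noteq> 0" and root: "eval_poly2 j z t S = 0"
      using relation_over_generator[OF refl z] by blast
    then have "S \<noteq> 0"
      by auto
    show ?thesis
    proof (rule integral_mem[OF z])
      show "eval_poly j (coeff S i) t \<in> P" for i
        using unit[of "coeff S i"] zero_mem by (cases "coeff S i = 0") auto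
      show "eval_poly j (lead_coeff S) t \<notin> nonunits P"
        using unit[of "lead_coeff S"] \<open>S \<noteq> 0\<close> by simp
      show "(\<Sum>i\<le>degree S. eval_poly j (coeff S i) t * z ^ i) = 0"
        using root by (simp add: eval_poly2_eq_sum[OF order.refl])
    qed
  qed
  then show False
    using P unfolding places_def by blast
qed

lemma uniformizing_generator:
  assumes P: "P \<in> places j L"
  obtains w where "w \<in> nonunits P" "adjoin j w = adjoin j t"
proof (cases "t \<in> P")
  case True
  then obtain s where "t - j s \<in> nonunits P"
    using generator_takes_value[OF P] by (auto simp: takes_value_def)
  then show ?thesis
    using that adjoin_diff_const by blast
next
  case False
  then have "inverse t \<in> nonunits P"
    using place.inverse_nonunit[OF placeI[OF P]] t(1) by blast
  then show ?thesis
    using that adjoin_inverse by blast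
qed

lemma takes_value_if_mem:
  assumes P: "P \<in> places j L" and z: "z \<in> P"
  shows "\<exists>s. takes_value j P z s"
proof (rule ccontr)
  interpret place j L P by (rule placeI[OF P])
  assume no_value: "\<nexists>s. takes_value j P z s"
  obtain w where w: "w \<in> nonunits P" "adjoin j w = adjoin j t"
    by (rule uniformizing_generator[OF P])
  obtain S where S: "map_poly (\<lambda>q. poly q 0) S \<noteq> 0" "eval_poly2 j z w S = 0"
    by (rule relation_over_generator[OF w(2) mem_field[OF z]])
  have "takes_value j P w 0"
    using w(1) by (simp add: takes_value_0_iff)
  from nonunit_uminus[OF eval_poly2_specialize[OF z this, of S]]
  have "eval_poly j (map_poly (\<lambda>q. poly q 0) S) z \<in> nonunits P"
    by (simp add: S(2))
  moreover have "eval_poly j (map_poly (\<lambda>q. poly q 0) S) z \<in> P - nonunits P"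
    by (rule place_eval_poly_unit[OF placeI[OF P] z _ S(1)]) (use no_value in auto)
  ultimately show False
    by simp
qed

lemma inverse_diff_const_regular:
  assumes P: "P \<in> places j L" and z: "z \<in> L" and s: "\<not> takes_value j P z s"
  shows "inverse (z - j s) \<in> P" "inverse (z - j s) \<in> nonunits P \<longleftrightarrow> z \<notin> P"
proof -
  interpret place j L P by (rule placeI[OF P])
  have "inverse (z - j s) \<in> P \<and> (inverse (z - j s) \<in> nonunits P \<longleftrightarrow> z \<notin> P)"
  proof (cases "z \<in> P")
    case True
    then obtain r where r: "takes_value j P z r"
      using takes_value_if_mem[OF P] by blast
    then have "r \<noteq> s"
      using s by auto
    then have v: "takes_value j P (inverse (z - j s)) (inverse (r - s))"
      by (intro takes_value_inverse takes_value_diff r takes_value_const) auto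
    then show ?thesis
      using takes_value_mem[OF v] takes_value_nonunit_iff[OF v] True \<open>r \<noteq> s\<close> by simp
  next
    case False
    then have "z - j s \<notin> P"
      using add_mem[of "z - j s" "j s"] const_mem by auto
    then have "inverse (z - j s) \<in> nonunits P"
      by (intro inverse_nonunit subfield_diff[OF subfield_L] z const_in_L)
    then show ?thesis
      using False nonunit_mem by blast
  qed
  then show "inverse (z - j s) \<in> P" "inverse (z - j s) \<in> nonunits P \<longleftrightarrow> z \<notin> P"
    by auto
qed

lemma regular_moebius:
  assumes Z: "finite Z" "Z \<subseteq> places j L" and z: "z \<in> L"
  obtains s where "z \<noteq> j s" "\<And>P. P \<in> Z \<Longrightarrow> inverse (z - j s) \<in> P"
    "\<And>P. P \<in> Z \<Longrightarrow> inverse (z - j s) \<in> nonunits P \<longleftrightarrow> z \<notin> P"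
proof -
  define B where "B = (\<Union>P\<in>Z. {s. takes_value j P z s}) \<union> {s. z = j s}"
  have "finite {s. takes_value j P z s}" if "P \<in> Z" for P
  proof (rule finite_subset)
    show "{s. takes_value j P z s} \<subseteq> {THE s. takes_value j P z s}"
      using place.takes_value_unique[OF placeI, of P] that Z(2) by (auto intro!: the_equality[symmetric])
  qed simp
  moreover have "finite {s. z = j s}"
  proof (rule finite_subset)
    show "{s. z = j s} \<subseteq> {THE s. z = j s}"
      by auto
  qed simp
  ultimately have "finite B"
    unfolding B_def using Z(1) by blast
  then obtain s where "s \<notin> B"
    using ex_new_if_finite[OF infinite_UNIV_alg_closed_field] by blast
  then have "z \<noteq> j s" "\<And>P. P \<in> Z \<Longrightarrow> \<not> takes_value j P z s"
    by (auto simp: B_def)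
  then show ?thesis
    using that inverse_diff_const_regular[OF _ z] Z(2) by (meson subsetD)
qed

lemma places_incomparable:
  assumes P: "P \<in> places j L" and Q: "Q \<in> places j L" and "P \<subseteq> Q"
  shows "P = Q"
proof -
  interpret P: place j L P by (rule placeI[OF P])
  interpret Q: place j L Q by (rule placeI[OF Q])
  have "z \<in> P" if "z \<in> Q" for z
  proof -
    obtain s where s: "z - j s \<in> nonunits Q"
      using takes_value_if_mem[OF Q \<open>z \<in> Q\<close>] by (auto simp: takes_value_def)
    have "z - j s \<in> P"
    proof (rule ccontr)
      assume "z - j s \<notin> P"
      then have "z - j s \<noteq> 0" "inverse (z - j s) \<in> P"
        using P.zero_mem P.mem_or_inverse_mem[OF Q.mem_field[OF Q.nonunit_mem[OF s]]] by metis+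
      then show False
        using s \<open>P \<subseteq> Q\<close> unfolding nonunits_def by blast
    qed
    then show ?thesis
      using P.add_mem[OF _ P.const_mem[of s]] by fastforce
  qed
  then show ?thesis
    using \<open>P \<subseteq> Q\<close> by blast
qed

lemma function_separating_two_places:
  assumes Z: "finite Z" "Z \<subseteq> places j L" and "P \<in> Z" "Q \<in> Z" "P \<noteq> Q"
  shows "\<exists>e\<in>L. (\<forall>R\<in>Z. e \<in> R) \<and> e \<notin> nonunits P \<and> e \<in> nonunits Q"
proof -
  have "\<not> P \<subseteq> Q"
    using places_incomparable[of P Q] assms by blast
  then obtain z where z: "z \<in> P" "z \<notin> Q"
    by blast
  have "z \<in> L"
    using place.mem_field[OF placeI, of P z] assms z by blast
  obtain s where s: "\<And>R. R \<in> Z \<Longrightarrow> inverse (z - j s) \<in> R"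
      "\<And>R. R \<in> Z \<Longrightarrow> inverse (z - j s) \<in> nonunits R \<longleftrightarrow> z \<notin> R"
    using regular_moebius[OF Z \<open>z \<in> L\<close>] by metis
  have "inverse (z - j s) \<in> L"
    by (intro subfield_inverse subfield_diff subfield_L \<open>z \<in> L\<close> const_in_L)
  then show ?thesis
    using s z assms by blast
qed

lemma function_separating_places:
  assumes Z: "finite Z" "Z \<subseteq> places j L" and P: "P \<in> Z"
  shows "\<exists>e\<in>L. \<forall>Q\<in>Z. e \<in> Q \<and> (e \<in> nonunits Q \<longleftrightarrow> Q \<noteq> P)"
proof -
  have "\<forall>Q\<in>Z - {P}. \<exists>e. (\<forall>R\<in>Z. e \<in> R) \<and> e \<notin> nonunits P \<and> e \<in> nonunits Q"
    using function_separating_two_places[OF Z P] by blast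
  from bchoice[OF this] obtain e where e: "\<And>Q R. Q \<in> Z - {P} \<Longrightarrow> R \<in> Z \<Longrightarrow> e Q \<in> R"
      "\<And>Q. Q \<in> Z - {P} \<Longrightarrow> e Q \<notin> nonunits P" "\<And>Q. Q \<in> Z - {P} \<Longrightarrow> e Q \<in> nonunits Q"
    by blast
  define f where "f = (\<Prod>Q\<in>Z - {P}. e Q)"
  have f: "f \<in> R \<and> (f \<in> nonunits R \<longleftrightarrow> R \<noteq> P)" if R: "R \<in> Z" for R
  proof -
    interpret R: place j L R
      using placeI Z R by blast
    have "f \<in> R"
      unfolding f_def by (intro R.prod_mem e(1) R)
    moreover have "f \<in> nonunits R \<longleftrightarrow> (\<exists>Q\<in>Z - {P}. e Q \<in> nonunits R)"
      unfolding f_def using Z(1) e(1) R by (intro R.prod_nonunit_iff) auto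
    ultimately show ?thesis
      using e(2,3) R by blast
  qed
  moreover have "f \<in> L"
    using f[OF P] place.mem_field[OF placeI] Z P by blast
  ultimately show ?thesis
    by blast
qed

text \<open>A relation between separating functions with coefficients in \<open>K[w]\<close>, not all vanishing at
  \<open>w = 0\<close>, fails at one of the zeros of \<open>w\<close>.\<close>

lemma card_zeros_le_degree:
  assumes w: "w \<notin> range j" and degree: "has_degree m (adjoin j w) L"
    and Z: "finite Z" "Z \<subseteq> places j L" and zeros: "\<And>P. P \<in> Z \<Longrightarrow> w \<in> nonunits P"
  shows "card Z \<le> m"
proof (rule ccontr)
  assume "\<not> card Z \<le> m"
  then obtain P where inj: "inj_on P {..m}" and "P ` {..m} \<subseteq> Z"
    using card_le_inj[of "{..m}" Z] Z(1) by auto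
  then have places: "finite (P ` {..m})" "P ` {..m} \<subseteq> places j L"
    using Z by auto
  have "\<forall>i\<in>{..m}. \<exists>e\<in>L. \<forall>Q\<in>P ` {..m}. e \<in> Q \<and> (e \<in> nonunits Q \<longleftrightarrow> Q \<noteq> P i)"
    using function_separating_places[OF places] by blast
  then obtain e where e_L: "\<forall>i\<le>m. e i \<in> L"
    and e: "\<And>i l. i \<le> m \<Longrightarrow> l \<le> m \<Longrightarrow> e i \<in> P l \<and> (e i \<in> nonunits (P l) \<longleftrightarrow> P l \<noteq> P i)"
    by (metis atMost_iff imageI)
  obtain q where "\<exists>i\<le>m. poly (q i) 0 \<noteq> 0" and relation: "(\<Sum>i\<le>m. eval_poly j (q i) w * e i) = 0"
    by (rule has_degree_imp_polynomial_relation[OF w degree e_L])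
  then obtain l where l: "l \<le> m" "poly (q l) 0 \<noteq> 0"
    by blast
  have Pl: "P l \<in> places j L" "w \<in> nonunits (P l)"
    using places(2) \<open>P ` {..m} \<subseteq> Z\<close> l(1) zeros by auto
  have "poly (q l) 0 = 0"
  proof (rule place.relation_coeff_vanishes_at_0[OF placeI[OF Pl(1)] Pl(2) _ _ _ _ _ relation])
    show "e l \<in> P l" "e l \<notin> nonunits (P l)"
      using e[OF l(1) l(1)] by auto
    show "e i \<in> nonunits (P l)" if "i \<in> {..m} - {l}" for i
      using e[of i l] inj_on_eq_iff[OF inj, of l i] l(1) that by auto
  qed (use l(1) in simp_all)
  then show False
    using l(2) by simp
qed

lemma finite_zeros_of_generator:
  assumes "adjoin j w = adjoin j t"
  shows "finite {P \<in> places j L. w \<in> nonunits P}"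
proof (rule finite_if_finite_subsets_card_bdd[of _ n, THEN conjunct1])
  fix Z assume Z: "Z \<subseteq> {P \<in> places j L. w \<in> nonunits P}" "finite Z"
  have "w \<notin> range j"
    by (rule transcendental_if_adjoin_eq[OF assms t(2)])
  then show "card Z \<le> n"
    by (rule card_zeros_le_degree) (use assms degree Z in auto)
qed

text \<open>A zero of \<open>z\<close> is a zero of the constant coefficient of a relation for \<open>z\<close> over \<open>K[t]\<close>.\<close>

lemma finite_zeros:
  assumes z: "z \<in> L" "z \<noteq> 0"
  shows "finite {P \<in> places j L. z \<in> nonunits P}"
proof -
  obtain S where "map_poly (\<lambda>q. poly q 0) S \<noteq> 0" "eval_poly2 j z t S = 0"
    by (rule relation_over_generator[OF refl z(1)])
  moreover from this have "S \<noteq> 0"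
    by auto
  ultimately obtain R where R: "coeff R 0 \<noteq> 0" "eval_poly2 j z t R = 0"
    using relation_with_constant_term[OF z(2)] by blast
  let ?B = "{s. poly (coeff R 0) s = 0}"
  let ?zeros = "\<lambda>w. {P \<in> places j L. w \<in> nonunits P}"
  have "?zeros z \<subseteq> ?zeros (inverse t) \<union> (\<Union>s\<in>?B. ?zeros (t - j s))"
  proof
    fix P assume "P \<in> ?zeros z"
    then have P: "P \<in> places j L" and zP: "z \<in> nonunits P"
      by auto
    interpret place j L P by (rule placeI[OF P])
    show "P \<in> ?zeros (inverse t) \<union> (\<Union>s\<in>?B. ?zeros (t - j s))"
    proof (cases "t \<in> P")
      case False
      then show ?thesis
        using P inverse_nonunit t(1) by blast
    next
      case True
      then obtain s where s: "takes_value j P t s"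
        using takes_value_if_mem[OF P] by blast
      have "eval_poly j (coeff R 0) t \<in> nonunits P"
        by (rule nonunit_root_imp_nonunit_constant_coeff[OF zP True R(2)])
      then have "poly (coeff R 0) s = 0"
        using takes_value_nonunit_iff[OF takes_value_eval_poly[OF s]] by blast
      then show ?thesis
        using P s by (auto simp: takes_value_def)
    qed
  qed
  moreover have "finite (?zeros (t - j s))" for s
    by (rule finite_zeros_of_generator[OF adjoin_diff_const])
  ultimately show ?thesis
    using finite_zeros_of_generator[OF adjoin_inverse] poly_roots_finite[OF R(1)]
    by (meson finite_UN_I finite_UnI finite_subset)
qed

end

section \<open>The degree of a difference of conjugate functions\<close>

lemma comm_ring_hom_const_poly2: "comm_ring_hom (\<lambda>a. [:[:a:]:])"
  by (rule comm_ring_hom_compose[OF comm_ring_hom_const_poly comm_ring_hom_const_poly])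

lemma eval_poly_const_poly2:
  fixes q :: "'k::comm_ring_1 poly"
  shows "eval_poly (\<lambda>a. [:[:a:]:]) q [:0, 1:] = map_poly (\<lambda>a. [:a:]) q"
proof -
  interpret const: comm_ring_hom "\<lambda>a :: 'k. [:[:a:]:]"
    by (rule comm_ring_hom_const_poly2)
  show ?thesis
    by (induction q) (auto simp: Polynomial.map_poly_pCons)
qed

definition swap_vars :: "'k::comm_ring_1 poly poly \<Rightarrow> 'k poly poly" where
  "swap_vars = eval_poly2 (\<lambda>a. [:[:a:]:]) [:[:0, 1:]:] [:0, 1:]"

lemma coeff_swap_vars: "coeff (coeff (swap_vars p) m) i = coeff (coeff p i) m"
proof (induction p arbitrary: i)
  case 0
  show ?case by (simp add: swap_vars_def)
next
  case (pCons q p)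
  interpret const: comm_ring_hom "\<lambda>a :: 'a. [:[:a:]:]"
    by (rule comm_ring_hom_const_poly2)
  have "swap_vars (pCons q p) = map_poly (\<lambda>a. [:a:]) q + [:[:0, 1:]:] * swap_vars p"
    unfolding swap_vars_def const.eval_poly2_pCons eval_poly_const_poly2 ..
  then have "coeff (swap_vars (pCons q p)) m = pCons (coeff q m) (coeff (swap_vars p) m)"
    by (simp add: coeff_map_poly)
  then show ?case
    using pCons.IH by (simp add: coeff_pCons split: nat.split)
qed

lemma swap_vars_swap_vars [simp]: "swap_vars (swap_vars p) = p"
  by (intro poly_eqI) (simp add: coeff_swap_vars)

lemma degree_coeff_le_degree_swap_vars: "degree (coeff p i) \<le> degree (swap_vars p)"
proof (rule degree_le, intro allI impI)
  fix m assume "degree (swap_vars p) < m"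
  then have "coeff (coeff (swap_vars p) m) i = 0"
    by (simp add: coeff_eq_0)
  then show "coeff (coeff p i) m = 0"
    by (simp add: coeff_swap_vars)
qed

lemma swap_vars_dvd:
  assumes "p dvd q"
  shows "swap_vars p dvd swap_vars q"
proof -
  interpret swap: comm_ring_hom swap_vars
    unfolding swap_vars_def by (rule comm_ring_hom.comm_ring_hom_eval_poly2[OF comm_ring_hom_const_poly2])
  show ?thesis
    by (rule swap.hom_dvd[OF assms])
qed

lemma (in comm_ring_hom) eval_poly2_swap_vars: "eval_poly2 hom x c (swap_vars p) = eval_poly2 hom c x p"
  unfolding swap_vars_def
  by (subst comm_ring_hom.hom_eval_poly2[OF comm_ring_hom_const_poly2 comm_ring_hom_eval_poly2]) simp

text \<open>The substitution taking a relation \<open>R(g, h)\<close> to the relation \<open>R(h - w, h)\<close> between \<open>h\<close> and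
  \<open>w = h - g\<close>.\<close>

definition diff_subst :: "'k::comm_ring_1 poly poly \<Rightarrow> 'k poly poly" where
  "diff_subst = eval_poly2 (\<lambda>a. [:[:a:]:]) [:[:0, - 1:], 1:] [:0, 1:]"

lemma (in comm_ring_hom) eval_poly2_diff_subst:
  "eval_poly2 hom h w (diff_subst R) = eval_poly2 hom (h - w) h R"
  unfolding diff_subst_def
  by (subst comm_ring_hom.hom_eval_poly2[OF comm_ring_hom_const_poly2 comm_ring_hom_eval_poly2])
     (simp add: eval_poly2_pCons hom_uminus)

lemma diff_subst_nonzero:
  fixes R :: "'k::comm_ring_1 poly poly"
  assumes "R \<noteq> 0"
  shows "diff_subst R \<noteq> 0"
proof
  assume "diff_subst R = 0"
  then have "eval_poly2 (\<lambda>a. [:[:a:]:]) [:[:0, 1:]:] [:[:0, 1:], - 1:] (diff_subst R) = 0"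
    by simp
  then have "eval_poly2 (\<lambda>a. [:[:a:]:]) [:0, 1:] [:[:0, 1:]:] R = 0"
    by (simp add: comm_ring_hom.eval_poly2_diff_subst[OF comm_ring_hom_const_poly2])
  moreover have "comm_ring_hom (\<lambda>p :: 'k poly poly. p)"
    by unfold_locales auto
  ultimately show False
    using comm_ring_hom_eq_eval_poly2[of "\<lambda>p. p" R] assms by simp
qed

lemma degree_diff_subst_le:
  fixes R :: "'k::idom poly poly"
  shows "degree (diff_subst R) \<le> degree R + degree (swap_vars R)"
proof -
  interpret const: comm_ring_hom "\<lambda>a :: 'k. [:[:a:]:]"
    by (rule comm_ring_hom_const_poly2)
  have "diff_subst R = (\<Sum>i\<le>degree R. map_poly (\<lambda>a. [:a:]) (coeff R i) * [:[:0, - 1:], 1:] ^ i)"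
    unfolding diff_subst_def const.eval_poly2_eq_sum[OF order.refl] eval_poly_const_poly2 ..
  also have "degree \<dots> \<le> degree R + degree (swap_vars R)"
  proof (rule degree_sum_le)
    fix i assume i: "i \<in> {..degree R}"
    have "degree (map_poly (\<lambda>a. [:a:]) (coeff R i) * [:[:0, - 1:], 1:] ^ i) \<le>
        degree (map_poly (\<lambda>a. [:a:]) (coeff R i)) + degree ([:[:0, - 1:], 1:] ^ i :: 'k poly poly)"
      by (rule degree_mult_le)
    also have "\<dots> \<le> degree (swap_vars R) + i"
      using degree_map_poly_le[of "\<lambda>a. [:a:]" "coeff R i"] degree_coeff_le_degree_swap_vars[of R i]
      by (simp add: degree_power_eq)
    finally show "degree (map_poly (\<lambda>a. [:a:]) (coeff R i) * [:[:0, - 1:], 1:] ^ i) \<le>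
        degree R + degree (swap_vars R)"
      using i by simp
  qed simp
  finally show ?thesis .
qed

context alg_closed_embedding
begin

text \<open>
  The generator \<open>R\<close> of the ideal of relations between \<open>g\<close> and \<open>h\<close> divides both a relation of degree
  at most \<open>e\<close> in \<open>g\<close> and, when the relations are symmetric, its mirror image.
\<close>

lemma symmetric_relation:
  assumes h: "h \<notin> range j" and degree: "has_degree e (adjoin j h) E" and g: "\<forall>i\<le>e. g ^ i \<in> E"
    and sym: "\<And>p. eval_poly2 j g h p = 0 \<Longrightarrow> eval_poly2 j h g p = 0"
  obtains R where "R \<noteq> 0" "eval_poly2 j g h R = 0" "degree R \<le> e" "degree (swap_vars R) \<le> e"
proof -
  obtain S where "map_poly (\<lambda>q. poly q 0) S \<noteq> 0" and S: "degree S \<le> e" "eval_poly2 j g h S = 0"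
    by (rule has_degree_imp_algebraic[OF h degree g])
  then have "S \<noteq> 0"
    by auto
  have inj: "r = 0" if "eval_poly2 j g h [:r:] = 0" for r
    using that eval_poly_eq_0_iff[OF h] by simp
  obtain R where R: "\<And>p. eval_poly2 j g h p = 0 \<longleftrightarrow> R dvd p"
    using kernel_principal[OF comm_ring_hom_eval_poly2 inj \<open>S \<noteq> 0\<close> S(2)] by metis
  have dvd: "R dvd S"
    using R S(2) by simp
  have "R dvd swap_vars S"
    using sym[OF S(2)] by (simp add: eval_poly2_swap_vars flip: R)
  then have swap_dvd: "swap_vars R dvd S"
    using swap_vars_dvd by fastforce
  have "R \<noteq> 0"
    using dvd \<open>S \<noteq> 0\<close> by auto
  moreover have "degree R \<le> e" "degree (swap_vars R) \<le> e"
    using dvd_imp_degree_le[OF dvd \<open>S \<noteq> 0\<close>] dvd_imp_degree_le[OF swap_dvd \<open>S \<noteq> 0\<close>] S(1) by simp_all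
  moreover have "eval_poly2 j g h R = 0"
    by (simp add: R)
  ultimately show ?thesis
    by (intro that[of R])
qed

lemma has_degree_difference:
  assumes h: "h \<notin> range j" and w: "w \<notin> range j" and degree: "has_degree e (adjoin j h) (adjoin2 j h w)"
    and sym: "\<And>p. eval_poly2 j (h - w) h p = 0 \<Longrightarrow> eval_poly2 j h (h - w) p = 0"
  obtains m where "m \<le> 2 * e" "has_degree m (adjoin j w) (adjoin2 j h w)"
proof -
  have "\<forall>i\<le>e. (h - w) ^ i \<in> adjoin2 j h w"
    by (intro allI impI subfield_power subfield_diff is_subfield_adjoin2 generators_in_adjoin2)
  then obtain R where R: "R \<noteq> 0" "eval_poly2 j (h - w) h R = 0"
      "degree R \<le> e" "degree (swap_vars R) \<le> e"
    by (rule symmetric_relation[OF h degree _ sym])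
  define T where "T = diff_subst R"
  have "T \<noteq> 0"
    unfolding T_def by (rule diff_subst_nonzero[OF R(1)])
  have "eval_poly2 j h w T = 0"
    unfolding T_def eval_poly2_diff_subst by (rule R(2))
  then have root: "(\<Sum>i\<le>degree T. eval_poly j (coeff T i) w * h ^ i) = 0"
    unfolding eval_poly2_eq_sum[OF order.refl] .
  have lead: "eval_poly j (lead_coeff T) w \<noteq> 0"
    using eval_poly_eq_0_iff[OF w] \<open>T \<noteq> 0\<close> by simp
  obtain m where m: "m \<le> degree T" "has_degree m (adjoin j w) (adjoin2 j h w)"
  proof (rule has_degree_simple_le[where y = h,
        OF is_subfield_adjoin is_subfield_adjoin2 _ _ _ _ lead root])
    show "adjoin j w \<subseteq> adjoin2 j h w"
      by (intro adjoin_subset is_subfield_adjoin2 range_subset_adjoin2 generators_in_adjoin2)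
    show "h \<in> adjoin2 j h w"
      by (rule generators_in_adjoin2)
    show "adjoin2 j h w \<subseteq> T" if "is_subfield T" "adjoin j w \<subseteq> T" "h \<in> T" for T
      using that generator_in_adjoin[of w] range_subset_adjoin[of w] by (intro adjoin2_subset) auto
    show "\<forall>i\<le>degree T. eval_poly j (coeff T i) w \<in> adjoin j w"
      by (simp add: eval_poly_in_adjoin)
  qed
  have "m \<le> 2 * e"
    using m(1) degree_diff_subst_le[of R] R(3,4) unfolding T_def by linarith
  then show ?thesis
    using m(2) by (rule that)
qed

end

section \<open>Homomorphisms between fields of fractions\<close>

definition frac_map :: "('r \<Rightarrow> 'f::field) \<Rightarrow> ('r \<Rightarrow> 'g::field) \<Rightarrow> 'f \<Rightarrow> 'g" where
  "frac_map e e' z = (THE w. \<exists>p q. e q \<noteq> 0 \<and> z = e p / e q \<and> w = e' p / e' q)"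

locale same_kernel = e: comm_ring_hom e + e': comm_ring_hom e'
  for e :: "'r::comm_ring_1 \<Rightarrow> 'f::field" and e' :: "'r \<Rightarrow> 'g::field" +
  assumes kernel: "e p = 0 \<longleftrightarrow> e' p = 0"
begin

lemma frac_map_fraction:
  assumes q: "e q \<noteq> 0"
  shows "frac_map e e' (e p / e q) = e' p / e' q"
  unfolding frac_map_def
proof (rule the_equality)
  fix w assume "\<exists>r s. e s \<noteq> 0 \<and> e p / e q = e r / e s \<and> w = e' r / e' s"
  then obtain r s where s: "e s \<noteq> 0" and same: "e p / e q = e r / e s" and w: "w = e' r / e' s"
    by blast
  have "e (p * s - r * q) = 0"
    using same q s by (simp add: e.hom_minus e.hom_mult field_simps)
  then have "e' p * e' s = e' r * e' q"
    unfolding kernel by (simp add: e'.hom_minus e'.hom_mult)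
  moreover have "e' s \<noteq> 0" "e' q \<noteq> 0"
    using s q kernel by auto
  ultimately show "w = e' p / e' q"
    unfolding w by (simp add: field_simps)
qed (use q in blast)

lemma frac_map_image: "frac_map e e' (e p) = e' p"
  using frac_map_fraction[of 1 p] by simp

lemma frac_map_mult:
  assumes "z \<in> fractions e" "z' \<in> fractions e"
  shows "frac_map e e' (z * z') = frac_map e e' z * frac_map e e' z'"
proof -
  obtain p q p' q' where z: "z = e p / e q" "e q \<noteq> 0" and z': "z' = e p' / e q'" "e q' \<noteq> 0"
    using assms by (auto elim!: fractionsE)
  have "z * z' = e (p * p') / e (q * q')" "e (q * q') \<noteq> 0"
    using z z' by (simp_all add: e.hom_mult)
  then show ?thesis
    using z z' by (simp add: frac_map_fraction e'.hom_mult)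
qed

lemma frac_map_add:
  assumes "z \<in> fractions e" "z' \<in> fractions e"
  shows "frac_map e e' (z + z') = frac_map e e' z + frac_map e e' z'"
proof -
  obtain p q p' q' where z: "z = e p / e q" "e q \<noteq> 0" and z': "z' = e p' / e q'" "e q' \<noteq> 0"
    using assms by (auto elim!: fractionsE)
  have sum: "z + z' = e (p * q' + p' * q) / e (q * q')"
    using z z' by (simp add: e.hom_add e.hom_mult add_frac_eq)
  have "frac_map e e' (z + z') = e' (p * q' + p' * q) / e' (q * q')"
    unfolding sum by (rule frac_map_fraction) (simp add: z z' e.hom_mult)
  also have "\<dots> = e' p / e' q + e' p' / e' q'"
    using z(2) z'(2) kernel by (simp add: e'.hom_add e'.hom_mult add_frac_eq)
  finally show ?thesis
    by (simp add: z z' frac_map_fraction)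
qed

lemma frac_map_eq_0_iff:
  assumes "z \<in> fractions e"
  shows "frac_map e e' z = 0 \<longleftrightarrow> z = 0"
proof -
  obtain p q where "z = e p / e q" "e q \<noteq> 0"
    using assms by (rule fractionsE)
  then show ?thesis
    using frac_map_fraction[of q p] kernel by auto
qed

lemma frac_map_uminus:
  assumes "z \<in> fractions e"
  shows "frac_map e e' (- z) = - frac_map e e' z"
proof -
  have "frac_map e e' (z + - z) = frac_map e e' z + frac_map e e' (- z)"
    by (intro frac_map_add assms subfield_uminus[OF is_subfield_fractions[OF e.comm_ring_hom_axioms]])
  then show ?thesis
    using frac_map_image[of 0] by (simp add: eq_neg_iff_add_eq_0 add.commute)
qed

lemma frac_map_diff:
  assumes "z \<in> fractions e" "z' \<in> fractions e"
  shows "frac_map e e' (z - z') = frac_map e e' z - frac_map e e' z'"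
  using frac_map_add[of z "- z'"] frac_map_uminus assms
    subfield_uminus[OF is_subfield_fractions[OF e.comm_ring_hom_axioms]] by simp

lemma frac_map_inverse:
  assumes "z \<in> fractions e"
  shows "frac_map e e' (inverse z) = inverse (frac_map e e' z)"
proof (cases "z = 0")
  case True
  then show ?thesis
    using frac_map_image[of 0] by simp
next
  case False
  have "frac_map e e' (z * inverse z) = frac_map e e' z * frac_map e e' (inverse z)"
    by (intro frac_map_mult assms subfield_inverse[OF is_subfield_fractions[OF e.comm_ring_hom_axioms]])
  then have "frac_map e e' z * frac_map e e' (inverse z) = 1"
    using frac_map_image[of 1] False by simp
  then show ?thesis
    by (metis inverse_unique)
qed

end

section \<open>Places given by power series\<close>

lemma comm_ring_hom_fps_to_fls: "comm_ring_hom (fps_to_fls :: 'k::comm_ring_1 fps \<Rightarrow> 'k fls)"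
  by unfold_locales (auto simp: fls_times_fps_to_fls)

lemma fls_in_range_fps_to_fls_cases:
  fixes f :: "'k::field fls"
  assumes "f \<noteq> 0"
  shows "f \<in> range fps_to_fls \<or> inverse f \<in> range fps_to_fls"
proof -
  have integral: "g \<in> range fps_to_fls" if "fls_subdegree g \<ge> 0" for g :: "'k fls"
    using fls_regpart_to_fls_trivial[OF that] by (metis rangeI)
  show ?thesis
    using integral[of f] integral[of "inverse f"] assms by (cases "fls_subdegree f \<ge> 0") auto
qed

text \<open>
  A homomorphism \<open>s\<close> from \<open>R\<close> to \<open>K[[X]]\<close> with the same kernel as \<open>e\<close> embeds the field of fractions
  of \<open>e(R)\<close> into \<open>K((X))\<close>; the functions whose image lies in \<open>K[[X]]\<close> form a place.
\<close>

locale power_series_embedding = field_hom j + e: comm_ring_hom e + s: comm_ring_hom s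
  for j :: "'k::field \<Rightarrow> 'f::field" and e :: "'r::comm_ring_1 \<Rightarrow> 'f" and s :: "'r \<Rightarrow> 'k fps" +
  fixes const :: "'k \<Rightarrow> 'r"
  assumes e_const: "e (const b) = j b" and s_const: "s (const b) = fps_const b"
    and s_eq_0_iff: "s p = 0 \<longleftrightarrow> e p = 0"
    and nonconstant: "\<exists>p. s p \<notin> range fps_const"
begin

definition expansion :: "'f \<Rightarrow> 'k fls" where
  "expansion = frac_map e (\<lambda>p. fps_to_fls (s p))"

sublocale expansion: same_kernel e "\<lambda>p. fps_to_fls (s p)"
  by (intro same_kernel.intro e.comm_ring_hom_axioms same_kernel_axioms.intro
      comm_ring_hom_compose[OF s.comm_ring_hom_axioms comm_ring_hom_fps_to_fls])
     (simp add: s_eq_0_iff)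

lemmas expansion_add = expansion.frac_map_add[folded expansion_def]
  and expansion_mult = expansion.frac_map_mult[folded expansion_def]
  and expansion_uminus = expansion.frac_map_uminus[folded expansion_def]
  and expansion_diff = expansion.frac_map_diff[folded expansion_def]
  and expansion_inverse = expansion.frac_map_inverse[folded expansion_def]
  and expansion_eq_0_iff = expansion.frac_map_eq_0_iff[folded expansion_def]
  and expansion_image = expansion.frac_map_image[folded expansion_def]
  and expansion_fraction = expansion.frac_map_fraction[folded expansion_def]

definition series_place :: "'f set" where
  "series_place = {z \<in> fractions e. expansion z \<in> range fps_to_fls}"

lemma subfield_L: "is_subfield (fractions e)"
  by (rule is_subfield_fractions[OF e.comm_ring_hom_axioms])

lemma const_in_L: "j b \<in> fractions e"
  using image_in_fractions[OF e.comm_ring_hom_axioms, of "const b"] by (simp add: e_const)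

lemma expansion_const: "expansion (j b) = fps_to_fls (fps_const b)"
  using expansion_image[of "const b"] by (simp add: e_const s_const)

lemma nonunit_if_expansion_vanishes:
  assumes z: "z \<in> fractions e" "expansion z = fps_to_fls f" "fps_nth f 0 = 0"
  shows "z \<in> nonunits series_place"
proof -
  have "inverse z \<notin> series_place" if "z \<noteq> 0"
  proof
    assume "inverse z \<in> series_place"
    then obtain g where "expansion (inverse z) = fps_to_fls g"
      by (auto simp: series_place_def)
    then have "fps_to_fls g = inverse (fps_to_fls f)"
      using z(2) expansion_inverse[OF z(1)] by simp
    moreover have "fps_to_fls f \<noteq> 0"
      using expansion_eq_0_iff[OF z(1)] z(2) that by metis
    ultimately have "fps_to_fls f * fps_to_fls g = 1"
      by simp
    then have "f * g = 1"
      by (simp flip: fls_times_fps_to_fls)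
    then have "fps_nth f 0 * fps_nth g 0 = 1"
      by (metis fps_mult_nth_0 fps_one_nth)
    then show False
      using z(3) by simp
  qed
  then show ?thesis
    using z by (auto simp: nonunits_def series_place_def)
qed

lemma takes_value_series_place:
  assumes z: "z \<in> fractions e" "expansion z = fps_to_fls f"
  shows "takes_value j series_place z (fps_nth f 0)"
proof -
  have "expansion (z - j (fps_nth f 0)) = fps_to_fls (f - fps_const (fps_nth f 0))"
    using expansion_diff[OF z(1) const_in_L] z(2) by (simp add: expansion_const)
  then have "z - j (fps_nth f 0) \<in> nonunits series_place"
    by (rule nonunit_if_expansion_vanishes[rotated])
       (simp_all add: subfield_diff[OF subfield_L z(1) const_in_L])
  then show ?thesis
    using z by (auto simp: takes_value_def series_place_def)
qed

lemma series_place_closed: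
  shows "z \<in> series_place \<Longrightarrow> w \<in> series_place \<Longrightarrow> z + w \<in> series_place"
    and "z \<in> series_place \<Longrightarrow> w \<in> series_place \<Longrightarrow> z * w \<in> series_place"
    and "z \<in> series_place \<Longrightarrow> - z \<in> series_place"
proof -
  have mem: "y \<in> series_place" if "y \<in> fractions e" "expansion y = fps_to_fls f" for y f
    using that by (auto simp: series_place_def)
  assume "z \<in> series_place"
  then obtain f where z: "z \<in> fractions e" "expansion z = fps_to_fls f"
    by (auto simp: series_place_def)
  show "- z \<in> series_place"
    by (rule mem[of _ "- f"]) (simp_all add: subfield_uminus[OF subfield_L] expansion_uminus z)
  assume "w \<in> series_place"
  then obtain g where w: "w \<in> fractions e" "expansion w = fps_to_fls g"
    by (auto simp: series_place_def)
  show "z + w \<in> series_place"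
    by (rule mem[of _ "f + g"]) (simp_all add: subfield_add[OF subfield_L] expansion_add z w)
  show "z * w \<in> series_place"
    by (rule mem[of _ "f * g"])
       (simp_all add: subfield_mult[OF subfield_L] expansion_mult z w fls_times_fps_to_fls)
qed

lemma series_place_uniformizer:
  obtains \<pi> where "\<pi> \<in> nonunits series_place" "\<pi> \<notin> range j"
proof -
  obtain p where p: "s p \<notin> range fps_const"
    using nonconstant by blast
  define b where "b = fps_nth (s p) 0"
  have e_p: "e p \<in> fractions e"
    by (rule image_in_fractions[OF e.comm_ring_hom_axioms])
  have expansion: "expansion (e p - j b) = fps_to_fls (s p - fps_const b)"
    using expansion_diff[OF e_p const_in_L] by (simp add: expansion_image expansion_const)
  show ?thesis
  proof (rule that)
    show "e p - j b \<in> nonunits series_place"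
      by (rule nonunit_if_expansion_vanishes[OF _ expansion])
         (simp_all add: b_def subfield_diff[OF subfield_L e_p const_in_L])
    show "e p - j b \<notin> range j"
    proof
      assume "e p - j b \<in> range j"
      then obtain b' where "e p - j b = j b'"
        by blast
      then have "fps_to_fls (s p - fps_const b) = fps_to_fls (fps_const b')"
        using expansion expansion_const by metis
      then have "s p - fps_const b = fps_const b'"
        unfolding fps_to_fls_eq_iff .
      then have "s p = fps_const (b' + b)"
        by (simp add: diff_eq_eq)
      then show False
        using p by blast
    qed
  qed
qed

lemma series_place_in_places: "series_place \<in> places j (fractions e)"
proof -
  obtain \<pi> where \<pi>: "\<pi> \<in> nonunits series_place" "\<pi> \<notin> range j"
    by (rule series_place_uniformizer)
  then have "\<pi> \<noteq> 0"
    using hom_zero by (metis rangeI)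
  then have "\<pi> \<in> series_place" "inverse \<pi> \<notin> series_place"
    using \<pi>(1) by (auto simp: nonunits_def)
  moreover have "inverse \<pi> \<in> fractions e"
    using \<open>\<pi> \<in> series_place\<close> by (auto simp: series_place_def intro: subfield_inverse[OF subfield_L])
  ultimately have proper: "series_place \<noteq> fractions e" "range j \<noteq> series_place"
    using \<pi>(2) by auto
  show ?thesis
    unfolding places_def
  proof (intro CollectI conjI ballI)
    show "series_place \<subseteq> fractions e"
      by (auto simp: series_place_def)
    show "range j \<subseteq> series_place"
      using expansion_const const_in_L unfolding series_place_def by blast
    show "z \<in> series_place \<or> inverse z \<in> series_place" if z: "z \<in> fractions e - {0}" for z
    proof -
      have "expansion z \<in> range fps_to_fls \<or> expansion (inverse z) \<in> range fps_to_fls"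
        using z fls_in_range_fps_to_fls_cases[of "expansion z"]
        by (simp add: expansion_inverse expansion_eq_0_iff)
      then show ?thesis
        using z subfield_inverse[OF subfield_L, of z] unfolding series_place_def by blast
    qed
  qed (use proper series_place_closed in auto)
qed

lemma takes_value_frac_map_substitution:
  assumes \<tau>: "same_kernel e (\<lambda>p. e (\<tau> p))"
    and compose: "\<And>p. s (\<tau> p) = s p oo g" and g: "fps_nth g 0 = 0"
    and value_z: "takes_value j series_place z v"
  shows "takes_value j series_place (frac_map e (\<lambda>p. e (\<tau> p)) z) v"
proof -
  interpret \<tau>: same_kernel e "\<lambda>p. e (\<tau> p)" by fact
  interpret place j "fractions e" series_place
    by (intro place.intro place_axioms.intro field_hom_axioms subfield_L series_place_in_places)
  obtain f where z: "z \<in> fractions e" "expansion z = fps_to_fls f"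
    using takes_value_mem[OF value_z] by (auto simp: series_place_def)
  have v: "v = fps_nth f 0"
    using takes_value_unique[OF value_z takes_value_series_place[OF z]] .
  obtain p q where pq: "z = e p / e q" "e q \<noteq> 0"
    using z(1) by (rule fractionsE)
  then have "fps_to_fls (s p) / fps_to_fls (s q) = fps_to_fls f"
    using z(2) expansion_fraction[of q p] by simp
  then have "fps_to_fls (s p) = fps_to_fls (f * s q)"
    using pq(2) by (simp add: s_eq_0_iff fls_times_fps_to_fls nonzero_divide_eq_eq)
  then have "s p = f * s q"
    by simp
  then have \<tau>p: "s (\<tau> p) = (f oo g) * s (\<tau> q)"
    by (simp add: compose fps_compose_mult_distrib[OF g])
  have \<tau>q: "e (\<tau> q) \<noteq> 0"
    using pq(2) \<tau>.kernel by blast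
  have conj_z: "frac_map e (\<lambda>p. e (\<tau> p)) z = e (\<tau> p) / e (\<tau> q)"
    unfolding pq(1) by (rule \<tau>.frac_map_fraction[OF pq(2)])
  have "expansion (e (\<tau> p) / e (\<tau> q)) = fps_to_fls (f oo g)"
    unfolding expansion_fraction[OF \<tau>q] \<tau>p using \<tau>q by (simp add: s_eq_0_iff fls_times_fps_to_fls)
  from takes_value_series_place[OF fractionsI[of e, OF \<tau>q] this]
  show ?thesis
    unfolding conj_z v by simp
qed

end

section \<open>The function field of the preimage curve\<close>

lemma coeff_quad_map_funpow_in_subfield:
  fixes c :: "'f::field"
  assumes S: "is_subfield S" and c: "c \<in> S"
  shows "coeff ((quad_map [:c:] ^^ m) [:0, 1:]) i \<in> S"
proof (induction m arbitrary: i)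
  case 0
  show ?case
    by (auto simp: coeff_pCons subfield_0[OF S] subfield_1[OF S] split: nat.split)
next
  case (Suc m)
  then show ?case
    using c by (auto simp: quad_map_def power2_eq_square coeff_mult coeff_pCons
        intro!: subfield_add[OF S] subfield_sum[OF S] subfield_mult[OF S] subfield_0[OF S]
        split: nat.split)
qed

lemma has_degree_iterated_preimage_le:
  fixes x c :: "'f::field"
  assumes S: "is_subfield S" and V: "is_subfield V" "S \<subseteq> V" "x \<in> V"
    and least: "\<And>T. is_subfield T \<Longrightarrow> S \<subseteq> T \<Longrightarrow> x \<in> T \<Longrightarrow> V \<subseteq> T"
    and c: "c \<in> S" and orbit: "(quad_map c ^^ M) x \<in> S"
  obtains n where "n \<le> 2 ^ M" "has_degree n S V"
proof -
  define Q where "Q = (quad_map [:c:] ^^ M) [:0, 1:] - [:(quad_map c ^^ M) x:]"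
  have degree_Q: "degree Q = 2 ^ M"
    unfolding Q_def by (subst degree_quad_map_funpow_diff_const) auto
  then have "Q \<noteq> 0"
    by auto
  obtain n where "n \<le> degree Q" "has_degree n S V"
  proof (rule has_degree_simple_le[OF S V])
    show "V \<subseteq> T" if "is_subfield T" "S \<subseteq> T" "x \<in> T" for T
      using that by (rule least)
    show "\<forall>i\<le>degree Q. coeff Q i \<in> S"
      using coeff_quad_map_funpow_in_subfield[OF S c] orbit unfolding Q_def
      by (auto simp: coeff_pCons intro!: subfield_diff[OF S] subfield_0[OF S] split: nat.split)
    show "lead_coeff Q \<noteq> 0"
      using \<open>Q \<noteq> 0\<close> by (simp only: leading_coeff_0_iff not_False_eq_True)
    have "poly Q x = 0"
      by (simp add: Q_def poly_hom.hom_quad_map_funpow)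
    then show "(\<Sum>i\<le>degree Q. coeff Q i * x ^ i) = 0"
      by (simp only: poly_altdef)
  qed
  then show ?thesis
    using that by (simp add: degree_Q)
qed

lemma (in field_hom) conic_point_in_adjoin_parameter:
  assumes conic: "u\<^sup>2 = v\<^sup>2 + v - hom a" and disc: "1 + 4 * a \<noteq> 0"
  shows "v \<in> adjoin hom (u - v)"
proof -
  define t where "t = u - v"
  note adjoin_closed = subfield_closed[OF is_subfield_adjoin[of t]]
  have param: "v * (1 - 2 * t) = t\<^sup>2 + hom a"
    using conic by (simp add: t_def power2_eq_square algebra_simps)
  have "1 - 2 * t \<noteq> 0"
  proof
    assume "1 - 2 * t = 0"
    then have "2 * t = 1" "t\<^sup>2 + hom a = 0"
      using param by simp_all
    have "1 + 4 * hom a = (2 * t) * (2 * t) + 4 * hom a"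
      unfolding \<open>2 * t = 1\<close> by simp
    also have "\<dots> = 4 * (t\<^sup>2 + hom a)"
      by (simp add: power2_eq_square algebra_simps)
    finally have "hom (1 + 4 * a) = 0"
      using \<open>t\<^sup>2 + hom a = 0\<close> by (simp add: hom_add hom_mult hom_numeral)
    then show False
      using disc by (simp add: hom_0_iff)
  qed
  then have "v = (t\<^sup>2 + hom a) / (1 - 2 * t)"
    using param by (simp add: eq_divide_eq)
  moreover have "2 \<in> adjoin hom t"
    using const_in_adjoin[of 2 t] by (simp add: hom_numeral)
  ultimately have "v \<in> adjoin hom t"
    using generator_in_adjoin[of t] const_in_adjoin[of a t] by (simp add: adjoin_closed)
  then show ?thesis
    unfolding t_def .
qed

lemma critical_roots_simple_imp_discriminant_nonzero:
  fixes a :: "'k::field"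
  assumes simple: "critical_roots_simple N a" and "N \<ge> 2" and two: "(2 :: 'k) \<noteq> 0"
  shows "1 + 4 * a \<noteq> 0"
proof
  assume disc: "1 + 4 * a = 0"
  have crit: "crit_poly 2 a = [:- a, 1, 1:]"
    by (simp add: crit_poly_def numeral_2_eq_2 quad_map_def power2_eq_square)
  define b where "b = - inverse (2 :: 'k)"
  have b: "2 * b = - 1"
    using two by (simp add: b_def)
  have "4 * (b * b + b - a) = (2 * b) * (2 * b) + 2 * (2 * b) - 4 * a"
    by (simp add: algebra_simps)
  also have "\<dots> = - (1 + 4 * a)"
    unfolding b by simp
  finally have "2 * (2 * (b * b + b - a)) = 0"
    using disc by simp
  then have "b * b + b - a = 0"
    using two by (metis mult_eq_0_iff)
  then have "poly (crit_poly 2 a) b = 0"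
    by (simp add: crit algebra_simps)
  moreover have "poly (pderiv (crit_poly 2 a)) b = 0"
    using b by (simp add: crit pderiv_pCons mult.commute)
  ultimately show False
    using simple \<open>N \<ge> 2\<close> by (auto simp: critical_roots_simple_def)
qed

locale preimage_field = alg_closed_embedding j for j :: "'k::alg_closed_field \<Rightarrow> 'f::field" +
  fixes x c :: 'f and N :: nat and a :: 'k
  assumes kernel: "eval_poly2 j x c p = 0 \<longleftrightarrow> preimage_poly N a dvd p"
    and two: "(2 :: 'k) \<noteq> 0" and simple: "critical_roots_simple N a"
begin

abbreviation L where "L \<equiv> adjoin2 j x c"

sublocale eval: comm_ring_hom "eval_poly2 j x c"
  by (rule comm_ring_hom_eval_poly2)

lemmas L_closed = subfield_closed[OF is_subfield_adjoin2[of x c]]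

lemma orbit_eq: "(quad_map c ^^ N) x = j a"
  using kernel[of "preimage_poly N a"] by (simp add: eval_poly2_preimage_poly)

lemma nonzero_if_degree_less: "p \<noteq> 0 \<Longrightarrow> degree p < 2 ^ N \<Longrightarrow> eval_poly2 j x c p \<noteq> 0"
  using dvd_imp_degree_le[of "preimage_poly N a" p] by (auto simp: kernel degree_preimage_poly)

lemma c_transcendental: "c \<notin> range j"
proof
  assume "c \<in> range j"
  then obtain b where "c = j b" by auto
  then have "eval_poly2 j x c [:[:- b, 1:]:] = 0"
    by (simp add: hom_uminus)
  then show False
    using nonzero_if_degree_less[of "[:[:- b, 1:]:]"] by simp
qed

lemma two_nonzero: "(2 :: 'f) \<noteq> 0"
  using two hom_0_iff[of 2] by (simp add: hom_numeral)

subsection \<open>Places on the curve\<close>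

lemma power_series_embedding_curve_param:
  assumes param: "curve_param N a \<xi> \<eta>"
  shows "power_series_embedding j (eval_poly2 j x c) (eval_poly2 fps_const \<xi> \<eta>) (\<lambda>b. [:[:b:]:])"
proof -
  interpret const: comm_ring_hom "fps_const :: 'k \<Rightarrow> 'k fps"
    by (rule comm_ring_hom_fps_const)
  show ?thesis
  proof (intro power_series_embedding.intro power_series_embedding_axioms.intro field_hom_axioms
      eval.comm_ring_hom_axioms const.comm_ring_hom_eval_poly2)
    have "eval_poly2 fps_const \<xi> \<eta> [:[:0, 1:]:] \<notin> range fps_const"
      using param by (simp add: curve_param_def)
    then show "\<exists>p. eval_poly2 fps_const \<xi> \<eta> p \<notin> range fps_const"
      by blast
  qed (simp_all add: kernel curve_param_eval_eq_0_iff[OF prime_elem_preimage_poly[OF simple] param])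
qed

lemma takes_value_c_at_series_place:
  assumes param: "curve_param N a \<xi> \<eta>"
  shows "takes_value j (power_series_embedding.series_place (eval_poly2 j x c) (eval_poly2 fps_const \<xi> \<eta>))
           c (fps_nth \<eta> 0)"
proof -
  interpret power_series_embedding j "eval_poly2 j x c" "eval_poly2 fps_const \<xi> \<eta>" "\<lambda>b. [:[:b:]:]"
    by (rule power_series_embedding_curve_param[OF param])
  interpret const: comm_ring_hom "fps_const :: 'k \<Rightarrow> 'k fps"
    by (rule comm_ring_hom_fps_const)
  have "expansion c = fps_to_fls \<eta>"
    using expansion_image[of "[:[:0, 1:]:]"] by simp
  then show ?thesis
    using generators_in_adjoin2(2) unfolding adjoin2_def by (intro takes_value_series_place)
qed

lemma place_over_parameter:
  assumes param: "curve_param N a \<xi> \<eta>"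
  obtains P where "P \<in> places j L" "takes_value j P c (fps_nth \<eta> 0)"
  using power_series_embedding.series_place_in_places[OF power_series_embedding_curve_param[OF param]]
    takes_value_c_at_series_place[OF param] that
  unfolding adjoin2_def by blast

lemma placeI: "P \<in> places j L \<Longrightarrow> place j L P"
  by (intro place.intro place_axioms.intro field_hom_axioms is_subfield_adjoin2)

lemma infinite_places: "infinite (places j L)"
proof
  assume fin: "finite (places j L)"
  define B where "B = (\<Union>M\<in>{1..N}. {s. poly (crit_poly M a) s = 0})"
  have "crit_poly M a \<noteq> 0" if "M \<in> {1..N}" for M
    using crit_poly_Suc_nonzero[of "M - 1" a] that by simp
  then have "finite B"
    unfolding B_def by (intro finite_UN_I poly_roots_finite) auto
  obtain P where P: "inj_on P (- B)" "P ` (- B) \<subseteq> places j L"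
  proof (rule places_with_distinct_values[OF is_subfield_adjoin2 order.refl])
    fix s assume "s \<in> - B"
    then obtain \<xi> where param: "curve_param N a \<xi> (fps_const s + fps_X)"
      using curve_param_at_noncritical_value[OF two, of N a s] by (auto simp: B_def)
    show "\<exists>P\<in>places j L. takes_value j P c s"
      by (rule place_over_parameter[OF param]) auto
  qed
  then have "finite (- B)"
    using fin by (meson finite_imageD finite_subset)
  then show False
    using \<open>finite B\<close> infinite_UNIV_alg_closed_field[where 'k = 'k] by (metis Compl_partition finite_UnI)
qed

subsection \<open>A function of small degree\<close>

lemma rational_function_of_conic_parameter:
  assumes "N = Suc (Suc M)"
  obtains t where "t \<in> L" "(quad_map c ^^ M) x \<in> adjoin j t" "c \<in> adjoin j t"
proof -
  define u where "u = (quad_map c ^^ M) x"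
  define v where "v = u\<^sup>2 + c"
  define t where "t = u - v"
  note adjoin_closed = subfield_closed[OF is_subfield_adjoin[of t]]
  have "v\<^sup>2 + c = j a"
    using orbit_eq by (simp add: assms u_def v_def quad_map_def)
  then have c_eq: "c = j a - v\<^sup>2"
    by (simp add: eq_diff_eq add.commute)
  have "u\<^sup>2 = v - c"
    by (simp add: v_def)
  also have "\<dots> = v\<^sup>2 + v - j a"
    by (subst c_eq) simp
  finally have "u\<^sup>2 = v\<^sup>2 + v - j a" .
  moreover have "1 + 4 * a \<noteq> 0"
    by (rule critical_roots_simple_imp_discriminant_nonzero[OF simple _ two]) (simp add: assms)
  ultimately have v: "v \<in> adjoin j t"
    unfolding t_def by (rule conic_point_in_adjoin_parameter)
  show ?thesis
  proof (rule that)
    show "t \<in> L"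
      unfolding t_def v_def u_def
      by (intro L_closed subfield_quad_map_funpow is_subfield_adjoin2 generators_in_adjoin2)
    have "u = t + v"
      by (simp add: t_def)
    then show "(quad_map c ^^ M) x \<in> adjoin j t"
      using v generator_in_adjoin[of t] by (simp add: adjoin_closed flip: u_def)
    show "c \<in> adjoin j t"
      unfolding c_eq using v const_in_adjoin[of a t] by (simp add: adjoin_closed)
  qed
qed

lemma function_of_small_degree:
  assumes "N \<ge> 2"
  obtains t n where "function_field_in_one_variable j L t n" "n \<le> 2 ^ (N - 2)"
proof -
  obtain M where M: "N = Suc (Suc M)"
    using assms by (metis add_2_eq_Suc le_Suc_ex)
  obtain t where t: "t \<in> L" "(quad_map c ^^ M) x \<in> adjoin j t" "c \<in> adjoin j t"
    by (rule rational_function_of_conic_parameter[OF M])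
  obtain n where n: "n \<le> 2 ^ M" "has_degree n (adjoin j t) L"
  proof (rule has_degree_iterated_preimage_le[OF is_subfield_adjoin is_subfield_adjoin2
        _ generators_in_adjoin2(1) _ t(3,2)])
    show "adjoin j t \<subseteq> L"
      by (intro adjoin_subset is_subfield_adjoin2 range_subset_adjoin2 t)
    show "L \<subseteq> T" if "is_subfield T" "adjoin j t \<subseteq> T" "x \<in> T" for T
      using that t(3) range_subset_adjoin[of t] by (intro adjoin2_subset) auto
  qed
  have "t \<notin> range j"
    using adjoin_subset_range[of t] t(3) c_transcendental by blast
  then have "function_field_in_one_variable j L t n"
    by (intro function_field_in_one_variable.intro function_field_in_one_variable_axioms.intro
        alg_closed_embedding_axioms is_subfield_adjoin2 range_subset_adjoin2 t n)
  then show ?thesis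
    by (rule that) (use n(1) M in simp)
qed

end

section \<open>The involution \<open>x \<mapsto> - x\<close>\<close>

lemma pcompose_neg_neg: "pcompose (pcompose p [:0, - 1:]) [:0, - 1:] = (p :: 'k::comm_ring_1 poly poly)"
proof -
  have "pcompose [:0, - 1:] [:0, - 1:] = ([:0, 1:] :: 'k poly poly)"
    by (simp add: pcompose_pCons)
  then show ?thesis
    unfolding pcompose_assoc[symmetric] by simp
qed

lemma preimage_poly_dvd_pcompose_neg_iff:
  "preimage_poly (Suc M) a dvd pcompose p [:0, - 1:] \<longleftrightarrow> preimage_poly (Suc M) a dvd p"
proof -
  have neg: "preimage_poly (Suc M) a dvd pcompose q [:0, - 1:]" if "preimage_poly (Suc M) a dvd q" for q
    using pcompose_hom.hom_dvd[OF that, of "[:0, - 1:]"] by (simp only: preimage_poly_even)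
  show ?thesis
    using neg[of p] neg[of "pcompose p [:0, - 1:]"] by (auto simp only: pcompose_neg_neg)
qed

locale preimage_field_Suc = preimage_field j x c "Suc M" a
  for j :: "'k::alg_closed_field \<Rightarrow> 'f::field" and x c M a
begin

definition \<sigma> :: "'f \<Rightarrow> 'f" where
  "\<sigma> = frac_map (eval_poly2 j x c) (\<lambda>p. eval_poly2 j x c (pcompose p [:0, - 1:]))"

sublocale \<sigma>: same_kernel "eval_poly2 j x c" "\<lambda>p. eval_poly2 j x c (pcompose p [:0, - 1:])"
  by (intro same_kernel.intro eval.comm_ring_hom_axioms same_kernel_axioms.intro
      comm_ring_hom_compose[OF pcompose_hom.comm_ring_hom_axioms eval.comm_ring_hom_axioms])
     (simp add: kernel preimage_poly_dvd_pcompose_neg_iff)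

lemmas \<sigma>_add = \<sigma>.frac_map_add[folded \<sigma>_def adjoin2_def]
  and \<sigma>_mult = \<sigma>.frac_map_mult[folded \<sigma>_def adjoin2_def]
  and \<sigma>_uminus = \<sigma>.frac_map_uminus[folded \<sigma>_def adjoin2_def]
  and \<sigma>_diff = \<sigma>.frac_map_diff[folded \<sigma>_def adjoin2_def]
  and \<sigma>_inverse = \<sigma>.frac_map_inverse[folded \<sigma>_def adjoin2_def]
  and \<sigma>_image = \<sigma>.frac_map_image[folded \<sigma>_def]
  and \<sigma>_fraction = \<sigma>.frac_map_fraction[folded \<sigma>_def]

lemma \<sigma>_const [simp]: "\<sigma> (j b) = j b"
  using \<sigma>_image[of "[:[:b:]:]"] by simp

lemma \<sigma>_x [simp]: "\<sigma> x = - x"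
  using \<sigma>_image[of "[:0, 1:]"] by (simp add: eval_poly2_pcompose eval_poly2_pCons hom_uminus)

lemma \<sigma>_c [simp]: "\<sigma> c = c"
  using \<sigma>_image[of "[:[:0, 1:]:]"] by simp

lemma \<sigma>_mem: "z \<in> L \<Longrightarrow> \<sigma> z \<in> L"
  and \<sigma>_\<sigma>: "z \<in> L \<Longrightarrow> \<sigma> (\<sigma> z) = z"
proof -
  let ?n = "\<lambda>p. pcompose p [:0, - 1:]"
  assume "z \<in> L"
  then obtain p q where z: "z = eval_poly2 j x c p / eval_poly2 j x c q" "eval_poly2 j x c q \<noteq> 0"
    unfolding adjoin2_def by (rule fractionsE)
  then have q: "eval_poly2 j x c (?n q) \<noteq> 0"
    using \<sigma>.kernel by blast
  have \<sigma>_z: "\<sigma> z = eval_poly2 j x c (?n p) / eval_poly2 j x c (?n q)"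
    unfolding z(1) by (rule \<sigma>_fraction[OF z(2)])
  then show "\<sigma> z \<in> L"
    using q unfolding adjoin2_def by (simp add: fractionsI)
  show "\<sigma> (\<sigma> z) = z"
    unfolding \<sigma>_z \<sigma>_fraction[OF q] by (simp only: pcompose_neg_neg z(1))
qed

lemma \<sigma>_eval_poly: "z \<in> L \<Longrightarrow> \<sigma> (eval_poly j q z) = eval_poly j q (\<sigma> z)"
proof (induction q)
  case 0
  show ?case using \<sigma>_const[of 0] by simp
next
  case (pCons b q)
  have "eval_poly j q z \<in> L"
    by (intro eval_poly_in_subfield is_subfield_adjoin2 range_subset_adjoin2 pCons.prems)
  then show ?case
    using pCons by (simp add: \<sigma>_add \<sigma>_mult const_in_adjoin2 L_closed)
qed

lemma \<sigma>_eval_poly2: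
  "z \<in> L \<Longrightarrow> w \<in> L \<Longrightarrow> \<sigma> (eval_poly2 j z w p) = eval_poly2 j (\<sigma> z) (\<sigma> w) p"
proof (induction p)
  case 0
  show ?case using \<sigma>_const[of 0] by simp
next
  case (pCons q p)
  have "eval_poly2 j z w p \<in> L" "eval_poly j q w \<in> L"
    by (intro eval_poly2_in_subfield eval_poly_in_subfield is_subfield_adjoin2
        range_subset_adjoin2 pCons.prems)+
  then show ?case
    using pCons by (simp add: eval_poly2_pCons \<sigma>_add \<sigma>_mult \<sigma>_eval_poly L_closed)
qed

lemma x_nonzero: "x \<noteq> 0"
proof -
  have "(1 :: nat) < 2 ^ Suc M"
    by (rule one_less_power) simp_all
  then have "eval_poly2 j x c [:0, 1:] \<noteq> 0"
    by (intro nonzero_if_degree_less) simp_all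
  then show ?thesis
    by simp
qed

lemma eq_0_if_\<sigma>_eq_uminus:
  assumes "\<sigma> z = z" "\<sigma> z = - z"
  shows "z = 0"
proof -
  have "2 * z = z + \<sigma> z"
    using assms(1) by simp
  also have "\<dots> = 0"
    using assms(2) by simp
  finally show ?thesis
    using two_nonzero by simp
qed

subsection \<open>The fixed field\<close>

abbreviation lower_field where "lower_field \<equiv> adjoin2 j (x\<^sup>2 + c) c"

lemma lower_field_subset_L: "lower_field \<subseteq> L"
  by (intro adjoin2_subset is_subfield_adjoin2 range_subset_adjoin2 L_closed generators_in_adjoin2)

lemma \<sigma>_lower_field:
  assumes "z \<in> lower_field"
  shows "\<sigma> z = z"
proof -
  define T where "T = {z \<in> L. \<sigma> z = z}"
  have "is_subfield T"
    unfolding T_def using \<sigma>_const[of 1]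
    by (intro is_subfieldI) (auto simp: L_closed \<sigma>_add \<sigma>_mult \<sigma>_uminus \<sigma>_inverse)
  moreover have "range j \<subseteq> T"
    by (auto simp: T_def const_in_adjoin2)
  moreover have "x\<^sup>2 + c \<in> T"
    by (simp add: T_def power2_eq_square \<sigma>_add \<sigma>_mult generators_in_adjoin2 L_closed)
  moreover have "c \<in> T"
    by (simp add: T_def generators_in_adjoin2)
  ultimately have "lower_field \<subseteq> T"
    by (rule adjoin2_subset)
  then show ?thesis
    using assms by (auto simp: T_def)
qed

lemma x_not_in_lower_field: "x \<notin> lower_field"
  using \<sigma>_lower_field[of x] eq_0_if_\<sigma>_eq_uminus[of x] x_nonzero by auto

lemma L_eq_quadratic_extension:
  assumes "z \<in> L"
  obtains u v where "z = u + x * v" "u \<in> lower_field" "v \<in> lower_field"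
proof -
  note lower_closed = subfield_closed[OF is_subfield_adjoin2[of "x\<^sup>2 + c" c]]
  define T where "T = {u + x * v | u v. u \<in> lower_field \<and> v \<in> lower_field}"
  have mem: "u + x * v \<in> T" if "u \<in> lower_field" "v \<in> lower_field" for u v
    using that unfolding T_def by blast
  have "(x\<^sup>2 + c) - c \<in> lower_field"
    by (intro lower_closed generators_in_adjoin2)
  then have "is_subfield T"
    unfolding T_def
    by (intro subfield_quadratic_extension is_subfield_adjoin2 x_not_in_lower_field)
       (simp add: power2_eq_square)
  moreover have "range j \<subseteq> T"
    using mem[OF const_in_adjoin2 lower_closed(1)] by auto
  moreover have "x \<in> T"
    using mem[OF lower_closed(1,2)] by simp
  moreover have "c \<in> T"
    using mem[OF generators_in_adjoin2(2) lower_closed(1)] by simp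
  ultimately have "L \<subseteq> T"
    by (rule adjoin2_subset)
  then show ?thesis
    using assms that unfolding T_def by blast
qed

lemma in_lower_field_if_fixed:
  assumes "z \<in> L" "\<sigma> z = z"
  shows "z \<in> lower_field"
proof -
  obtain u v where uv: "z = u + x * v" "u \<in> lower_field" "v \<in> lower_field"
    by (rule L_eq_quadratic_extension[OF assms(1)])
  then have L: "u \<in> L" "v \<in> L" "x * v \<in> L"
    using lower_field_subset_L generators_in_adjoin2 by (auto intro: L_closed)
  have "\<sigma> z = u + \<sigma> (x * v)"
    using L uv by (simp add: \<sigma>_add \<sigma>_lower_field)
  then have "\<sigma> (x * v) = x * v"
    using assms(2) uv(1) by simp
  moreover have "\<sigma> (x * v) = - (x * v)"
    using L(2) uv(3) generators_in_adjoin2 by (simp add: \<sigma>_mult \<sigma>_lower_field)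
  ultimately have "x * v = 0"
    by (rule eq_0_if_\<sigma>_eq_uminus)
  then have "z = u"
    using uv(1) by simp
  then show ?thesis
    using uv(2) by simp
qed

lemma two_le_degree_over_lower_field:
  assumes "has_degree m lower_field L"
  shows "2 \<le> m"
proof -
  have "1 \<in> L"
    by (rule L_closed)
  then have "m > 0"
    by (rule has_degree_pos[OF is_subfield_adjoin2 assms])
  moreover have "m \<noteq> 1"
  proof
    assume "m = 1"
    then have "L \<subseteq> lower_field"
      using has_degree_1_subset[OF is_subfield_adjoin2 _ \<open>1 \<in> L\<close>] assms by blast
    then show False
      using x_not_in_lower_field generators_in_adjoin2(1) by blast
  qed
  ultimately show ?thesis
    by simp
qed

lemma degree_in_lower_field:
  assumes "h \<in> lower_field" and degree: "has_degree n (adjoin j h) L"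
  obtains e where "has_degree e (adjoin j h) lower_field" "e * 2 \<le> n"
proof -
  have "adjoin j h \<subseteq> lower_field"
    by (intro adjoin_subset is_subfield_adjoin2 range_subset_adjoin2 assms(1))
  then obtain e m where em: "has_degree e (adjoin j h) lower_field" "has_degree m lower_field L"
      "n = e * m"
    by (rule has_degree_tower_split[OF is_subfield_adjoin is_subfield_adjoin2 is_subfield_adjoin2 _
          lower_field_subset_L degree])
  have "e * 2 \<le> n"
    unfolding em(3) using two_le_degree_over_lower_field[OF em(2)] by (rule mult_le_mono2)
  with em(1) show ?thesis
    by (rule that)
qed

lemma preimage_field_lower_field: "preimage_field j (x\<^sup>2 + c) c M a"
proof (intro preimage_field.intro preimage_field_axioms.intro alg_closed_embedding_axioms two)
  fix p
  have quad: "eval_poly2 j x c quad_poly = x\<^sup>2 + c"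
    by (simp add: eval_poly2_pCons power2_eq_square add.commute)
  have "eval_poly2 j (x\<^sup>2 + c) c p = 0 \<longleftrightarrow>
      preimage_poly (Suc M) a dvd pcompose p quad_poly + [:0, 1:] * pcompose 0 quad_poly"
    using kernel[of "pcompose p quad_poly"] by (simp only: eval_poly2_pcompose quad) simp
  then show "eval_poly2 j (x\<^sup>2 + c) c p = 0 \<longleftrightarrow> preimage_poly M a dvd p"
    unfolding preimage_poly_Suc_dvd_even_odd_iff by simp
qed (rule critical_roots_simple_mono[OF simple], simp)

subsection \<open>Fixed points\<close>

definition fixed_places :: "'f set set" where
  "fixed_places = {P \<in> places j L. \<forall>z s. takes_value j P z s \<longrightarrow> takes_value j P (\<sigma> z) s}"

lemma fixed_place_over_critical_root:
  assumes c0: "poly (crit_poly (Suc M) a) c0 = 0"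
  obtains P where "P \<in> fixed_places" "takes_value j P c c0"
proof -
  obtain \<gamma> where \<gamma>: "fps_nth \<gamma> 0 = c0" "curve_param M a (\<gamma> + fps_X) \<gamma>"
    by (rule curve_param_at_critical_root[OF c0 critical_roots_simpleD[OF simple c0]])
  obtain \<eta> where \<eta>: "fps_nth \<eta> 0 = fps_nth \<gamma> 0" "\<eta> oo - fps_X = \<eta>"
    and param: "curve_param (Suc M) a fps_X \<eta>"
    by (rule even_curve_param[OF \<gamma>(2)])
  let ?s = "eval_poly2 fps_const fps_X \<eta>"
  interpret power_series_embedding j "eval_poly2 j x c" ?s "\<lambda>b. [:[:b:]:]"
    by (rule power_series_embedding_curve_param[OF param])
  interpret const: comm_ring_hom "fps_const :: 'k \<Rightarrow> 'k fps"
    by (rule comm_ring_hom_fps_const)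
  have neg: "?s (pcompose p [:0, - 1:]) = ?s p oo - fps_X" for p
  proof -
    have "comm_ring_hom (\<lambda>f :: 'k fps. f oo - fps_X)"
      by (rule comm_ring_hom_fps_compose) simp
    from const.hom_eval_poly2[OF this, of fps_X \<eta> p] show ?thesis
      by (simp add: const.eval_poly2_pcompose const.eval_poly2_pCons const.hom_uminus \<eta>(2))
  qed
  have "takes_value j series_place (\<sigma> z) s" if "takes_value j series_place z s" for z s
    unfolding \<sigma>_def
    by (rule takes_value_frac_map_substitution[OF \<sigma>.same_kernel_axioms neg _ that]) simp
  then have "series_place \<in> fixed_places"
    using series_place_in_places unfolding fixed_places_def adjoin2_def by blast
  moreover have "takes_value j series_place c c0"
    using takes_value_c_at_series_place[OF param] \<eta>(1) \<gamma>(1) by simp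
  ultimately show ?thesis
    by (rule that)
qed

lemma many_fixed_places:
  obtains Z where "finite Z" "Z \<subseteq> fixed_places" "card Z = 2 ^ M"
proof -
  define B where "B = {b. poly (crit_poly (Suc M) a) b = 0}"
  have "card B = degree (crit_poly (Suc M) a)"
    unfolding B_def
    by (rule card_simple_roots_eq_degree[OF crit_poly_Suc_nonzero critical_roots_simpleD[OF simple]])
  then have "card B = 2 ^ M"
    by (simp add: degree_crit_poly_Suc)
  obtain P where P: "inj_on P B" "P ` B \<subseteq> fixed_places"
  proof (rule places_with_distinct_values[OF is_subfield_adjoin2])
    show "fixed_places \<subseteq> places j L"
      by (auto simp: fixed_places_def)
    show "\<exists>P\<in>fixed_places. takes_value j P c b" if "b \<in> B" for b
      using that fixed_place_over_critical_root unfolding B_def by (metis mem_Collect_eq)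
  qed
  show ?thesis
  proof (rule that[of "P ` B"])
    show "card (P ` B) = 2 ^ M"
      using P(1) \<open>card B = 2 ^ M\<close> by (simp add: card_image)
    then show "finite (P ` B)"
      by (intro card_ge_0_finite) simp
  qed (rule P(2))
qed

subsection \<open>The function \<open>h - \<sigma> h\<close>\<close>

lemma \<sigma>_difference_transcendental:
  assumes "h \<in> L" "\<sigma> h \<noteq> h"
  shows "h - \<sigma> h \<notin> range j"
proof
  assume "h - \<sigma> h \<in> range j"
  then have "\<sigma> (h - \<sigma> h) = h - \<sigma> h"
    by auto
  moreover have "\<sigma> (h - \<sigma> h) = - (h - \<sigma> h)"
    using assms(1) by (simp add: \<sigma>_diff \<sigma>_mem \<sigma>_\<sigma>)
  ultimately show False
    using assms(2) eq_0_if_\<sigma>_eq_uminus[of "h - \<sigma> h"] by simp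
qed

lemma \<sigma>_difference_degree:
  assumes h: "h \<in> L" "h \<notin> range j" "\<sigma> h \<noteq> h" and degree: "has_degree n (adjoin j h) L"
  obtains m where "m \<le> 2 * n" "has_degree m (adjoin j (h - \<sigma> h)) L"
proof -
  define w where "w = h - \<sigma> h"
  let ?E = "adjoin2 j h w"
  have w: "w \<in> L" "w \<notin> range j" "h - w = \<sigma> h"
    using h \<sigma>_difference_transcendental by (simp_all add: w_def \<sigma>_mem L_closed)
  have "adjoin j h \<subseteq> ?E"
    by (intro adjoin_subset is_subfield_adjoin2 range_subset_adjoin2 generators_in_adjoin2)
  moreover have "?E \<subseteq> L"
    by (intro adjoin2_subset is_subfield_adjoin2 range_subset_adjoin2 h w)
  ultimately obtain e d
    where e: "has_degree e (adjoin j h) ?E" and d: "has_degree d ?E L" and n: "n = e * d"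
    by (rule has_degree_tower_split[OF is_subfield_adjoin is_subfield_adjoin2 is_subfield_adjoin2
          _ _ degree])
  have sym: "eval_poly2 j h (h - w) p = 0" if "eval_poly2 j (h - w) h p = 0" for p
    using \<sigma>_eval_poly2[OF \<sigma>_mem[OF h(1)] h(1), of p] that \<sigma>_const[of 0]
    by (simp add: w(3) \<sigma>_\<sigma>[OF h(1)])
  obtain m where m: "m \<le> 2 * e" "has_degree m (adjoin j w) ?E"
    by (rule has_degree_difference[OF h(2) w(2) e sym])
  have "has_degree (m * d) (adjoin j w) L"
    by (rule type_ring.telescopic_base[OF is_subfield_adjoin is_subfield_adjoin2 m(2) d])
  moreover have "m * d \<le> 2 * n"
    using m(1) by (simp add: n flip: mult.assoc)
  ultimately show ?thesis
    using that unfolding w_def by blast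
qed

lemma generator_regular_at_places:
  assumes field: "function_field_in_one_variable j L t d" and Z: "finite Z" "Z \<subseteq> places j L"
    and h: "h \<in> L" "\<sigma> h \<noteq> h"
  obtains g where "g \<in> L" "\<sigma> g \<noteq> g" "adjoin j g = adjoin j h" "\<And>P. P \<in> Z \<Longrightarrow> g \<in> P"
proof -
  interpret function_field_in_one_variable j L t d by fact
  obtain s where regular: "\<And>P. P \<in> Z \<Longrightarrow> inverse (h - j s) \<in> P"
    using regular_moebius[OF Z h(1)] by metis
  define g where "g = inverse (h - j s)"
  have "g \<in> L"
    using h(1) const_in_L by (simp add: g_def L_closed)
  moreover have "\<sigma> g \<noteq> g"
  proof
    assume "\<sigma> g = g"
    moreover have "h = inverse g + j s"
      by (simp add: g_def)
    ultimately have "\<sigma> h = h"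
      using \<open>g \<in> L\<close> const_in_L by (simp add: \<sigma>_add \<sigma>_inverse L_closed)
    then show False
      using h(2) by simp
  qed
  moreover have "adjoin j g = adjoin j h"
    by (simp add: g_def adjoin_inverse adjoin_diff_const)
  ultimately show ?thesis
    using regular unfolding g_def by (rule that)
qed

lemma degree_ge_if_not_fixed:
  assumes field: "function_field_in_one_variable j L t d" and h: "h \<in> L" "h \<notin> range j" "\<sigma> h \<noteq> h"
    and degree_h: "has_degree n (adjoin j h) L"
  shows "2 ^ M \<le> 2 * n"
proof -
  interpret function_field_in_one_variable j L t d by fact
  obtain Z where Z: "finite Z" "Z \<subseteq> fixed_places" "card Z = 2 ^ M"
    by (rule many_fixed_places)
  then have Z_places: "Z \<subseteq> places j L"
    by (auto simp: fixed_places_def)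
  obtain g where g: "g \<in> L" "\<sigma> g \<noteq> g" "adjoin j g = adjoin j h" and regular: "\<And>P. P \<in> Z \<Longrightarrow> g \<in> P"
    using generator_regular_at_places[OF field Z(1) Z_places h(1,3)] by metis
  have "g \<notin> range j"
    by (rule transcendental_if_adjoin_eq[OF g(3) h(2)])
  have zeros: "g - \<sigma> g \<in> nonunits P" if P: "P \<in> Z" for P
  proof -
    interpret P: place j L P
      using placeI P Z_places by blast
    obtain r where r: "takes_value j P g r"
      using takes_value_if_mem regular[OF P] P Z_places by blast
    then have "takes_value j P (g - \<sigma> g) (r - r)"
      using P Z(2) by (intro P.takes_value_diff) (auto simp: fixed_places_def)
    then show ?thesis
      by (simp add: P.takes_value_0_iff)
  qed
  obtain m where m: "m \<le> 2 * n" "has_degree m (adjoin j (g - \<sigma> g)) L"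
    by (rule \<sigma>_difference_degree[OF g(1) \<open>g \<notin> range j\<close> g(2) degree_h[folded g(3)]])
  have "card Z \<le> m"
    using \<sigma>_difference_transcendental[OF g(1,2)] m(2) Z(1) Z_places zeros
    by (rule card_zeros_le_degree)
  then show ?thesis
    using m(1) Z(3) by simp
qed

end

section \<open>The lower bound\<close>

theorem degree_lower_bound:
  assumes "preimage_field j x c N a" "N \<ge> 2" "h \<in> adjoin2 j x c" "h \<notin> range j"
    and "has_degree n (adjoin j h) (adjoin2 j x c)"
  shows "2 ^ (N - 2) \<le> n"
  using assms(2,1,3-)
proof (induction N arbitrary: x n rule: nat_induct_at_least)
  case base
  interpret preimage_field j x c 2 a by fact
  have "n > 0"
    using has_degree_pos[OF is_subfield_adjoin base(4)] by (simp add: L_closed)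
  then show ?case by simp
next
  case (Suc N)
  interpret preimage_field_Suc j x c N a
    using Suc.prems(1) by (simp add: preimage_field_Suc_def)
  obtain K where K: "N = Suc (Suc K)"
    using Suc.hyps by (metis add_2_eq_Suc le_Suc_ex)
  note h = Suc.prems(2,3) and degree = Suc.prems(4)
  show ?case
  proof (cases "\<sigma> h = h")
    case True
    then have "h \<in> lower_field"
      by (rule in_lower_field_if_fixed[OF h(1)])
    then obtain e where e: "has_degree e (adjoin j h) lower_field" "e * 2 \<le> n"
      by (rule degree_in_lower_field[OF _ degree])
    have "2 ^ (N - 2) \<le> e"
      by (rule Suc.IH[OF preimage_field_lower_field \<open>h \<in> lower_field\<close> h(2) e(1)])
    then show ?thesis
      using e(2) by (simp add: K)
  next
    case False
    obtain t d where "function_field_in_one_variable j L t d"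
      by (rule function_of_small_degree) (use Suc.hyps in auto)
    then have "2 ^ N \<le> 2 * n"
      using h False degree by (rule degree_ge_if_not_fixed)
    then show ?thesis
      by (simp add: K)
  qed
qed

section \<open>The projective line\<close>

abbreviation (input) finite_point :: "'k::field \<Rightarrow> ('k \<times> 'k) set" where
  "finite_point s \<equiv> hom_point s 1"

abbreviation (input) infinite_point :: "('k::field \<times> 'k) set" where
  "infinite_point \<equiv> hom_point 1 0"

lemma hom_point_scale:
  assumes "l \<noteq> 0"
  shows "hom_point (l * u) (l * v) = hom_point u (v :: 'k::field)"
proof
  show "hom_point (l * u) (l * v) \<subseteq> hom_point u v"
    unfolding hom_point_def using assms by (auto simp: mult.assoc[symmetric])
  show "hom_point u v \<subseteq> hom_point (l * u) (l * v)"
  proof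
    fix p assume "p \<in> hom_point u v"
    then obtain k where k: "k \<noteq> 0" "p = (k * u, k * v)"
      by (auto simp: hom_point_def)
    then have "p = ((k / l) * (l * u), (k / l) * (l * v))" "k / l \<noteq> 0"
      using assms by auto
    then show "p \<in> hom_point (l * u) (l * v)"
      unfolding hom_point_def by blast
  qed
qed

lemma hom_point_eq_imp_proportional:
  assumes "hom_point u v = hom_point u' v'"
  obtains l where "l \<noteq> 0" "u = l * u'" "v = l * v'"
proof -
  have "(u, v) \<in> hom_point u v"
    unfolding hom_point_def by (intro CollectI exI[of _ 1]) simp
  then have "\<exists>l. l \<noteq> 0 \<and> u = l * u' \<and> v = l * v'"
    unfolding assms by (simp add: hom_point_def) blast
  then show ?thesis
    using that by auto
qed

lemma hom_point_eq_finite_point: "v \<noteq> 0 \<Longrightarrow> hom_point u v = finite_point (u / v)"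
  using hom_point_scale[of v "u / v" 1] by simp

lemma hom_point_eq_infinite_point: "u \<noteq> 0 \<Longrightarrow> hom_point u 0 = infinite_point"
  using hom_point_scale[of u 1 0] by simp

lemma finite_point_eq_iff [simp]: "hom_point s 1 = hom_point s' 1 \<longleftrightarrow> s = (s' :: 'k::field)"
  by (auto elim: hom_point_eq_imp_proportional)

lemma finite_point_neq_infinite_point [simp]:
  "hom_point s 1 \<noteq> hom_point 1 (0 :: 'k::field)" "hom_point 1 0 \<noteq> hom_point s (1 :: 'k)"
  by (auto elim: hom_point_eq_imp_proportional)

lemma proj_line_eq: "proj_line = insert infinite_point (range finite_point)"
proof
  show "proj_line \<subseteq> insert infinite_point (range (finite_point :: 'a \<Rightarrow> _))"
  proof
    fix Q :: "('a \<times> 'a) set" assume "Q \<in> proj_line"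
    then obtain u v where "Q = hom_point u v" "(u, v) \<noteq> (0, 0)"
      by (auto simp: proj_line_def)
    then show "Q \<in> insert infinite_point (range (finite_point :: 'a \<Rightarrow> _))"
      using hom_point_eq_finite_point[of v u] hom_point_eq_infinite_point[of u] by (cases "v = 0") auto
  qed
  have mem: "hom_point u v \<in> proj_line" if "(u, v) \<noteq> (0, 0)" for u v :: 'a
    using that unfolding proj_line_def by blast
  show "insert infinite_point (range finite_point) \<subseteq> (proj_line :: ('a \<times> 'a) set set)"
    using mem[of 1 0] mem[of _ 1] by auto
qed

lemma proj_line_cases:
  assumes "Q \<in> proj_line"
  obtains (finite) s where "Q = finite_point s" | (infinite) "Q = infinite_point"
  using assms unfolding proj_line_eq by auto

subsection \<open>Binary forms\<close>

definition form_poly :: "nat \<Rightarrow> (nat \<Rightarrow> 'k::field) \<Rightarrow> 'k poly" where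
  "form_poly d b = (\<Sum>i\<le>d. Polynomial.monom (b i) i)"

lemma coeff_form_poly: "coeff (form_poly d b) i = (if i \<le> d then b i else 0)"
  unfolding form_poly_def coeff_sum by (simp add: coeff_monom)

lemma degree_form_poly: "degree (form_poly d b) \<le> d"
  by (rule degree_le) (simp add: coeff_form_poly)

lemma form_poly_coeff: "degree p \<le> d \<Longrightarrow> form_poly d (coeff p) = p"
  by (intro poly_eqI) (auto simp: coeff_form_poly coeff_eq_0)

lemma binary_form_finite_point: "binary_form d b s 1 = poly (form_poly d b) s"
  unfolding binary_form_def form_poly_def poly_sum by (simp add: poly_monom)

lemma binary_form_infinite_point: "binary_form d b 1 0 = b d"
proof -
  have "binary_form d b 1 0 = (\<Sum>i\<le>d. if i = d then b i else 0)"
    unfolding binary_form_def by (rule sum.cong) (auto simp: power_0_left)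
  then show ?thesis
    by simp
qed

lemma binary_form_scale: "binary_form d b (l * u) (l * v) = l ^ d * binary_form d b u v"
  unfolding binary_form_def sum_distrib_left
proof (rule sum.cong)
  fix i assume "i \<in> {..d}"
  then have "l ^ d = l ^ i * l ^ (d - i)"
    by (simp flip: power_add)
  then show "b i * (l * u) ^ i * (l * v) ^ (d - i) = l ^ d * (b i * u ^ i * v ^ (d - i))"
    by (simp add: power_mult_distrib)
qed simp

lemma binary_form_eq_0_cong:
  "hom_point u v = hom_point u' v' \<Longrightarrow> binary_form d b u v = 0 \<longleftrightarrow> binary_form d b u' v' = 0"
  by (auto elim!: hom_point_eq_imp_proportional simp: binary_form_scale)

lemma binary_form_eq_0_if_form_poly_eq_0:
  assumes "form_poly d b = 0"
  shows "binary_form d b u v = 0"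
  unfolding binary_form_def
proof (rule sum.neutral, intro ballI)
  fix i assume "i \<in> {..d}"
  then show "b i * u ^ i * v ^ (d - i) = 0"
    using arg_cong[OF assms, of "\<lambda>p. coeff p i"] by (simp add: coeff_form_poly)
qed

subsection \<open>Closed and open sets\<close>

lemma proj_line_closed_cases:
  assumes "proj_line_closed Z"
  obtains "Z = proj_line" | "finite Z" "Z \<subseteq> proj_line"
proof -
  obtain S where Z: "Z = {hom_point u v | u v.
      (u, v) \<noteq> (0, 0) \<and> (\<forall>(d, b) \<in> S. binary_form d b u v = 0)}"
    using assms unfolding proj_line_closed_def by blast
  have subset: "Z \<subseteq> proj_line"
    unfolding Z proj_line_def by blast
  show ?thesis
  proof (cases "\<exists>(d, b)\<in>S. form_poly d b \<noteq> 0")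
    case True
    then obtain d b where db: "(d, b) \<in> S" "form_poly d b \<noteq> 0"
      by blast
    have "Z \<subseteq> insert infinite_point (finite_point ` {s. poly (form_poly d b) s = 0})"
    proof
      fix Q assume "Q \<in> Z"
      then obtain u v where Q: "Q = hom_point u v" "binary_form d b u v = 0"
        using db(1) unfolding Z by blast
      from \<open>Q \<in> Z\<close> have "Q \<in> proj_line"
        using subset by blast
      then show "Q \<in> insert infinite_point (finite_point ` {s. poly (form_poly d b) s = 0})"
      proof (cases rule: proj_line_cases)
        case (finite s)
        then have "binary_form d b s 1 = 0"
          using Q binary_form_eq_0_cong[of u v s 1] by simp
        then show ?thesis
          by (simp add: finite binary_form_finite_point)
      qed simp
    qed
    then have "finite Z"
      using poly_roots_finite[OF db(2)] by (meson finite.insertI finite_imageI finite_subset)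
    then show ?thesis
      using subset by (rule that(2))
  next
    case False
    then have "Z = proj_line"
      unfolding Z proj_line_def using binary_form_eq_0_if_form_poly_eq_0 by fastforce
    then show ?thesis
      by (rule that(1))
  qed
qed

lemma proj_line_closed_roots:
  fixes p :: "'k::field poly"
  assumes p: "degree p \<le> d"
  shows "proj_line_closed
    (finite_point ` {s. poly p s = 0} \<union> (if coeff p d = 0 then {infinite_point} else {}))"
    (is "proj_line_closed ?Z")
proof -
  let ?locus = "{hom_point u v | u v. (u, v) \<noteq> (0, 0) \<and> binary_form d (coeff p) u v = 0}"
  have point: "hom_point u v \<in> ?locus \<longleftrightarrow> binary_form d (coeff p) u v = 0" if "(u, v) \<noteq> (0, 0)" for u v
    using that binary_form_eq_0_cong by blast
  have finite: "finite_point s \<in> ?locus \<longleftrightarrow> poly p s = 0" for s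
    by (subst point) (simp_all add: binary_form_finite_point form_poly_coeff[OF p])
  have infinite: "infinite_point \<in> ?locus \<longleftrightarrow> coeff p d = 0"
    by (subst point) (simp_all add: binary_form_infinite_point)
  have "?Z = ?locus"
  proof (intro equalityI subsetI)
    fix Q assume "Q \<in> ?Z"
    then show "Q \<in> ?locus"
      using finite infinite by (auto split: if_splits)
  next
    fix Q assume Q: "Q \<in> ?locus"
    then have "Q \<in> proj_line"
      unfolding proj_line_def by blast
    then show "Q \<in> ?Z"
      using Q finite infinite by (cases rule: proj_line_cases) simp_all
  qed
  then show ?thesis
    unfolding proj_line_closed_def by (intro exI[of _ "{(d, coeff p)}"]) simp
qed

lemma proj_line_closed_singleton:
  assumes "Q \<in> proj_line"
  shows "proj_line_closed {Q}"
  using assms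
proof (cases rule: proj_line_cases)
  case (finite s)
  have "{r. poly [:- s, 1:] r = 0} = {s}"
    by auto
  then show ?thesis
    using proj_line_closed_roots[of "[:- s, 1:]" 1] by (simp add: finite)
next
  case infinite
  then show ?thesis
    using proj_line_closed_roots[of "1 :: 'a poly" 1] by simp
qed

lemma proj_line_open_cofinite:
  assumes "proj_line_open V" "V \<noteq> {}"
  shows "finite (proj_line - V)"
  using assms unfolding proj_line_open_def by (auto elim: proj_line_closed_cases)

lemma cofinitely_many_finite_points:
  fixes V :: "('k::field \<times> 'k) set set"
  assumes "proj_line_open V" "V \<noteq> {}"
  shows "finite {s. finite_point s \<notin> V}"
proof (rule finite_subset)
  show "{s. finite_point s \<notin> V} \<subseteq> finite_point -` (proj_line - V)"
    by (auto simp: proj_line_eq)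
  show "finite (finite_point -` (proj_line - V))"
    by (rule finite_vimageI[OF proj_line_open_cofinite[OF assms]]) (simp add: inj_on_def)
qed

definition nonvanishing :: "'k::field poly \<Rightarrow> ('k \<times> 'k) set set" where
  "nonvanishing q = finite_point ` {s. poly q s \<noteq> 0}"

lemma proj_line_open_nonvanishing: "proj_line_open (nonvanishing q)"
proof -
  have "proj_line - nonvanishing q = finite_point ` {s. poly q s = 0} \<union> {infinite_point}"
    by (auto simp: nonvanishing_def proj_line_eq)
  then have "proj_line_closed (proj_line - nonvanishing q)"
    using proj_line_closed_roots[of q "Suc (degree q)"] by (simp add: coeff_eq_0)
  then show ?thesis
    unfolding proj_line_open_def by (auto simp: nonvanishing_def proj_line_eq)
qed

lemma nonvanishing_nonempty:
  fixes q :: "'k::alg_closed_field poly"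
  assumes "q \<noteq> 0"
  shows "nonvanishing q \<noteq> {}"
proof -
  obtain s where "poly q s \<noteq> 0"
    using ex_new_if_finite[OF infinite_UNIV_alg_closed_field poly_roots_finite[OF assms]] by blast
  then show ?thesis
    unfolding nonvanishing_def by blast
qed

subsection \<open>Regular functions\<close>

definition ratio_function :: "'k::field poly \<Rightarrow> 'k poly \<Rightarrow> ('k \<times> 'k) set \<Rightarrow> 'k" where
  "ratio_function p q Q = (let s = THE s. Q = finite_point s in poly p s / poly q s)"

lemma ratio_function_finite_point [simp]: "ratio_function p q (hom_point s 1) = poly p s / poly q s"
  unfolding ratio_function_def by simp

lemma proj_line_regular_ratio_function: "proj_line_regular_on (nonvanishing q) (ratio_function p q)"
  unfolding proj_line_regular_on_def
proof
  fix Q assume Q: "Q \<in> nonvanishing q"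
  define d where "d = max (degree p) (degree q)"
  have "binary_form d (coeff q) u v \<noteq> 0 \<and>
      ratio_function p q (hom_point u v) = binary_form d (coeff p) u v / binary_form d (coeff q) u v"
    if point: "hom_point u v \<in> nonvanishing q" for u v
  proof -
    obtain s where s: "hom_point u v = finite_point s" "poly q s \<noteq> 0"
      using point unfolding nonvanishing_def by blast
    then obtain l where l: "l \<noteq> 0" "u = l * s" "v = l * 1"
      by (elim hom_point_eq_imp_proportional)
    have "binary_form d (coeff r) u v = l ^ d * poly r s" if "degree r \<le> d" for r
      unfolding l(2,3) binary_form_scale binary_form_finite_point form_poly_coeff[OF that] ..
    then show ?thesis
      using s l(1) by (simp add: d_def)
  qed
  then show "\<exists>U. proj_line_open U \<and> Q \<in> U \<and> U \<subseteq> nonvanishing q \<and>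
        (\<exists>d A B. \<forall>u v. (u, v) \<noteq> (0, 0) \<and> hom_point u v \<in> U \<longrightarrow>
            binary_form d B u v \<noteq> 0 \<and>
            ratio_function p q (hom_point u v) = binary_form d A u v / binary_form d B u v)"
    using Q proj_line_open_nonvanishing by blast
qed

definition represents_on ::
    "nat \<Rightarrow> (nat \<Rightarrow> 'k::field) \<Rightarrow> (nat \<Rightarrow> 'k) \<Rightarrow> ('k \<times> 'k) set set \<Rightarrow> (('k \<times> 'k) set \<Rightarrow> 'k) \<Rightarrow> bool" where
  "represents_on d A B U g \<longleftrightarrow> proj_line_open U \<and> form_poly d B \<noteq> 0 \<and>
     (\<forall>s. finite_point s \<in> U \<longrightarrow> poly (form_poly d B) s \<noteq> 0 \<and>
        g (finite_point s) = poly (form_poly d A) s / poly (form_poly d B) s) \<and>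
     (infinite_point \<in> U \<longrightarrow> B d \<noteq> 0 \<and> g infinite_point = A d / B d)"

lemma proj_line_regular_representation:
  assumes "proj_line_regular_on V g" "Q \<in> V"
  obtains U d A B where "Q \<in> U" "U \<subseteq> V" "represents_on d A B U g"
proof -
  obtain U d A B where U: "proj_line_open U" "Q \<in> U" "U \<subseteq> V"
    and g: "\<And>u v. (u, v) \<noteq> (0, 0) \<Longrightarrow> hom_point u v \<in> U \<Longrightarrow> binary_form d B u v \<noteq> 0 \<and>
            g (hom_point u v) = binary_form d A u v / binary_form d B u v"
    using assms unfolding proj_line_regular_on_def by metis
  obtain u v where "Q = hom_point u v" "(u, v) \<noteq> (0, 0)"
    using U unfolding proj_line_open_def proj_line_def by blast
  then have "form_poly d B \<noteq> 0"
    using g U(2) binary_form_eq_0_if_form_poly_eq_0 by blast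
  then have "represents_on d A B U g"
    using U(1) g[of _ 1] g[of 1 0]
    by (simp add: represents_on_def binary_form_finite_point binary_form_infinite_point)
  with U(2,3) show ?thesis
    by (rule that)
qed

text \<open>Two representations of a function agree as fractions, since they agree at infinitely many
  points.\<close>

lemma representations_cross_multiply:
  fixes g :: "('k::alg_closed_field \<times> 'k) set \<Rightarrow> 'k"
  assumes "represents_on d A B U g" "U \<noteq> {}" "represents_on d' A' B' U' g" "U' \<noteq> {}"
  shows "form_poly d A * form_poly d' B' = form_poly d' A' * form_poly d B" (is "?l = ?r")
proof (rule ccontr)
  assume "?l \<noteq> ?r"
  then have "finite {s. poly (?l - ?r) s = 0}"
    by (intro poly_roots_finite) simp
  moreover have "finite {s. finite_point s \<notin> U}" "finite {s. finite_point s \<notin> U'}"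
    using assms by (auto simp: represents_on_def intro: cofinitely_many_finite_points)
  ultimately have
    "finite ({s. poly (?l - ?r) s = 0} \<union> {s. finite_point s \<notin> U} \<union> {s. finite_point s \<notin> U'})"
    by blast
  from ex_new_if_finite[OF infinite_UNIV_alg_closed_field this]
  obtain s where s: "poly (?l - ?r) s \<noteq> 0" "finite_point s \<in> U" "finite_point s \<in> U'"
    by blast
  have "poly (form_poly d A) s / poly (form_poly d B) s =
      poly (form_poly d' A') s / poly (form_poly d' B') s"
    and "poly (form_poly d B) s \<noteq> 0" "poly (form_poly d' B') s \<noteq> 0"
    using assms(1,3) s(2,3) unfolding represents_on_def by metis+
  then have "poly (?l - ?r) s = 0"
    by (simp add: frac_eq_eq)
  then show False
    using s(1) by simp
qed

section \<open>Fraction fields of rings embedded in a field\<close>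

locale ring_embedding = ring_hom_ring R type_ring e
  for R (structure) and e :: "'r \<Rightarrow> 'f::field" +
  assumes inj: "inj_on e (carrier R)"
begin

definition quotients :: "'f set" where
  "quotients = {e r / e s | r s. r \<in> carrier R \<and> s \<in> carrier R \<and> e s \<noteq> 0}"

definition representatives :: "'f \<Rightarrow> ('r \<times> 'r) set" where
  "representatives z = {(r, s). r \<in> carrier R \<and> s \<in> carrier R \<and> e s \<noteq> 0 \<and> z = e r / e s}"

lemma e_eq_0_iff: "r \<in> carrier R \<Longrightarrow> e r = 0 \<longleftrightarrow> r = \<zero>"
  using inj_onD[OF inj, of r \<zero>] hom_zero by auto

lemma frac_class_eq_representatives:
  assumes r: "r \<in> carrier R" and s: "s \<in> carrier R" "e s \<noteq> 0"
  shows "frac_class R r s = representatives (e r / e s)"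
proof -
  have "r \<otimes> s' = r' \<otimes> s \<longleftrightarrow> e r / e s = e r' / e s'"
    if "r' \<in> carrier R" "s' \<in> carrier R" "e s' \<noteq> 0" for r' s'
  proof -
    have "r \<otimes> s' = r' \<otimes> s \<longleftrightarrow> e (r \<otimes> s') = e (r' \<otimes> s)"
      using r s that by (intro inj_on_eq_iff[OF inj, symmetric]) auto
    also have "\<dots> \<longleftrightarrow> e r / e s = e r' / e s'"
      using r s that by (simp add: frac_eq_eq)
    finally show ?thesis .
  qed
  then show ?thesis
    using r s unfolding frac_class_def frac_rel_def representatives_def
    by (auto simp: e_eq_0_iff)
qed

lemma representatives_nonempty:
  assumes "z \<in> quotients"
  shows "representatives z \<noteq> {}"
  using assms unfolding quotients_def representatives_def by blast

lemma inj_on_representatives: "inj_on representatives quotients"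
proof (rule inj_onI)
  fix z w assume "z \<in> quotients" and same: "representatives z = representatives w"
  then obtain r s where "(r, s) \<in> representatives z"
    using representatives_nonempty by fastforce
  then have "(r, s) \<in> representatives z" "(r, s) \<in> representatives w"
    by (simp_all add: same)
  then show "z = w"
    by (simp add: representatives_def)
qed

lemma carrier_fraction_field: "carrier (fraction_field R) = representatives ` quotients"
proof -
  let ?D = "carrier R \<times> {s \<in> carrier R. e s \<noteq> 0}"
  have "carrier R - {\<zero>} = {s \<in> carrier R. e s \<noteq> 0}"
    using e_eq_0_iff by blast
  then have "carrier (fraction_field R) = (\<lambda>(r, s). frac_class R r s) ` ?D"
    by (simp add: fraction_field_def frac_class_def quotient_def UNION_singleton_eq_range case_prod_unfold)
  also have "\<dots> = (\<lambda>(r, s). representatives (e r / e s)) ` ?D"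
    by (rule image_cong) (auto simp: frac_class_eq_representatives)
  also have "\<dots> = representatives ` quotients"
    by (auto simp: quotients_def)
  finally show ?thesis .
qed

lemma UN_representatives:
  assumes "z \<in> quotients" "w \<in> quotients"
    and const: "\<And>r s r' s'. (r, s) \<in> representatives z \<Longrightarrow> (r', s') \<in> representatives w \<Longrightarrow> G r s r' s' = A"
  shows "(\<Union>(r, s)\<in>representatives z. \<Union>(r', s')\<in>representatives w. G r s r' s') = A"
proof -
  obtain r s r' s' where "(r, s) \<in> representatives z" "(r', s') \<in> representatives w"
    using representatives_nonempty assms(1,2) by fastforce
  then show ?thesis
    using const by fastforce
qed

lemma fraction_field_mult:
  assumes "z \<in> quotients" "w \<in> quotients"
  shows "representatives z \<otimes>\<^bsub>fraction_field R\<^esub> representatives w = representatives (z * w)"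
proof -
  have "representatives z \<otimes>\<^bsub>fraction_field R\<^esub> representatives w =
      (\<Union>(r, s)\<in>representatives z. \<Union>(r', s')\<in>representatives w. frac_class R (r \<otimes> r') (s \<otimes> s'))"
    by (simp add: fraction_field_def)
  also have "\<dots> = representatives (z * w)"
    by (rule UN_representatives[OF assms])
       (auto simp: representatives_def[of z] representatives_def[of w] frac_class_eq_representatives)
  finally show ?thesis .
qed

lemma fraction_field_add:
  assumes "z \<in> quotients" "w \<in> quotients"
  shows "representatives z \<oplus>\<^bsub>fraction_field R\<^esub> representatives w = representatives (z + w)"
proof -
  have "representatives z \<oplus>\<^bsub>fraction_field R\<^esub> representatives w =
      (\<Union>(r, s)\<in>representatives z. \<Union>(r', s')\<in>representatives w.
        frac_class R (r \<otimes> s' \<oplus> r' \<otimes> s) (s \<otimes> s'))"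
    by (simp add: fraction_field_def)
  also have "\<dots> = representatives (z + w)"
    by (rule UN_representatives[OF assms])
       (auto simp: representatives_def[of z] representatives_def[of w]
          frac_class_eq_representatives add_frac_eq)
  finally show ?thesis .
qed

lemma fraction_field_one: "\<one>\<^bsub>fraction_field R\<^esub> = representatives 1"
  using frac_class_eq_representatives[of \<one> \<one>] by (simp add: fraction_field_def)

lemma fraction_field_zero: "\<zero>\<^bsub>fraction_field R\<^esub> = representatives 0"
  using frac_class_eq_representatives[of \<zero> \<one>] by (simp add: fraction_field_def)

theorem representatives_ring_iso:
  "representatives \<in> ring_iso (type_ring\<lparr>carrier := quotients\<rparr>) (fraction_field R)"
proof (rule ring_iso_memI)
  show "bij_betw representatives (carrier (type_ring\<lparr>carrier := quotients\<rparr>)) (carrier (fraction_field R))"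
    using inj_on_representatives by (simp add: bij_betw_def carrier_fraction_field)
qed (simp_all add: carrier_fraction_field fraction_field_mult fraction_field_add fraction_field_one)

end

subsection \<open>Quotients by kernels\<close>

lemma ring_hom_ring_type_ring:
  fixes e :: "'r::comm_ring_1 \<Rightarrow> 's::comm_ring_1"
  assumes "comm_ring_hom e"
  shows "ring_hom_ring type_ring type_ring e"
proof -
  interpret comm_ring_hom e by fact
  show ?thesis
    by (rule ring_hom_ringI) (simp_all add: hom_add hom_mult cring.axioms(1)[OF cring_from_type_algebra])
qed

locale kernel_quotient = comm_ring_hom e for e :: "'r::comm_ring_1 \<Rightarrow> 'f::field" +
  fixes I :: "'r set"
  assumes kernel: "p \<in> I \<longleftrightarrow> e p = 0"
begin

sublocale hom_ring: ring_hom_ring type_ring type_ring e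
  by (rule ring_hom_ring_type_ring) (rule comm_ring_hom_axioms)

lemma I_eq_kernel: "I = a_kernel type_ring type_ring e"
  unfolding a_kernel_def' by (simp add: set_eq_iff kernel)

abbreviation quotient_ring where "quotient_ring \<equiv> FactRing type_ring I"
abbreviation coset_value where "coset_value A \<equiv> the_elem (e ` A)"

lemma coset_value: "coset_value (I +>\<^bsub>type_ring\<^esub> p) = e p"
  using hom_ring.the_elem_simp[of p] by (simp add: I_eq_kernel)

lemma coset_mem: "I +>\<^bsub>type_ring\<^esub> p \<in> carrier quotient_ring"
  by (auto simp: FactRing_def A_RCOSETS_def')

lemma coset_cases:
  assumes "A \<in> carrier quotient_ring"
  obtains p where "A = I +>\<^bsub>type_ring\<^esub> p"
  using assms by (auto simp: FactRing_def A_RCOSETS_def')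

sublocale ring_embedding quotient_ring coset_value
proof (intro ring_embedding.intro ring_embedding_axioms.intro ring_hom_ringI2)
  show "ring quotient_ring"
    unfolding I_eq_kernel by (rule ideal.quotient_is_ring[OF hom_ring.kernel_is_ideal])
  show "inj_on coset_value (carrier quotient_ring)"
    unfolding I_eq_kernel by (intro inj_onI) (rule hom_ring.the_elem_inj)
qed (simp_all add: cring.axioms(1)[OF cring_from_type_algebra] hom_ring.the_elem_hom I_eq_kernel)

lemma quotients_eq_fractions: "quotients = fractions e"
  unfolding quotients_def fractions_def
proof (intro Collect_cong iffI; elim exE conjE)
  fix z A B assume "A \<in> carrier quotient_ring" "B \<in> carrier quotient_ring"
    and AB: "coset_value B \<noteq> 0" "z = coset_value A / coset_value B"
  then obtain p q where "A = I +>\<^bsub>type_ring\<^esub> p" "B = I +>\<^bsub>type_ring\<^esub> q"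
    by (elim coset_cases)
  then show "\<exists>p q. z = e p / e q \<and> e q \<noteq> 0"
    using AB by (auto simp: coset_value)
next
  fix z p q assume "z = e p / e q" "e q \<noteq> 0"
  then show "\<exists>A B. z = coset_value A / coset_value B \<and>
      A \<in> carrier quotient_ring \<and> B \<in> carrier quotient_ring \<and> coset_value B \<noteq> 0"
    using coset_mem
    by (intro exI[of _ "I +>\<^bsub>type_ring\<^esub> p"] exI[of _ "I +>\<^bsub>type_ring\<^esub> q"])
       (simp add: coset_value)
qed

lemma field_fraction_field: "field (fraction_field quotient_ring)"
proof -
  have "is_subfield (fractions e)"
    by (rule is_subfield_fractions) (rule comm_ring_hom_axioms)
  then have "field (type_ring\<lparr>carrier := fractions e\<rparr>)"
    by (rule type_ring.subfield_iff(2))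
  from field.ring_iso_imp_img_field[OF this representatives_ring_iso[unfolded quotients_eq_fractions]]
  show ?thesis
    by (simp flip: fraction_field_zero)
qed

lemma frac_class_coset:
  "frac_class quotient_ring (I +>\<^bsub>type_ring\<^esub> p) \<one>\<^bsub>quotient_ring\<^esub> = representatives (e p)"
  by (subst frac_class_eq_representatives) (simp_all add: coset_mem coset_value)

end

section \<open>Degrees and isomorphisms\<close>

lemma ring_iso_dimension_iff:
  assumes "ring R" "ring R'" and "\<one>\<^bsub>R\<^esub> \<noteq> \<zero>\<^bsub>R\<^esub>" "\<one>\<^bsub>R'\<^esub> \<noteq> \<zero>\<^bsub>R'\<^esub>"
    and iso: "\<psi> \<in> ring_iso R R'" and S: "subfield S R" and E: "E \<subseteq> carrier R"
  shows "ring.dimension R' n (\<psi> ` S) (\<psi> ` E) \<longleftrightarrow> ring.dimension R n S E"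
proof
  have inv_iso: "inv_into (carrier R) \<psi> \<in> ring_iso R' R"
    by (rule ring_iso_set_sym[OF assms(1) iso])
  interpret \<psi>: ring_hom_ring R R' \<psi>
    by (rule ring_hom_ringI2[OF assms(1,2)]) (use iso in \<open>simp add: ring_iso_def\<close>)
  interpret inv: ring_hom_ring R' R "inv_into (carrier R) \<psi>"
    by (rule ring_hom_ringI2[OF assms(2,1)]) (use inv_iso in \<open>simp add: ring_iso_def\<close>)
  have inj: "inj_on \<psi> (carrier R)"
    using ring_iso_memE(5)[OF iso] by (simp add: bij_betw_def)
  show "ring.dimension R' n (\<psi> ` S) (\<psi> ` E)" if "ring.dimension R n S E"
    by (rule \<psi>.inj_hom_dimension[OF S assms(4) inj_on_subset[OF inj E] that])
  show "ring.dimension R n S E" if "ring.dimension R' n (\<psi> ` S) (\<psi> ` E)"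
  proof -
    have "inj_on (inv_into (carrier R) \<psi>) (\<psi> ` E)"
      by (rule inj_on_inv_into) (use E in blast)
    from inv.inj_hom_dimension[OF \<psi>.img_is_subfield(2)[OF S assms(4)] assms(3) this that]
    show ?thesis
      using inv_into_image_cancel[OF inj E] inv_into_image_cancel[OF inj subfieldE(3)[OF S]] by simp
  qed
qed

lemma dimension_restrict_carrier_iff:
  assumes L: "is_subfield L" and S: "is_subfield S" "S \<subseteq> L"
  shows "ring.dimension (type_ring\<lparr>carrier := L\<rparr>) n S L \<longleftrightarrow> has_degree n S L"
proof -
  let ?L = "type_ring\<lparr>carrier := L\<rparr>"
  have field_L: "field ?L"
    by (rule type_ring.subfield_iff(2)[OF L])
  interpret L: domain ?L
    using field_L by (rule field.axioms(1))
  have S_L: "subfield S ?L"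
    using type_ring.subfield_iff(2)[OF S(1)] S(2) by (intro L.subfield_iff(1)) simp_all
  interpret incl: ring_hom_ring ?L type_ring id
    by (rule ring_hom_ringI2[OF L.ring_axioms type_ring.ring_axioms], rule ring_hom_memI) auto
  have incl: "has_degree m S L" if "L.dimension m S L" for m
    using incl.inj_hom_dimension[OF S_L, of L m] that by simp
  show ?thesis
  proof (intro iffI incl)
    assume degree: "has_degree n S L"
    obtain Us where Us: "set Us \<subseteq> carrier type_ring" "type_ring.Span S Us = L"
      using type_ring.exists_base[OF S(1) degree] by blast
    then have "set Us \<subseteq> L"
      using type_ring.Span_base_incl[OF S(1) Us(1)] by simp
    moreover have "L.Span S Us = L"
      using type_ring.Span_consistent[OF subfieldE(1)[OF L]] Us(2) by simp
    ultimately have "L.finite_dimension S L"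
      using L.Span_finite_dimension[OF S_L, of Us] by simp
    then obtain m where m: "L.dimension m S L"
      unfolding L.finite_dimension_def by blast
    moreover have "m = n"
      by (rule type_ring.dimension_is_inj[OF S(1) incl[OF m] degree])
    ultimately show "L.dimension n S L"
      by simp
  qed
qed

section \<open>Models of the complete nonsingular curve\<close>

locale curve_model = function_field_in_one_variable j L t n
  for j :: "'k::alg_closed_field \<Rightarrow> 'f::field" and L t n +
  fixes F :: "('b, 'm) ring_scheme" and \<iota> :: "'k \<Rightarrow> 'b" and \<psi> :: "'f \<Rightarrow> 'b"
  assumes iso: "\<psi> \<in> ring_iso (type_ring\<lparr>carrier := L\<rparr>) F" and field_F: "field F"
    and \<iota>_eq: "\<iota> s = \<psi> (j s)" and infinite_places: "infinite (places j L)"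
begin

lemmas L_closed = subfield_closed[OF subfield_L]

sublocale F: field F
  by (rule field_F)

lemma carrier_F: "carrier F = \<psi> ` L"
  using ring_iso_memE(5)[OF iso] by (simp add: bij_betw_def)

lemma inj_on_\<psi>: "inj_on \<psi> L"
  using ring_iso_memE(5)[OF iso] by (simp add: bij_betw_def)

lemma \<psi>_eq_iff: "z \<in> L \<Longrightarrow> w \<in> L \<Longrightarrow> \<psi> z = \<psi> w \<longleftrightarrow> z = w"
  using inj_on_\<psi> by (rule inj_on_eq_iff)

lemma \<psi>_mem_image_iff: "z \<in> L \<Longrightarrow> P \<subseteq> L \<Longrightarrow> \<psi> z \<in> \<psi> ` P \<longleftrightarrow> z \<in> P"
  by (rule inj_on_image_mem_iff[OF inj_on_\<psi>])

lemma \<psi>_closed: "z \<in> L \<Longrightarrow> \<psi> z \<in> carrier F"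
  by (simp add: carrier_F)

lemma \<psi>_mult: "z \<in> L \<Longrightarrow> w \<in> L \<Longrightarrow> \<psi> (z * w) = \<psi> z \<otimes>\<^bsub>F\<^esub> \<psi> w"
  using ring_iso_memE(2)[OF iso] by simp

lemma \<psi>_add: "z \<in> L \<Longrightarrow> w \<in> L \<Longrightarrow> \<psi> (z + w) = \<psi> z \<oplus>\<^bsub>F\<^esub> \<psi> w"
  using ring_iso_memE(3)[OF iso] by simp

lemma \<psi>_one: "\<psi> 1 = \<one>\<^bsub>F\<^esub>"
  using ring_iso_memE(4)[OF iso] by simp

lemma \<psi>_zero: "\<psi> 0 = \<zero>\<^bsub>F\<^esub>"
proof -
  have "\<psi> 0 \<oplus>\<^bsub>F\<^esub> \<psi> 0 = \<psi> 0"
    using \<psi>_add[of 0 0] by (simp add: L_closed)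
  then show ?thesis
    using F.add.r_cancel_one[of "\<psi> 0" "\<psi> 0"] by (simp add: \<psi>_closed L_closed)
qed

lemma \<psi>_uminus: "z \<in> L \<Longrightarrow> \<psi> (- z) = \<ominus>\<^bsub>F\<^esub> \<psi> z"
  by (rule F.minus_equality[symmetric]) (simp_all add: \<psi>_closed \<psi>_zero L_closed flip: \<psi>_add)

lemma \<psi>_diff: "z \<in> L \<Longrightarrow> w \<in> L \<Longrightarrow> \<psi> (z - w) = \<psi> z \<ominus>\<^bsub>F\<^esub> \<psi> w"
  using \<psi>_add[of z "- w"] by (simp add: a_minus_def \<psi>_uminus L_closed)

lemma \<psi>_inverse: "z \<in> L \<Longrightarrow> z \<noteq> 0 \<Longrightarrow> \<psi> (inverse z) = inv\<^bsub>F\<^esub> \<psi> z"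
  by (rule F.comm_inv_char[symmetric]) (simp_all add: \<psi>_closed \<psi>_one L_closed flip: \<psi>_mult)

lemma has_morphism_degree_image_iff:
  assumes "is_subfield S" "S \<subseteq> L"
  shows "ring.dimension F m (\<psi> ` S) (carrier F) \<longleftrightarrow> has_degree m S L"
proof -
  let ?L = "type_ring\<lparr>carrier := L\<rparr>"
  have "field ?L"
    by (rule type_ring.subfield_iff(2)[OF subfield_L])
  then interpret L: field ?L .
  have "subfield S ?L"
    using type_ring.subfield_iff(2)[OF assms(1)] assms(2) by (intro L.subfield_iff(1)) simp_all
  then have "ring.dimension F m (\<psi> ` S) (\<psi> ` L) \<longleftrightarrow> ring.dimension ?L m S L"
    by (intro ring_iso_dimension_iff iso L.ring_axioms F.ring_axioms) simp_all
  then show ?thesis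
    by (simp add: carrier_F dimension_restrict_carrier_iff[OF subfield_L assms])
qed

subsection \<open>Points and values\<close>

lemma subring_image_iff:
  assumes "P \<subseteq> L"
  shows "subring (\<psi> ` P) F \<longleftrightarrow>
    1 \<in> P \<and> (\<forall>a\<in>P. - a \<in> P) \<and> (\<forall>a\<in>P. \<forall>b\<in>P. a + b \<in> P \<and> a * b \<in> P)"
proof -
  have image: "\<psi> z \<in> \<psi> ` P \<longleftrightarrow> z \<in> P" if "z \<in> L" for z
    using \<psi>_mem_image_iff[OF that assms] .
  have L: "z \<in> L" if "z \<in> P" for z
    using that assms by blast
  show ?thesis
  proof
    assume sub: "subring (\<psi> ` P) F"
    show "1 \<in> P \<and> (\<forall>a\<in>P. - a \<in> P) \<and> (\<forall>a\<in>P. \<forall>b\<in>P. a + b \<in> P \<and> a * b \<in> P)"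
      using subringE(3)[OF sub] subringE(5)[OF sub imageI] subringE(6,7)[OF sub imageI imageI] L
      by (simp add: L_closed image flip: \<psi>_one \<psi>_uminus \<psi>_add \<psi>_mult)
  next
    assume "1 \<in> P \<and> (\<forall>a\<in>P. - a \<in> P) \<and> (\<forall>a\<in>P. \<forall>b\<in>P. a + b \<in> P \<and> a * b \<in> P)"
    then show "subring (\<psi> ` P) F"
      by (intro F.subringI)
         (auto simp: carrier_F L simp flip: \<psi>_one \<psi>_uminus \<psi>_add \<psi>_mult)
  qed
qed

lemma image_in_curve_points_iff:
  assumes "P \<subseteq> L"
  shows "\<psi> ` P \<in> curve_points F \<iota> \<longleftrightarrow> P \<in> places j L"
proof -
  have subset: "\<psi> ` A \<subseteq> \<psi> ` B \<longleftrightarrow> A \<subseteq> B" if "A \<subseteq> L" "B \<subseteq> L" for A B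
    unfolding image_subset_iff using that \<psi>_mem_image_iff[of _ B] by blast
  have "range \<iota> = \<psi> ` range j"
    by (auto simp: \<iota>_eq)
  then have const: "range \<iota> \<subset> \<psi> ` P \<longleftrightarrow> range j \<subset> P"
    by (simp add: less_le_not_le subset range_L assms)
  have proper: "\<psi> ` P \<subset> carrier F \<longleftrightarrow> P \<noteq> L"
    using assms by (auto simp: less_le_not_le subset carrier_F)
  have inverses: "(\<forall>z\<in>carrier F - {\<zero>\<^bsub>F\<^esub>}. z \<in> \<psi> ` P \<or> inv\<^bsub>F\<^esub> z \<in> \<psi> ` P) \<longleftrightarrow>
      (\<forall>z\<in>L - {0}. z \<in> P \<or> inverse z \<in> P)"
  proof -
    have "carrier F - {\<zero>\<^bsub>F\<^esub>} = \<psi> ` (L - {0})"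
      using inj_on_image_set_diff[OF inj_on_\<psi>, of L "{0}"] by (simp add: carrier_F \<psi>_zero L_closed)
    then show ?thesis
      by (simp add: \<psi>_mem_image_iff assms L_closed flip: \<psi>_inverse)
  qed
  have one: "range j \<subset> P \<longrightarrow> 1 \<in> P"
  proof
    assume "range j \<subset> P"
    then have "j 1 \<in> P"
      by blast
    then show "1 \<in> P"
      by simp
  qed
  show ?thesis
    unfolding curve_points_def places_def mem_Collect_eq subring_image_iff[OF assms] const proper inverses
    using assms one unfolding psubset_eq by argo
qed

lemma curve_points_eq: "curve_points F \<iota> = (`) \<psi> ` places j L"
proof (intro equalityI subsetI)
  fix Q assume Q: "Q \<in> curve_points F \<iota>"
  define P where "P = {z \<in> L. \<psi> z \<in> Q}"
  have "Q \<subseteq> \<psi> ` L"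
    using Q by (auto simp: curve_points_def carrier_F)
  then have Q_eq: "Q = \<psi> ` P"
    by (auto simp: P_def)
  have "P \<subseteq> L"
    by (auto simp: P_def)
  then have "P \<in> places j L"
    using Q by (simp add: Q_eq image_in_curve_points_iff)
  with Q_eq show "Q \<in> (`) \<psi> ` places j L"
    by (rule image_eqI)
next
  fix Q assume "Q \<in> (`) \<psi> ` places j L"
  then obtain P where P: "P \<in> places j L" "Q = \<psi> ` P"
    by (elim imageE)
  then have "P \<subseteq> L"
    by (simp add: places_def)
  then show "Q \<in> curve_points F \<iota>"
    using P by (simp add: image_in_curve_points_iff)
qed

lemma inj_on_image_places: "inj_on ((`) \<psi>) (places j L)"
  using inj_on_\<psi> by (auto simp: inj_on_def places_def inj_on_image_eq_iff)

lemma curve_preimage_eq: "curve_preimage F \<iota> \<phi> V = (`) \<psi> ` {P \<in> places j L. \<phi> (\<psi> ` P) \<in> V}"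
  unfolding curve_preimage_def curve_points_eq by blast

lemma finite_curve_preimage_iff:
  "finite (curve_preimage F \<iota> \<phi> V) \<longleftrightarrow> finite {P \<in> places j L. \<phi> (\<psi> ` P) \<in> V}"
  unfolding curve_preimage_eq
  by (rule finite_image_iff) (rule inj_on_subset[OF inj_on_image_places], blast)

lemma max_ideal_at_image:
  assumes P: "P \<in> places j L" and w: "w \<in> L"
  shows "\<psi> w \<in> max_ideal_at F (\<psi> ` P) \<longleftrightarrow> w \<in> nonunits P"
proof -
  interpret place j L P by (rule placeI[OF P])
  have PL: "P \<subseteq> L"
    using mem_field by blast
  have "\<psi> w \<in> Units (F\<lparr>carrier := \<psi> ` P\<rparr>) \<longleftrightarrow> (\<exists>v\<in>P. v * w = 1)" if "w \<in> P"
    using that mem_field w L_closed(2)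
    by (simp add: Units_def \<psi>_eq_iff L_closed mult.commute[of w] flip: \<psi>_mult \<psi>_one cong: bex_cong)
  moreover have "(\<exists>v\<in>P. v * w = 1) \<longleftrightarrow> w \<noteq> 0 \<and> inverse w \<in> P"
    by (metis inverse_unique left_inverse mult.commute mult_zero_right zero_neq_one)
  ultimately show ?thesis
    using w by (auto simp: max_ideal_at_def nonunits_def \<psi>_mem_image_iff[OF _ PL])
qed

lemma has_value_at_iff:
  assumes P: "P \<in> places j L" and z: "z \<in> L"
  shows "has_value_at F \<iota> (\<psi> ` P) (\<psi> z) s \<longleftrightarrow> takes_value j P z s"
proof -
  have "P \<subseteq> L"
    using P by (simp add: places_def)
  then show ?thesis
    using max_ideal_at_image[OF P, of "z - j s"] z
    by (simp add: has_value_at_def takes_value_def \<iota>_eq \<psi>_mem_image_iff const_in_L L_closed flip: \<psi>_diff)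
qed

end

section \<open>Morphisms to the projective line\<close>

definition is_function_degree :: "('k::field \<Rightarrow> 'f::field) \<Rightarrow> 'f set \<Rightarrow> nat \<Rightarrow> bool" where
  "is_function_degree j L m \<longleftrightarrow> (\<exists>h. h \<in> L \<and> h \<notin> range j \<and> has_degree m (adjoin j h) L)"

context curve_model
begin

definition affine_coordinate :: "('b set \<Rightarrow> ('k \<times> 'k) set) \<Rightarrow> 'f \<Rightarrow> bool" where
  "affine_coordinate \<phi> h \<longleftrightarrow> h \<in> L \<and>
     (\<forall>P\<in>places j L. \<forall>s. \<phi> (\<psi> ` P) = finite_point s \<longrightarrow> takes_value j P h s)"

lemma affine_coordinate_mem: "affine_coordinate \<phi> h \<Longrightarrow> h \<in> L"
  by (simp add: affine_coordinate_def)

lemma affine_coordinate_takes_value: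
  "affine_coordinate \<phi> h \<Longrightarrow> P \<in> places j L \<Longrightarrow> \<phi> (\<psi> ` P) = finite_point s \<Longrightarrow> takes_value j P h s"
  by (simp add: affine_coordinate_def)

end

locale nonconstant_morphism = curve_model j L t n F \<iota> \<psi>
  for j :: "'k::alg_closed_field \<Rightarrow> 'f::field" and L t n
    and F :: "('b, 'm) ring_scheme" and \<iota> \<psi> +
  fixes \<phi> :: "'b set \<Rightarrow> ('k \<times> 'k) set"
  assumes morphism: "morphism_to_proj_line F \<iota> \<phi>" and nonconstant: "nonconstant_on_curve F \<iota> \<phi>"
begin

lemma finite_fiber:
  assumes "Q \<in> proj_line"
  shows "finite {P \<in> places j L. \<phi> (\<psi> ` P) = Q}"
proof -
  have "curve_closed F \<iota> (curve_preimage F \<iota> \<phi> {Q})"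
    using morphism proj_line_closed_singleton[OF assms] unfolding morphism_to_proj_line_def by blast
  moreover have "curve_preimage F \<iota> \<phi> {Q} \<noteq> curve_points F \<iota>"
    using nonconstant unfolding nonconstant_on_curve_def curve_preimage_def by blast
  ultimately have "finite (curve_preimage F \<iota> \<phi> {Q})"
    unfolding curve_closed_def by blast
  then show ?thesis
    by (simp add: finite_curve_preimage_iff)
qed

definition affine_preimage :: "('k \<times> 'k) set set \<Rightarrow> 'f set set" where
  "affine_preimage V =
     {P \<in> places j L. \<exists>s. \<phi> (\<psi> ` P) = finite_point s \<and> finite_point s \<in> V}"

lemma infinite_affine_preimage:
  assumes "proj_line_open V" "V \<noteq> {}"
  shows "infinite (affine_preimage V)"
proof
  assume "finite (affine_preimage V)"
  let ?D = "insert infinite_point (proj_line - V)"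
  have "places j L \<subseteq> affine_preimage V \<union> (\<Union>Q\<in>?D. {P \<in> places j L. \<phi> (\<psi> ` P) = Q})"
  proof
    fix P assume P: "P \<in> places j L"
    then have image: "\<phi> (\<psi> ` P) \<in> proj_line"
      using morphism unfolding morphism_to_proj_line_def curve_points_eq by blast
    show "P \<in> affine_preimage V \<union> (\<Union>Q\<in>?D. {P \<in> places j L. \<phi> (\<psi> ` P) = Q})"
    proof (cases "\<phi> (\<psi> ` P) \<in> ?D")
      case True
      then show ?thesis
        using P by simp
    next
      case False
      then have "\<phi> (\<psi> ` P) \<in> V"
        using image by simp
      from image show ?thesis
        by (cases rule: proj_line_cases)
           (use P False \<open>\<phi> (\<psi> ` P) \<in> V\<close> in \<open>simp_all add: affine_preimage_def\<close>)
    qed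
  qed
  moreover have "finite ?D"
    using proj_line_open_cofinite[OF assms] by simp
  then have "finite (\<Union>Q\<in>?D. {P \<in> places j L. \<phi> (\<psi> ` P) = Q})"
    by (intro finite_UN_I finite_fiber) (auto simp: proj_line_eq)
  ultimately show False
    using \<open>finite (affine_preimage V)\<close> infinite_places by (meson finite_UnI finite_subset)
qed

lemma affine_coordinate_exists:
  obtains h where "affine_coordinate \<phi> h"
proof -
  have "curve_regular_on F \<iota> (curve_preimage F \<iota> \<phi> (nonvanishing 1)) (ratio_function [:0, 1:] 1 \<circ> \<phi>)"
    using morphism proj_line_open_nonvanishing proj_line_regular_ratio_function
    unfolding morphism_to_proj_line_def by blast
  then obtain h where "h \<in> L" and h: "\<forall>P\<in>curve_preimage F \<iota> \<phi> (nonvanishing 1).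
      has_value_at F \<iota> P (\<psi> h) (ratio_function [:0, 1:] 1 (\<phi> P))"
    unfolding curve_regular_on_def carrier_F by auto
  have "takes_value j P h s" if P: "P \<in> places j L" and s: "\<phi> (\<psi> ` P) = finite_point s" for P s
  proof -
    have "\<psi> ` P \<in> curve_preimage F \<iota> \<phi> (nonvanishing 1)"
      using P s by (simp add: curve_preimage_eq nonvanishing_def)
    from bspec[OF h this] show ?thesis
      by (simp add: has_value_at_iff[OF P \<open>h \<in> L\<close>] s)
  qed
  then have "affine_coordinate \<phi> h"
    using \<open>h \<in> L\<close> by (simp add: affine_coordinate_def)
  then show ?thesis
    by (rule that)
qed

context
  fixes h
  assumes h: "affine_coordinate \<phi> h"
begin

lemma affine_coordinate_nonconstant: "h \<notin> range j"
proof
  assume "h \<in> range j"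
  then obtain b where b: "h = j b"
    by auto
  have "s = b" if P: "P \<in> places j L" and s: "\<phi> (\<psi> ` P) = finite_point s" for P s
    using place.takes_value_unique[OF placeI[OF P] affine_coordinate_takes_value[OF h P s]]
      place.takes_value_const[OF placeI[OF P]] b by simp
  then have "affine_preimage (nonvanishing 1) \<subseteq> {P \<in> places j L. \<phi> (\<psi> ` P) = finite_point b}"
    unfolding affine_preimage_def by blast
  moreover have "finite {P \<in> places j L. \<phi> (\<psi> ` P) = finite_point b}"
    by (rule finite_fiber) (simp add: proj_line_eq)
  ultimately show False
    using infinite_affine_preimage[OF proj_line_open_nonvanishing nonvanishing_nonempty[of 1]]
    by (simp add: finite_subset)
qed

lemma adjoin_coordinate_subset: "adjoin j h \<subseteq> L"
  by (intro adjoin_subset subfield_L range_L affine_coordinate_mem[OF h])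

lemma image_adjoin_subset_pullback_field: "\<psi> ` adjoin j h \<subseteq> pullback_field F \<iota> \<phi>"
proof (rule image_subsetI)
  fix z assume z: "z \<in> adjoin j h"
  then obtain p q where pq: "z = eval_poly j p h / eval_poly j q h" "eval_poly j q h \<noteq> 0"
    unfolding adjoin_def by (rule fractionsE)
  have "q \<noteq> 0"
    using pq(2) by auto
  have "z \<in> L"
    using z adjoin_coordinate_subset by blast
  have "has_value_at F \<iota> R (\<psi> z) (ratio_function p q (\<phi> R))"
    if R: "R \<in> curve_preimage F \<iota> \<phi> (nonvanishing q)" for R
  proof -
    obtain P s where P: "P \<in> places j L" "R = \<psi> ` P" and s: "\<phi> R = finite_point s" "poly q s \<noteq> 0"
      using R unfolding curve_preimage_eq nonvanishing_def by auto
    have "takes_value j P h s"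
      using affine_coordinate_takes_value[OF h P(1)] s(1) P(2) by simp
    then have "takes_value j P z (poly p s / poly q s)"
      unfolding pq(1)
      using place.takes_value_divide place.takes_value_eval_poly placeI[OF P(1)] s(2) by metis
    then show ?thesis
      using has_value_at_iff[OF P(1) \<open>z \<in> L\<close>] P(2) s(1) by simp
  qed
  then show "\<psi> z \<in> pullback_field F \<iota> \<phi>"
    unfolding pullback_field_def
    using \<psi>_closed[OF \<open>z \<in> L\<close>] proj_line_open_nonvanishing nonvanishing_nonempty[OF \<open>q \<noteq> 0\<close>]
      proj_line_regular_ratio_function by blast
qed

lemma in_adjoin_coordinate_if_agrees:
  assumes z: "z \<in> L" and U: "U \<noteq> {}" and rep: "represents_on d A B U g"
    and value_z: "\<And>P s. P \<in> places j L \<Longrightarrow> \<phi> (\<psi> ` P) = finite_point s \<Longrightarrow> finite_point s \<in> U \<Longrightarrow>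
      takes_value j P z (g (finite_point s))"
  shows "z \<in> adjoin j h"
proof -
  define w where "w = z * eval_poly j (form_poly d B) h - eval_poly j (form_poly d A) h"
  have eval_L: "eval_poly j p h \<in> L" for p
    by (intro eval_poly_in_subfield subfield_L range_L affine_coordinate_mem[OF h])
  have "w \<in> L"
    unfolding w_def by (intro L_closed z eval_L)
  have "w \<in> nonunits P" if affine: "P \<in> affine_preimage U" for P
  proof -
    obtain s where P: "P \<in> places j L" and s: "\<phi> (\<psi> ` P) = finite_point s" "finite_point s \<in> U"
      using affine unfolding affine_preimage_def by blast
    interpret P: place j L P by (rule placeI[OF P])
    have "takes_value j P w (g (finite_point s) * poly (form_poly d B) s - poly (form_poly d A) s)"
      unfolding w_def by (intro P.takes_value_diff P.takes_value_mult P.takes_value_eval_poly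
          value_z[OF P s] affine_coordinate_takes_value[OF h P s(1)])
    moreover have "g (finite_point s) * poly (form_poly d B) s - poly (form_poly d A) s = 0"
      using rep s(2) by (simp add: represents_on_def)
    ultimately show ?thesis
      by (simp add: P.takes_value_0_iff)
  qed
  then have "affine_preimage U \<subseteq> {P \<in> places j L. w \<in> nonunits P}"
    by (auto simp: affine_preimage_def)
  moreover have "infinite (affine_preimage U)"
    using rep U by (intro infinite_affine_preimage) (simp_all add: represents_on_def)
  ultimately have "infinite {P \<in> places j L. w \<in> nonunits P}"
    by (rule infinite_super)
  then have "w = 0"
    using finite_zeros[OF \<open>w \<in> L\<close>] by blast
  moreover have nonzero: "eval_poly j (form_poly d B) h \<noteq> 0"
    using rep by (simp add: eval_poly_eq_0_iff[OF affine_coordinate_nonconstant] represents_on_def)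
  ultimately have "z = eval_poly j (form_poly d A) h / eval_poly j (form_poly d B) h"
    by (simp add: w_def field_simps)
  then show ?thesis
    using fractionsI[of "\<lambda>p. eval_poly j p h" "form_poly d B"] nonzero by (simp add: adjoin_def)
qed

lemma pullback_field_subset_image_adjoin: "pullback_field F \<iota> \<phi> \<subseteq> \<psi> ` adjoin j h"
proof
  fix y assume "y \<in> pullback_field F \<iota> \<phi>"
  then obtain V g where "y \<in> carrier F" "V \<noteq> {}" and g: "proj_line_regular_on V g"
    and y: "\<forall>R\<in>curve_preimage F \<iota> \<phi> V. has_value_at F \<iota> R y (g (\<phi> R))"
    unfolding pullback_field_def by blast
  then obtain z where z: "z \<in> L" "y = \<psi> z"
    by (auto simp: carrier_F)
  obtain U d A B where U: "U \<noteq> {}" "U \<subseteq> V" and rep: "represents_on d A B U g"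
    using \<open>V \<noteq> {}\<close> proj_line_regular_representation[OF g] by (metis empty_iff ex_in_conv)
  have "takes_value j P z (g (finite_point s))"
    if P: "P \<in> places j L" and s: "\<phi> (\<psi> ` P) = finite_point s" "finite_point s \<in> U" for P s
  proof -
    have "\<psi> ` P \<in> curve_preimage F \<iota> \<phi> V"
      using P s U(2) by (auto simp: curve_preimage_eq)
    from bspec[OF y this] show ?thesis
      by (simp add: z(2) has_value_at_iff[OF P z(1)] s(1))
  qed
  then have "z \<in> adjoin j h"
    by (rule in_adjoin_coordinate_if_agrees[OF z(1) U(1) rep])
  then show "y \<in> \<psi> ` adjoin j h"
    by (simp add: z(2))
qed

lemma has_morphism_degree_iff: "has_morphism_degree F \<iota> \<phi> m \<longleftrightarrow> has_degree m (adjoin j h) L"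
proof -
  have "pullback_field F \<iota> \<phi> = \<psi> ` adjoin j h"
    using pullback_field_subset_image_adjoin image_adjoin_subset_pullback_field by (rule equalityI)
  then show ?thesis
    unfolding has_morphism_degree_def
    by (simp add: has_morphism_degree_image_iff is_subfield_adjoin adjoin_coordinate_subset)
qed

end

end

subsection \<open>The morphism defined by a function\<close>

context curve_model
begin

definition morphism_of :: "'f \<Rightarrow> 'b set \<Rightarrow> ('k \<times> 'k) set" where
  "morphism_of h Q = (let P = {z \<in> L. \<psi> z \<in> Q} in
     if h \<in> P then finite_point (SOME s. takes_value j P h s) else infinite_point)"

lemma morphism_of_image:
  assumes "P \<in> places j L"
  shows "morphism_of h (\<psi> ` P) =
    (if h \<in> P then finite_point (SOME s. takes_value j P h s) else infinite_point)"
proof -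
  have "P \<subseteq> L"
    using assms by (simp add: places_def)
  then have "{z \<in> L. \<psi> z \<in> \<psi> ` P} = P"
    using \<psi>_mem_image_iff by blast
  then show ?thesis
    by (simp add: morphism_of_def)
qed

lemma morphism_of_mem_proj_line: "morphism_of h Q \<in> proj_line"
  by (simp add: morphism_of_def Let_def proj_line_eq)

lemma morphism_of_eq_finite_point_iff:
  assumes P: "P \<in> places j L"
  shows "morphism_of h (\<psi> ` P) = finite_point s \<longleftrightarrow> takes_value j P h s"
proof (cases "h \<in> P")
  case True
  then have "takes_value j P h (SOME s. takes_value j P h s)"
    by (rule someI_ex[OF takes_value_if_mem[OF P]])
  then show ?thesis
    using place.takes_value_unique[OF placeI[OF P]] by (auto simp: morphism_of_image[OF P] True)
next
  case False
  then show ?thesis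
    using place.takes_value_mem[OF placeI[OF P]] by (auto simp: morphism_of_image[OF P])
qed

lemma morphism_of_eq_infinite_point_iff:
  "P \<in> places j L \<Longrightarrow> morphism_of h (\<psi> ` P) = infinite_point \<longleftrightarrow> h \<notin> P"
  by (simp add: morphism_of_image)

lemma finite_fiber_morphism_of:
  assumes h: "h \<in> L" "h \<notin> range j"
  shows "finite {P \<in> places j L. morphism_of h (\<psi> ` P) = Q}"
proof (cases "Q \<in> proj_line")
  case True
  then show ?thesis
  proof (cases rule: proj_line_cases)
    case (finite s)
    have "h - j s \<in> L" "h - j s \<noteq> 0"
      using h const_in_L by (auto simp: L_closed)
    then have "finite {P \<in> places j L. h - j s \<in> nonunits P}"
      by (rule finite_zeros)
    then show ?thesis
      by (rule finite_subset[rotated])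
         (auto simp: finite morphism_of_eq_finite_point_iff takes_value_def)
  next
    case infinite
    have "inverse h \<in> L" "inverse h \<noteq> 0"
      using h hom_zero by (auto simp: L_closed)
    then have "finite {P \<in> places j L. inverse h \<in> nonunits P}"
      by (rule finite_zeros)
    then show ?thesis
      by (rule finite_subset[rotated])
         (auto simp: infinite morphism_of_eq_infinite_point_iff intro: place.inverse_nonunit[OF placeI] h)
  qed
next
  case False
  then have "{P \<in> places j L. morphism_of h (\<psi> ` P) = Q} = {}"
    using morphism_of_mem_proj_line by blast
  then show ?thesis
    by (simp only: finite.emptyI)
qed

lemma eval_form_poly_reverse:
  assumes "h \<noteq> 0"
  shows "eval_poly j (form_poly d A) h = h ^ d * eval_poly j (form_poly d (\<lambda>i. A (d - i))) (inverse h)"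
proof -
  have "eval_poly j (form_poly d A) h = (\<Sum>i\<le>d. j (A i) * h ^ i)"
    by (simp add: eval_poly_eq_sum[OF degree_form_poly] coeff_form_poly)
  also have "\<dots> = (\<Sum>i\<le>d. j (A (d - i)) * h ^ (d - i))"
    using sum.nat_diff_reindex[of "\<lambda>i. j (A i) * h ^ i" "Suc d"]
    by (simp add: lessThan_Suc_atMost)
  also have "\<dots> = (\<Sum>i\<le>d. h ^ d * (j (A (d - i)) * inverse h ^ i))"
  proof (rule sum.cong)
    fix i assume "i \<in> {..d}"
    then have "h ^ d = h ^ (d - i) * h ^ i"
      by (simp flip: power_add)
    then show "j (A (d - i)) * h ^ (d - i) = h ^ d * (j (A (d - i)) * inverse h ^ i)"
      using assms by (simp add: field_simps)
  qed simp
  also have "\<dots> = h ^ d * eval_poly j (form_poly d (\<lambda>i. A (d - i))) (inverse h)"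
    by (simp add: eval_poly_eq_sum[OF degree_form_poly] coeff_form_poly sum_distrib_left)
  finally show ?thesis .
qed

lemma takes_value_ratio_at_pole:
  assumes P: "P \<in> places j L" and h: "h \<in> L" "h \<notin> P" and "B d \<noteq> 0"
  shows "takes_value j P (eval_poly j (form_poly d A) h / eval_poly j (form_poly d B) h) (A d / B d)"
proof -
  interpret P: place j L P by (rule placeI[OF P])
  have "h \<noteq> 0"
    using h P.zero_mem by auto
  have "takes_value j P (inverse h) 0"
    using h by (simp add: P.takes_value_0_iff P.inverse_nonunit)
  moreover have "poly (form_poly d (\<lambda>i. C (d - i))) 0 = C d" for C :: "nat \<Rightarrow> 'k"
    by (simp add: poly_0_coeff_0 coeff_form_poly)
  ultimately have value_at_0:
    "takes_value j P (eval_poly j (form_poly d (\<lambda>i. C (d - i))) (inverse h)) (C d)" for C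
    using P.takes_value_eval_poly[of "inverse h" 0 "form_poly d (\<lambda>i. C (d - i))"] by simp
  show ?thesis
    unfolding eval_form_poly_reverse[OF \<open>h \<noteq> 0\<close>, of d A] eval_form_poly_reverse[OF \<open>h \<noteq> 0\<close>, of d B]
    using P.takes_value_divide[OF value_at_0[of A] value_at_0[of B] \<open>B d \<noteq> 0\<close>] \<open>h \<noteq> 0\<close> by simp
qed

lemma takes_value_representation:
  assumes h: "h \<in> L" and P: "P \<in> places j L"
    and rep: "represents_on d A B U g" "morphism_of h (\<psi> ` P) \<in> U"
  shows "takes_value j P (eval_poly j (form_poly d A) h / eval_poly j (form_poly d B) h)
    (g (morphism_of h (\<psi> ` P)))"
proof (cases "h \<in> P")
  case True
  then obtain s where s: "takes_value j P h s"
    using takes_value_if_mem[OF P] by blast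
  then have image: "morphism_of h (\<psi> ` P) = finite_point s"
    by (simp add: morphism_of_eq_finite_point_iff[OF P])
  interpret P: place j L P by (rule placeI[OF P])
  have "poly (form_poly d B) s \<noteq> 0"
    "g (finite_point s) = poly (form_poly d A) s / poly (form_poly d B) s"
    using rep by (simp_all add: represents_on_def image)
  then show ?thesis
    using s by (simp add: image P.takes_value_divide P.takes_value_eval_poly)
next
  case False
  then have image: "morphism_of h (\<psi> ` P) = infinite_point"
    by (simp add: morphism_of_eq_infinite_point_iff[OF P])
  have "B d \<noteq> 0" "g infinite_point = A d / B d"
    using rep by (simp_all add: represents_on_def image)
  then show ?thesis
    using takes_value_ratio_at_pole[OF P h False] by (simp add: image)
qed

lemma morphism_of_regular:
  assumes h: "h \<in> L" "h \<notin> range j" and g: "proj_line_regular_on V g"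
  shows "curve_regular_on F \<iota> (curve_preimage F \<iota> (morphism_of h) V) (g \<circ> morphism_of h)"
proof (cases "V = {}")
  case True
  then show ?thesis
    using L_closed(1) by (auto simp: curve_regular_on_def curve_preimage_def carrier_F)
next
  case False
  then obtain U d A B where rep: "U \<noteq> {}" "represents_on d A B U g"
    using proj_line_regular_representation[OF g] by (metis empty_iff ex_in_conv)
  define r where "r = eval_poly j (form_poly d A) h / eval_poly j (form_poly d B) h"
  interpret eval: comm_ring_hom "\<lambda>p. eval_poly j p h"
    by (rule comm_ring_hom_eval_poly)
  have "r \<in> L"
    unfolding r_def by (intro L_closed eval_poly_in_subfield subfield_L range_L h)
  have "takes_value j P r (g (morphism_of h (\<psi> ` P)))"
    if P: "P \<in> places j L" and PV: "morphism_of h (\<psi> ` P) \<in> V" for P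
  proof -
    obtain U' d' A' B' where U': "morphism_of h (\<psi> ` P) \<in> U'" "U' \<subseteq> V"
      and rep': "represents_on d' A' B' U' g"
      by (rule proj_line_regular_representation[OF g PV])
    then have "U' \<noteq> {}"
      by blast
    have "eval_poly j (form_poly d A * form_poly d' B') h =
        eval_poly j (form_poly d' A' * form_poly d B) h"
      using representations_cross_multiply[OF rep(2,1) rep' \<open>U' \<noteq> {}\<close>] by simp
    moreover have "eval_poly j (form_poly d B) h \<noteq> 0" "eval_poly j (form_poly d' B') h \<noteq> 0"
      using rep(2) rep' by (simp_all add: represents_on_def eval_poly_eq_0_iff[OF h(2)])
    ultimately have "r = eval_poly j (form_poly d' A') h / eval_poly j (form_poly d' B') h"
      by (simp add: r_def eval.hom_mult frac_eq_eq)
    then show ?thesis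
      using takes_value_representation[OF h(1) P rep' U'(1)] by simp
  qed
  then have "\<forall>R\<in>curve_preimage F \<iota> (morphism_of h) V. has_value_at F \<iota> R (\<psi> r) ((g \<circ> morphism_of h) R)"
    using \<open>r \<in> L\<close> by (auto simp: curve_preimage_eq has_value_at_iff)
  then show ?thesis
    unfolding curve_regular_on_def using \<psi>_closed[OF \<open>r \<in> L\<close>] by blast
qed

lemma morphism_of_continuous:
  assumes h: "h \<in> L" "h \<notin> range j" and Z: "proj_line_closed Z"
  shows "curve_closed F \<iota> (curve_preimage F \<iota> (morphism_of h) Z)"
  using Z
proof (cases rule: proj_line_closed_cases)
  case 1
  then show ?thesis
    using morphism_of_mem_proj_line by (auto simp: curve_closed_def curve_preimage_def)
next
  case 2
  have "{P \<in> places j L. morphism_of h (\<psi> ` P) \<in> Z} =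
      (\<Union>Q\<in>Z. {P \<in> places j L. morphism_of h (\<psi> ` P) = Q})"
    by blast
  then have "finite (curve_preimage F \<iota> (morphism_of h) Z)"
    using 2(1) finite_fiber_morphism_of[OF h] by (simp add: finite_curve_preimage_iff)
  then show ?thesis
    by (auto simp: curve_closed_def curve_preimage_def)
qed

lemma morphism_of_nonconstant:
  assumes h: "h \<in> L" "h \<notin> range j"
  shows "nonconstant_on_curve F \<iota> (morphism_of h)"
proof (rule ccontr)
  assume const: "\<not> ?thesis"
  obtain P where P: "P \<in> places j L"
    using infinite_places by fastforce
  then have "places j L \<subseteq> {P' \<in> places j L. morphism_of h (\<psi> ` P') = morphism_of h (\<psi> ` P)}"
    using const unfolding nonconstant_on_curve_def curve_points_eq by blast
  then have "infinite {P' \<in> places j L. morphism_of h (\<psi> ` P') = morphism_of h (\<psi> ` P)}"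
    using infinite_places by (rule infinite_super)
  then show False
    using finite_fiber_morphism_of[OF h] by blast
qed

lemma nonconstant_morphism_of:
  assumes "h \<in> L" "h \<notin> range j"
  shows "nonconstant_morphism j L t n F \<iota> \<psi> (morphism_of h)"
proof (intro nonconstant_morphism.intro nonconstant_morphism_axioms.intro curve_model_axioms)
  show "morphism_to_proj_line F \<iota> (morphism_of h)"
    unfolding morphism_to_proj_line_def
    using morphism_of_mem_proj_line morphism_of_continuous morphism_of_regular assms by blast
  show "nonconstant_on_curve F \<iota> (morphism_of h)"
    by (rule morphism_of_nonconstant[OF assms])
qed

lemma affine_coordinate_morphism_of: "h \<in> L \<Longrightarrow> affine_coordinate (morphism_of h) h"
  by (simp add: affine_coordinate_def morphism_of_eq_finite_point_iff)

theorem gonality_eq: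
  "gonality F \<iota> = (LEAST m. is_function_degree j L m)"
  unfolding gonality_def
proof (intro arg_cong[where f = Least] ext iffI)
  fix m
  assume "\<exists>\<phi>. morphism_to_proj_line F \<iota> \<phi> \<and> nonconstant_on_curve F \<iota> \<phi> \<and> has_morphism_degree F \<iota> \<phi> m"
  then obtain \<phi> where \<phi>: "morphism_to_proj_line F \<iota> \<phi>" "nonconstant_on_curve F \<iota> \<phi>"
    and degree_\<phi>: "has_morphism_degree F \<iota> \<phi> m"
    by blast
  interpret nonconstant_morphism j L t n F \<iota> \<psi> \<phi>
    by (intro nonconstant_morphism.intro nonconstant_morphism_axioms.intro curve_model_axioms \<phi>)
  obtain h where h: "affine_coordinate \<phi> h"
    by (rule affine_coordinate_exists)
  show "is_function_degree j L m"
    unfolding is_function_degree_def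
    using affine_coordinate_mem[OF h] affine_coordinate_nonconstant[OF h]
      has_morphism_degree_iff[OF h] degree_\<phi> by blast
next
  fix m
  assume "is_function_degree j L m"
  then obtain h where h: "h \<in> L" "h \<notin> range j" and degree_h: "has_degree m (adjoin j h) L"
    unfolding is_function_degree_def by blast
  interpret nonconstant_morphism j L t n F \<iota> \<psi> "morphism_of h"
    by (rule nonconstant_morphism_of[OF h])
  have "has_morphism_degree F \<iota> (morphism_of h) m"
    using has_morphism_degree_iff[OF affine_coordinate_morphism_of[OF h(1)]] degree_h by blast
  then show "\<exists>\<phi>. morphism_to_proj_line F \<iota> \<phi> \<and> nonconstant_on_curve F \<iota> \<phi> \<and> has_morphism_degree F \<iota> \<phi> m"
    using morphism nonconstant by blast
qed

end

section \<open>The gonality of the preimage curve\<close>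

context preimage_field
begin

lemma kernel_quotient_preimage_ideal: "kernel_quotient (eval_poly2 j x c) (preimage_ideal N a)"
  by (intro kernel_quotient.intro kernel_quotient_axioms.intro eval.comm_ring_hom_axioms)
     (auto simp: preimage_ideal_def cgenideal_def kernel dvd_def mult.commute)

lemma curve_model:
  assumes "function_field_in_one_variable j L t n"
  shows "curve_model j L t n (function_field N a) (constant_function N a)
    (ring_embedding.representatives (coordinate_ring N a) (\<lambda>A. the_elem (eval_poly2 j x c ` A)))"
proof -
  interpret kernel_quotient "eval_poly2 j x c" "preimage_ideal N a"
    by (rule kernel_quotient_preimage_ideal)
  have "coordinate_ring N a = quotient_ring"
    by (simp add: coordinate_ring_def)
  then show ?thesis
    using representatives_ring_iso field_fraction_field infinite_places frac_class_coset
    by (intro curve_model.intro curve_model_axioms.intro assms)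
       (simp_all add: function_field_def constant_function_def quotients_eq_fractions adjoin2_def)
qed

theorem gonality_function_field:
  assumes "N \<ge> 2"
  shows "gonality (function_field N a) (constant_function N a) = 2 ^ (N - 2)"
proof -
  obtain t n where field: "function_field_in_one_variable j L t n" and n: "n \<le> 2 ^ (N - 2)"
    by (rule function_of_small_degree[OF assms])
  interpret function_field_in_one_variable j L t n by fact
  have lower: "2 ^ (N - 2) \<le> m" if "is_function_degree j L m" for m
    using that degree_lower_bound[OF preimage_field_axioms assms]
    unfolding is_function_degree_def by blast
  have upper: "is_function_degree j L n"
    unfolding is_function_degree_def using t degree by blast
  have "n = 2 ^ (N - 2)"
    using n lower[OF upper] by (rule order.antisym)
  then have "(LEAST m. is_function_degree j L m) = 2 ^ (N - 2)"
    using upper lower by (intro Least_equality) simp_all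
  then show ?thesis
    using curve_model.gonality_eq[OF curve_model[OF field]] by simp
qed

end

lemma curve_param_exists:
  fixes a :: "'k::alg_closed_field"
  assumes simple: "critical_roots_simple N a" and "N > 0"
  obtains \<xi> \<eta> where "curve_param N a \<xi> \<eta>"
proof -
  obtain M where M: "N = Suc M"
    using \<open>N > 0\<close> by (cases N) auto
  obtain c0 where c0: "poly (crit_poly (Suc M) a) c0 = 0"
    by (rule crit_poly_Suc_root)
  obtain \<gamma> where "curve_param M a (\<gamma> + fps_X) \<gamma>"
    by (rule curve_param_at_critical_root[OF c0 critical_roots_simpleD[OF simple[unfolded M] c0]])
  then show ?thesis
    using that unfolding M by (rule even_curve_param)
qed

lemma preimage_field_fls:
  fixes a :: "'k::alg_closed_field"
  assumes two: "(2 :: 'k) \<noteq> 0" and simple: "critical_roots_simple N a" and param: "curve_param N a \<xi> \<eta>"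
  shows "preimage_field fls_const (fps_to_fls \<xi>) (fps_to_fls \<eta>) N a"
proof -
  interpret const: comm_ring_hom "fps_const :: 'k \<Rightarrow> 'k fps"
    by (rule comm_ring_hom_fps_const)
  have "field_hom (fls_const :: 'k \<Rightarrow> 'k fls)"
    by unfold_locales (simp_all add: fls_plus_const fls_const_mult_const)
  moreover have "eval_poly2 fls_const (fps_to_fls \<xi>) (fps_to_fls \<eta>) p = 0 \<longleftrightarrow>
      preimage_poly N a dvd p" for p
  proof -
    have "eval_poly2 fls_const (fps_to_fls \<xi>) (fps_to_fls \<eta>) p = fps_to_fls (eval_poly2 fps_const \<xi> \<eta> p)"
      using const.hom_eval_poly2[OF comm_ring_hom_fps_to_fls, of \<xi> \<eta> p] by simp
    then show ?thesis
      by (simp add: curve_param_eval_eq_0_iff[OF prime_elem_preimage_poly[OF simple] param])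
  qed
  ultimately show ?thesis
    by (intro preimage_field.intro alg_closed_embedding.intro preimage_field_axioms.intro two simple)
qed

lemma two_nonzero_if_CHAR_neq_2:
  assumes "CHAR('a::idom) \<noteq> 2"
  shows "(2 :: 'a) \<noteq> 0"
proof
  assume "(2 :: 'a) = 0"
  then have "CHAR('a) dvd 2"
    using of_nat_eq_0_iff_char_dvd[where 'a = 'a, of 2] by simp
  then have "CHAR('a) = 1"
    using assms by (metis prime_nat_iff two_is_prime_nat)
  then show False
    by simp
qed

theorem theorem3p6:
  fixes a :: "'k::alg_closed_field" and N :: nat
  assumes "CHAR('k) \<noteq> 2"
    and "N \<ge> 2"
    and "preimage_curve_nonsingular N a"
  shows "gonality (function_field N a) (constant_function N a) = 2 ^ (N - 2)"
proof -
  have two: "(2 :: 'k) \<noteq> 0"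
    by (rule two_nonzero_if_CHAR_neq_2[OF assms(1)])
  have simple: "critical_roots_simple N a"
    by (rule critical_roots_simple_if_nonsingular[OF assms(3)])
  obtain \<xi> \<eta> where param: "curve_param N a \<xi> \<eta>"
    by (rule curve_param_exists[OF simple]) (use assms(2) in simp)
  interpret preimage_field fls_const "fps_to_fls \<xi>" "fps_to_fls \<eta>" N a
    by (rule preimage_field_fls[OF two simple param])
  show ?thesis
    by (rule gonality_function_field[OF assms(2)])
qed

end
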